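(* Let $R>0$, let $y_0\in L^2(\Omega)$, let $\rho,\rho_0$ be the Carleman weights described in the context and let $\rho_R:=\min(R,\rho)$. Consider the primal problem of minimizing $$I_R(v):=\overline F_R(Mv)+G(v)\quad\text{over }v\in\mathcal U,\tag{P}$$ the dual problem of maximizing $-\Phi_R^*(0,q)$ over $q\in L^2(Q)$, (D), where $$\Phi_R^*(0,q)=\frac12\iint_Q\rho_R^{-2}|q|^2\,dx\,dt+\frac12\iint_{Q_\omega}\rho_0^{-2}|M^*q|^2\,dx\,dt+\iint_Q q\,\overline y\,dx\,dt,$$ and the Lagrangian, for $(v,q)\in\mathcal U\times L^2(Q)$, $$L_R(v,q)=\frac12\iint_{Q_\omega}\rho_0^2|v|^2\,dx\,dt-\frac12\iint_Q\rho_R^{-2}|q|^2\,dx\,dt-\iint_Q q\,(Mv+\overline y)\,dx\,dt .$$ Then: 1. Problems (P) and (D) are uniquely solvable. 2. $\displaystyle\inf_{v\in\mathcal U}I_R(v)=\inf_{v\in\mathcal U}\sup_{q\in L^2(Q)}L_R(v,q)$ and $\displaystyle\sup_{q\in L^2(Q)}\bigl(-\Phi_R^*(0,q)\bigr)=\sup_{q\in L^2(Q)}\inf_{v\in\mathcal U}L_R(v,q)$. 3. If $v_R\in\mathcal U$ and $q_R\in L^2(Q)$ are the solutions of (P) and (D) respectively, then $(v_R,q_R)$ is the unique saddle-point of $L_R$ in $\mathcal U\times L^2(Q)$ (i.e. the unique couple with $L_R(v_R,q)\le L_R(v_R,q_R)\le L_R(v,q_R)$ for all $v\in\mathcal U$,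 $q\in L^2(Q)$), and $$\inf_{v\in\mathcal U}\sup_{q\in L^2(Q)}L_R(v,q)=L_R(v_R,q_R)=\sup_{q\in L^2(Q)}\inf_{v\in\mathcal U}L_R(v,q).$$ 4. The following optimality conditions hold: $$\overline F_R(Mv_R)+\overline F_R^*(-q_R)=-(Mv_R,q_R)_{L^2(Q)},\qquad G(v_R)+G^*(M^*q_R)=\langle M^*q_R,v_R\rangle_{\mathcal U',\mathcal U}.$$ Consequently, setting $y_R:=Mv_R+\overline y$, one has $$y_R=-\rho_R^{-2}q_R,\qquad v_R=\rho_0^{-2}M^*q_R .$$
   Context: Setting. $\Omega\subset\mathbb R^d$ ($d\ge1$) is a bounded domain with $C^2$ boundary, $T>0$, $\omega\subset\Omega$ is a non-empty open set, $Q=\Omega\times(0,T)$, $\Sigma=\partial\Omega\times(0,T)$, $Q_\omega=\omega\times(0,T)$. Coefficients: $a\in W^{1,\infty}(Q)$ with $a\ge a_0>0$ in $Q$, and $b\in L^\infty(Q)$. Operators: $Ly=\partial_t y-\mathrm{div}(a\nabla y)+by$ and $L^*z=-\partial_t z-\mathrm{div}(a\nabla z)+bz$. $M:L^2(Q_\omega)\to L^2(Q)$ sends $v$ to the weak solution $y$ of $Ly=v\mathbb 1_\omega$ in $Q$, $y=0$ on $\Sigma$, $y(\cdot,0)=0$ in $\Omega$ (here $v\mathbb 1_\omega$ is the extension of $v$ by zero). Its adjoint $M^*:L^2(Q)\to L^2(Q_\omega)$ is $M^*q=z|_{Q_\omega}$, where $z$ is the weak solution of $L^*z=q$ in $Q$,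 $z=0$ on $\Sigma$, $z(\cdot,T)=0$ in $\Omega$. $\overline y$ is the weak solution of $L\overline y=0$ in $Q$, $\overline y=0$ on $\Sigma$, $\overline y(\cdot,0)=y_0$ in $\Omega$. Weights. $\eta^0\in C^2(\overline\Omega)$ satisfies $\eta^0=0$ on $\partial\Omega$, $|\nabla\eta^0|>0$ in $\Omega\setminus\overline\omega$, $\partial_\nu\eta^0<0$ on $\partial\Omega$. With constants $K_1,K_2>0$ sufficiently large, $$\alpha(x,t)=K_1\frac{e^{K_2}-e^{\eta^0(x)}}{T-t},\quad \rho=e^{\alpha},\quad \rho_0=(T-t)^{3/2}\rho .$$ In particular $\rho,\rho_0$ are continuous in $Q$, bounded below by some $\rho_*>0$, and $\min_{x\in\overline\Omega}\rho(x,t)\to+\infty$, $\min_{x\in\overline\Omega}\rho_0(x,t)\to+\infty$ as $t\to T^-$. Spaces and functionals. $\mathcal U=\{v\in L^2(Q_\omega):\rho_0v\in L^2(Q_\omega)\}$, a Hilbert space with norm $\|\rho_0v\|_{L^2(Q_\omega)}$; $\mathcal U'$ is its dual, identified with $\{w:\rho_0^{-1}w\in L^2(Q_\omega)\}$ through the pairing $\langle w,v\rangle_{\mathcal U',\mathcal U}=\iint_{Q_\omega}wv\,dx\,dt$ (so $L^2(Q_\omega)\subset\mathcal U'$). Furthermore $$\overline F_R(z)=\frac12\iint_Q\rho_R^2|z+\overline y|^2\,dx\,dt\ (z\in L^2(Q)),\qquad G(v)=\frac12\iint_{Q_\omega}\rho_0^2|v|^2\,dx\,dt\ (v\in\mathcal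 U),$$ with convex conjugates $$\overline F_R^*(u)=\frac12\iint_Q\rho_R^{-2}|u|^2\,dx\,dt-\iint_Q\overline y\,u\,dx\,dt,\qquad G^*(w)=\frac12\iint_{Q_\omega}\rho_0^{-2}|w|^2\,dx\,dt .$$ *)

theory Defs
  imports "HOL-Analysis.Analysis"
begin

section \<open>Lebesgue spaces and test functions\<close>

text \<open>
  Elements of Lebesgue spaces over \<open>S\<close> are represented by functions on the whole type; their
  values outside \<open>S\<close> are irrelevant, and equality of elements is equality almost everywhere
  on \<open>S\<close>. Every class of Lebesgue measurable functions has a Borel representative, so
  \<^const>\<open>lborel\<close> yields the usual spaces.
\<close>

abbreviation lborel_on :: "'b::euclidean_space set \<Rightarrow> 'b measure" where
  "lborel_on S \<equiv> restrict_space lborel S"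

definition L2 :: "'b::euclidean_space set \<Rightarrow> ('b \<Rightarrow> 'c::euclidean_space) set" where
  "L2 S = {f. f \<in> borel_measurable (lborel_on S) \<and> integrable (lborel_on S) (\<lambda>x. (norm (f x))\<^sup>2)}"

definition Linf :: "'b::euclidean_space set \<Rightarrow> ('b \<Rightarrow> 'c::euclidean_space) set" where
  "Linf S = {f. f \<in> borel_measurable (lborel_on S) \<and> (\<exists>B. AE x in lborel_on S. norm (f x) \<le> B)}"

definition pairing :: "'b::euclidean_space set \<Rightarrow> ('b \<Rightarrow> real) \<Rightarrow> ('b \<Rightarrow> real) \<Rightarrow> real" where
  "pairing S u v = (LINT x|lborel_on S. u x * v x)"

definition grad :: "('b::euclidean_space \<Rightarrow> real) \<Rightarrow> 'b \<Rightarrow> 'b" where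
  "grad f x = (THE D. GDERIV f x :> D)"

text \<open>\<open>C\<^sup>1\<close> functions with compact support in the open set \<open>S\<close>.\<close>

definition C1c :: "'b::euclidean_space set \<Rightarrow> ('b \<Rightarrow> real) set" where
  "C1c S = {\<phi>. (\<exists>g. continuous_on UNIV g \<and> (\<forall>x. GDERIV \<phi> x :> g x)) \<and>
                compact (closure {x. \<phi> x \<noteq> 0}) \<and> closure {x. \<phi> x \<noteq> 0} \<subseteq> S}"

definition W1inf :: "'b::euclidean_space set \<Rightarrow> ('b \<Rightarrow> real) set" where
  "W1inf S = {f. f \<in> Linf S \<and>
     (\<exists>g \<in> Linf S. \<forall>\<phi> \<in> C1c S.
        (LINT x|lborel_on S. f x *\<^sub>R grad \<phi> x) = - (LINT x|lborel_on S. \<phi> x *\<^sub>R g x))}"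


section \<open>Domains\<close>

text \<open>
  \<open>f \<in> C\<^sup>2(closure S)\<close> with gradient \<open>g\<close>: the derivatives up to order two exist in the open set
  \<open>S\<close> and extend continuously to the closure; on the boundary \<open>g\<close> is that extension.
\<close>

definition C2_closure :: "'b::euclidean_space set \<Rightarrow> ('b \<Rightarrow> real) \<Rightarrow> ('b \<Rightarrow> 'b) \<Rightarrow> bool" where
  "C2_closure S f g \<longleftrightarrow> (\<exists>H :: 'b \<Rightarrow> 'b \<Rightarrow>\<^sub>L 'b.
     continuous_on (closure S) f \<and> continuous_on (closure S) g \<and> continuous_on (closure S) H \<and>
     (\<forall>x\<in>S. GDERIV f x :> g x \<and> (g has_derivative blinfun_apply (H x)) (at x)))"

text \<open>
  Near each boundary point, \<open>S\<close> is the strict epigraph, in some direction \<open>e\<close>, of a \<open>C\<^sup>2\<close> function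
  of the component orthogonal to \<open>e\<close>.
\<close>

definition C2_boundary :: "'b::euclidean_space set \<Rightarrow> bool" where
  "C2_boundary S \<longleftrightarrow> (\<forall>x0\<in>frontier S. \<exists>r>0. \<exists>e \<gamma> g. norm e = 1 \<and> C2_closure UNIV \<gamma> g \<and>
     S \<inter> ball x0 r = {x \<in> ball x0 r. \<gamma> (x - (x \<bullet> e) *\<^sub>R e) < x \<bullet> e})"

definition bounded_C2_domain :: "'b::euclidean_space set \<Rightarrow> bool" where
  "bounded_C2_domain S \<longleftrightarrow> S \<noteq> {} \<and> open S \<and> connected S \<and> bounded S \<and> C2_boundary S"

text \<open>
  \<open>\<nu>\<close> is the outward unit normal at the boundary point \<open>x\<close>: to first order at \<open>x\<close>, \<open>S\<close> is the
  half-space \<open>{y. (y - x) \<bullet> \<nu> < 0}\<close>.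
\<close>

definition outward_normal :: "'b::euclidean_space set \<Rightarrow> 'b \<Rightarrow> 'b \<Rightarrow> bool" where
  "outward_normal S x \<nu> \<longleftrightarrow> norm \<nu> = 1 \<and>
     (\<forall>\<epsilon>>0. \<exists>\<delta>>0. \<forall>y\<in>ball x \<delta>.
        ((y - x) \<bullet> \<nu> < - \<epsilon> * norm (y - x) \<longrightarrow> y \<in> S) \<and>
        ((y - x) \<bullet> \<nu> > \<epsilon> * norm (y - x) \<longrightarrow> y \<notin> closure S))"


section \<open>Weak solutions\<close>

text \<open>
  Space-time points are pairs \<open>(x, t)\<close>, so \<^term>\<open>fst (grad \<phi> z)\<close> and \<^term>\<open>snd (grad \<phi> z)\<close> are the
  spatial gradient and the time derivative of \<open>\<phi>\<close> at \<open>z\<close>.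
\<close>

text \<open>
  \<open>y \<in> L\<^sup>2(0,T; H\<^sup>1\<^sub>0(\<Omega>))\<close> with spatial gradient \<open>p\<close>. This space is the closure, in the norm of
  \<open>L\<^sup>2(0,T; H\<^sup>1(\<Omega>))\<close>, of the \<open>C\<^sup>1\<close> functions vanishing near the lateral boundary.
\<close>

definition energy_space ::
  "'a::euclidean_space set \<Rightarrow> real \<Rightarrow> ('a \<times> real \<Rightarrow> real) \<Rightarrow> ('a \<times> real \<Rightarrow> 'a) \<Rightarrow> bool" where
  "energy_space \<Omega> T y p \<longleftrightarrow> (let Q = \<Omega> \<times> {0<..<T} in
     y \<in> L2 Q \<and> p \<in> L2 Q \<and>
     (\<exists>\<phi>. (\<forall>n::nat. \<phi> n \<in> C1c (\<Omega> \<times> UNIV)) \<and>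
        (\<lambda>n. LINT z|lborel_on Q. (\<phi> n z - y z)\<^sup>2) \<longlonglongrightarrow> 0 \<and>
        (\<lambda>n. LINT z|lborel_on Q. (norm (fst (grad (\<phi> n) z) - p z))\<^sup>2) \<longlonglongrightarrow> 0))"

text \<open>
  Weak solution of \<open>\<partial>\<^sub>t y - div (a \<nabla>y) + b y = f\<close> in \<open>\<Omega> \<times> (0,T)\<close>, \<open>y = 0\<close> on the lateral boundary,
  \<open>y(\<cdot>,0) = y0\<close>. The test functions are those with compact support in \<open>\<Omega> \<times> [0,T)\<close>, written as
  restrictions of functions on the whole space.
\<close>

definition weak_sol ::
  "'a::euclidean_space set \<Rightarrow> real \<Rightarrow> ('a \<times> real \<Rightarrow> real) \<Rightarrow> ('a \<times> real \<Rightarrow> real) \<Rightarrow>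
   ('a \<times> real \<Rightarrow> real) \<Rightarrow> ('a \<Rightarrow> real) \<Rightarrow> ('a \<times> real \<Rightarrow> real) \<Rightarrow> bool" where
  "weak_sol \<Omega> T a b f y0 y \<longleftrightarrow> (let Q = \<Omega> \<times> {0<..<T} in
     \<exists>p. energy_space \<Omega> T y p \<and>
       (\<forall>\<phi> \<in> C1c (\<Omega> \<times> {..<T}).
          (LINT z|lborel_on Q. - y z * snd (grad \<phi> z) + a z * (p z \<bullet> fst (grad \<phi> z)) + b z * y z * \<phi> z)
          = (LINT z|lborel_on Q. f z * \<phi> z) + (LINT x|lborel_on \<Omega>. y0 x * \<phi> (x, 0))))"

text \<open>
  Weak solution of \<open>- \<partial>\<^sub>t z - div (a \<nabla>z) + b z = q\<close> in \<open>\<Omega> \<times> (0,T)\<close>, \<open>z = 0\<close> on the lateral boundary,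
  \<open>z(\<cdot>,T) = 0\<close>; here the test functions have compact support in \<open>\<Omega> \<times> (0,T]\<close>.
\<close>

definition adjoint_weak_sol ::
  "'a::euclidean_space set \<Rightarrow> real \<Rightarrow> ('a \<times> real \<Rightarrow> real) \<Rightarrow> ('a \<times> real \<Rightarrow> real) \<Rightarrow>
   ('a \<times> real \<Rightarrow> real) \<Rightarrow> ('a \<times> real \<Rightarrow> real) \<Rightarrow> bool" where
  "adjoint_weak_sol \<Omega> T a b q z \<longleftrightarrow> (let Q = \<Omega> \<times> {0<..<T} in
     \<exists>p. energy_space \<Omega> T z p \<and>
       (\<forall>\<phi> \<in> C1c (\<Omega> \<times> {0<..}).
          (LINT s|lborel_on Q. z s * snd (grad \<phi> s) + a s * (p s \<bullet> fst (grad \<phi> s)) + b s * z s * \<phi> s)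
          = (LINT s|lborel_on Q. q s * \<phi> s)))"


section \<open>Carleman weights\<close>

definition alpha :: "real \<Rightarrow> real \<Rightarrow> real \<Rightarrow> ('a \<Rightarrow> real) \<Rightarrow> 'a \<times> real \<Rightarrow> real" where
  "alpha K1 K2 T \<eta> = (\<lambda>(x, t). K1 * (exp K2 - exp (\<eta> x)) / (T - t))"

definition rho :: "real \<Rightarrow> real \<Rightarrow> real \<Rightarrow> ('a \<Rightarrow> real) \<Rightarrow> 'a \<times> real \<Rightarrow> real" where
  "rho K1 K2 T \<eta> z = exp (alpha K1 K2 T \<eta> z)"

definition rho0 :: "real \<Rightarrow> real \<Rightarrow> real \<Rightarrow> ('a \<Rightarrow> real) \<Rightarrow> 'a \<times> real \<Rightarrow> real" where
  "rho0 K1 K2 T \<eta> z = (T - snd z) powr (3/2) * rho K1 K2 T \<eta> z"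


section \<open>Functionals\<close>

text \<open>
  In this section \<open>Q\<close> and \<open>Qw\<close> stand for \<open>\<Omega> \<times> (0,T)\<close> and \<open>\<omega> \<times> (0,T)\<close>, \<open>r\<close> and \<open>r0\<close> for the
  weights \<open>\<rho>\<^sub>R\<close> and \<open>\<rho>\<^sub>0\<close>, and \<open>M\<close>, \<open>Ms\<close> for the control-to-state operator and its adjoint.
\<close>

definition ctrl_space :: "'b::euclidean_space set \<Rightarrow> ('b \<Rightarrow> real) \<Rightarrow> ('b \<Rightarrow> real) set" where
  "ctrl_space Qw r0 = {v \<in> L2 Qw. (\<lambda>z. r0 z * v z) \<in> L2 Qw}"

definition F_fun :: "'b::euclidean_space set \<Rightarrow> ('b \<Rightarrow> real) \<Rightarrow> ('b \<Rightarrow> real) \<Rightarrow> ('b \<Rightarrow> real) \<Rightarrow> real" where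
  "F_fun Q r ybar z = 1/2 * (LINT s|lborel_on Q. (r s)\<^sup>2 * (z s + ybar s)\<^sup>2)"

definition G_fun :: "'b::euclidean_space set \<Rightarrow> ('b \<Rightarrow> real) \<Rightarrow> ('b \<Rightarrow> real) \<Rightarrow> real" where
  "G_fun Qw r0 v = 1/2 * (LINT s|lborel_on Qw. (r0 s)\<^sup>2 * (v s)\<^sup>2)"

text \<open>Convex conjugate of \<open>F\<close>, a functional on \<open>X\<close>, with respect to the duality pairing \<open>pr\<close>.\<close>

definition convex_conjugate :: "'v set \<Rightarrow> ('u \<Rightarrow> 'v \<Rightarrow> real) \<Rightarrow> ('v \<Rightarrow> real) \<Rightarrow> 'u \<Rightarrow> ereal" where
  "convex_conjugate X pr F u = (SUP v\<in>X. ereal (pr u v - F v))"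

definition F_conj :: "'b::euclidean_space set \<Rightarrow> ('b \<Rightarrow> real) \<Rightarrow> ('b \<Rightarrow> real) \<Rightarrow> ('b \<Rightarrow> real) \<Rightarrow> ereal" where
  "F_conj Q r ybar = convex_conjugate (L2 Q) (pairing Q) (F_fun Q r ybar)"

definition G_conj :: "'b::euclidean_space set \<Rightarrow> ('b \<Rightarrow> real) \<Rightarrow> ('b \<Rightarrow> real) \<Rightarrow> ereal" where
  "G_conj Qw r0 = convex_conjugate (ctrl_space Qw r0) (pairing Qw) (G_fun Qw r0)"

definition primal_fun :: "'b::euclidean_space set \<Rightarrow> 'b set \<Rightarrow> ('b \<Rightarrow> real) \<Rightarrow> ('b \<Rightarrow> real) \<Rightarrow> ('b \<Rightarrow> real) \<Rightarrow>
   (('b \<Rightarrow> real) \<Rightarrow> ('b \<Rightarrow> real)) \<Rightarrow> ('b \<Rightarrow> real) \<Rightarrow> real" where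
  "primal_fun Q Qw r r0 ybar M v = F_fun Q r ybar (M v) + G_fun Qw r0 v"

definition dual_fun :: "'b::euclidean_space set \<Rightarrow> 'b set \<Rightarrow> ('b \<Rightarrow> real) \<Rightarrow> ('b \<Rightarrow> real) \<Rightarrow> ('b \<Rightarrow> real) \<Rightarrow>
   (('b \<Rightarrow> real) \<Rightarrow> ('b \<Rightarrow> real)) \<Rightarrow> ('b \<Rightarrow> real) \<Rightarrow> real" where
  "dual_fun Q Qw r r0 ybar Ms q =
     1/2 * (LINT s|lborel_on Q. (q s)\<^sup>2 / (r s)\<^sup>2)
     + 1/2 * (LINT s|lborel_on Qw. (Ms q s)\<^sup>2 / (r0 s)\<^sup>2)
     + (LINT s|lborel_on Q. q s * ybar s)"

definition Lagrangian :: "'b::euclidean_space set \<Rightarrow> 'b set \<Rightarrow> ('b \<Rightarrow> real) \<Rightarrow> ('b \<Rightarrow> real) \<Rightarrow> ('b \<Rightarrow> real) \<Rightarrow>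
   (('b \<Rightarrow> real) \<Rightarrow> ('b \<Rightarrow> real)) \<Rightarrow> ('b \<Rightarrow> real) \<Rightarrow> ('b \<Rightarrow> real) \<Rightarrow> real" where
  "Lagrangian Q Qw r r0 ybar M v q =
     1/2 * (LINT s|lborel_on Qw. (r0 s)\<^sup>2 * (v s)\<^sup>2)
     - 1/2 * (LINT s|lborel_on Q. (q s)\<^sup>2 / (r s)\<^sup>2)
     - (LINT s|lborel_on Q. q s * (M v s + ybar s))"

definition is_minimizer :: "'v set \<Rightarrow> ('v \<Rightarrow> real) \<Rightarrow> 'v \<Rightarrow> bool" where
  "is_minimizer X J v \<longleftrightarrow> v \<in> X \<and> (\<forall>w\<in>X. J v \<le> J w)"

definition is_maximizer :: "'v set \<Rightarrow> ('v \<Rightarrow> real) \<Rightarrow> 'v \<Rightarrow> bool" where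
  "is_maximizer X J v \<longleftrightarrow> v \<in> X \<and> (\<forall>w\<in>X. J w \<le> J v)"

definition is_saddle_point :: "'v set \<Rightarrow> 'w set \<Rightarrow> ('v \<Rightarrow> 'w \<Rightarrow> real) \<Rightarrow> 'v \<Rightarrow> 'w \<Rightarrow> bool" where
  "is_saddle_point X Y L v q \<longleftrightarrow> v \<in> X \<and> q \<in> Y \<and>
     (\<forall>v'\<in>X. \<forall>q'\<in>Y. L v q' \<le> L v q \<and> L v q \<le> L v' q)"


text \<open>Closed forms of the two conjugates.\<close>

lemma L2_mult_integrable:
  fixes f g :: "'b::euclidean_space \<Rightarrow> real"
  assumes "f \<in> L2 S" "g \<in> L2 S"
  shows "integrable (lborel_on S) (\<lambda>x. f x * g x)"
proof (rule Bochner_Integration.integrable_bound)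
  show "integrable (lborel_on S) (\<lambda>x. (norm (f x))\<^sup>2 + (norm (g x))\<^sup>2)"
    using assms by (auto simp: L2_def)
  show "(\<lambda>x. f x * g x) \<in> borel_measurable (lborel_on S)"
    using assms by (auto simp: L2_def)
  have "\<bar>u * v\<bar> \<le> u\<^sup>2 + v\<^sup>2" for u v :: real
  proof -
    have "2 * (\<bar>u\<bar> * \<bar>v\<bar>) \<le> u\<^sup>2 + v\<^sup>2"
      using sum_squares_bound[of "\<bar>u\<bar>" "\<bar>v\<bar>"] by (simp add: mult.assoc)
    moreover have "0 \<le> \<bar>u\<bar> * \<bar>v\<bar>" by simp
    ultimately show ?thesis unfolding abs_mult by linarith
  qed
  then show "AE x in lborel_on S. norm (f x * g x) \<le> norm ((norm (f x))\<^sup>2 + (norm (g x))\<^sup>2)"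
    by (auto intro!: AE_I2)
qed

lemma L2_add:
  fixes f g :: "'b::euclidean_space \<Rightarrow> real"
  assumes "f \<in> L2 S" "g \<in> L2 S"
  shows "(\<lambda>x. f x + g x) \<in> L2 S"
proof -
  have "integrable (lborel_on S) (\<lambda>x. (f x)\<^sup>2 + (g x)\<^sup>2 + 2 * (f x * g x))"
    using assms L2_mult_integrable[OF assms] by (auto simp: L2_def)
  then show ?thesis
    using assms by (auto simp: L2_def power2_sum mult.assoc intro: borel_measurable_add)
qed

lemma L2_bounded_mult:
  fixes f h :: "'b::euclidean_space \<Rightarrow> real"
  assumes "f \<in> L2 S" "h \<in> borel_measurable (lborel_on S)" "\<And>x. x \<in> S \<Longrightarrow> \<bar>h x\<bar> \<le> B"
  shows "(\<lambda>x. h x * f x) \<in> L2 S"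
proof -
  have "integrable (lborel_on S) (\<lambda>x. (h x * f x)\<^sup>2)"
  proof (rule Bochner_Integration.integrable_bound)
    show "integrable (lborel_on S) (\<lambda>x. B\<^sup>2 * (f x)\<^sup>2)"
      using assms by (auto simp: L2_def)
    show "(\<lambda>x. (h x * f x)\<^sup>2) \<in> borel_measurable (lborel_on S)"
      using assms by (auto simp: L2_def)
    show "AE x in lborel_on S. norm ((h x * f x)\<^sup>2) \<le> norm (B\<^sup>2 * (f x)\<^sup>2)"
    proof (rule AE_I2)
      fix x assume "x \<in> space (lborel_on S)"
      then have "\<bar>h x\<bar> \<le> \<bar>B\<bar>" using assms(3)[of x] by (auto simp: space_restrict_space)
      then have "(h x)\<^sup>2 \<le> B\<^sup>2" by (simp add: abs_le_square_iff)
      then show "norm ((h x * f x)\<^sup>2) \<le> norm (B\<^sup>2 * (f x)\<^sup>2)"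
        by (auto simp: power_mult_distrib intro: mult_right_mono)
    qed
  qed
  then show ?thesis using assms by (auto simp: L2_def)
qed

lemma quadratic_conjugate:
  fixes k c u :: "'b::euclidean_space \<Rightarrow> real"
  assumes k: "\<And>x. x \<in> S \<Longrightarrow> k x > 0"
    and F: "\<And>v. v \<in> X \<Longrightarrow> integrable (lborel_on S) (\<lambda>x. (k x)\<^sup>2 * (v x + c x)\<^sup>2)"
    and uv: "\<And>v. v \<in> X \<Longrightarrow> integrable (lborel_on S) (\<lambda>x. u x * v x)"
    and uu: "integrable (lborel_on S) (\<lambda>x. (u x)\<^sup>2 / (k x)\<^sup>2)"
    and cu: "integrable (lborel_on S) (\<lambda>x. c x * u x)"
    and opt: "(\<lambda>x. u x / (k x)\<^sup>2 - c x) \<in> X"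
  shows "convex_conjugate X (pairing S) (\<lambda>v. 1/2 * (LINT x|lborel_on S. (k x)\<^sup>2 * (v x + c x)\<^sup>2)) u
    = ereal (1/2 * (LINT x|lborel_on S. (u x)\<^sup>2 / (k x)\<^sup>2) - (LINT x|lborel_on S. c x * u x))"
    (is "_ = ereal ?V")
proof -
  let ?J = "\<lambda>v. pairing S u v - 1/2 * (LINT x|lborel_on S. (k x)\<^sup>2 * (v x + c x)\<^sup>2)"
  let ?w = "\<lambda>x. u x / (k x)\<^sup>2 - c x"
  have pt: "1/2 * ((u x)\<^sup>2 / (k x)\<^sup>2) - c x * u x - (u x * v - 1/2 * ((k x)\<^sup>2 * (v + c x)\<^sup>2))
      = 1/2 * (k x * (v + c x) - u x / k x)\<^sup>2" if "x \<in> S" for x v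
    using k[OF that] by (simp add: field_simps power2_eq_square)
  have V: "?V = (LINT x|lborel_on S. 1/2 * ((u x)\<^sup>2 / (k x)\<^sup>2) - c x * u x)"
  proof -
    have "integrable (lborel_on S) (\<lambda>x. 1/2 * ((u x)\<^sup>2 / (k x)\<^sup>2))"
      using uu by (rule Bochner_Integration.integrable_mult_right)
    from Bochner_Integration.integral_diff[OF this cu] show ?thesis
      by (simp only: integral_mult_right_zero)
  qed
  have J: "?J v = (LINT x|lborel_on S. u x * v x - 1/2 * ((k x)\<^sup>2 * (v x + c x)\<^sup>2))" if "v \<in> X" for v
  proof -
    have "integrable (lborel_on S) (\<lambda>x. 1/2 * ((k x)\<^sup>2 * (v x + c x)\<^sup>2))"
      using F[OF that] by (rule Bochner_Integration.integrable_mult_right)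
    from Bochner_Integration.integral_diff[OF uv[OF that] this] show ?thesis
      by (simp only: integral_mult_right_zero pairing_def)
  qed
  have le: "?J v \<le> ?V" if "v \<in> X" for v
    unfolding J[OF that] V
  proof (rule integral_mono_AE)
    show "AE x in lborel_on S. u x * v x - 1/2 * ((k x)\<^sup>2 * (v x + c x)\<^sup>2)
      \<le> 1/2 * ((u x)\<^sup>2 / (k x)\<^sup>2) - c x * u x"
    proof (rule AE_I2)
      fix x assume "x \<in> space (lborel_on S)"
      then have "x \<in> S" by (auto simp: space_restrict_space)
      from pt[OF this, of "v x"] show "u x * v x - 1/2 * ((k x)\<^sup>2 * (v x + c x)\<^sup>2)
        \<le> 1/2 * ((u x)\<^sup>2 / (k x)\<^sup>2) - c x * u x"
        using zero_le_power2[of "k x * (v x + c x) - u x / k x"] by linarith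
    qed
  qed (intro Bochner_Integration.integrable_diff Bochner_Integration.integrable_mult_right
        F[OF that] uv[OF that] uu cu)+
  have eq: "?J ?w = ?V"
    unfolding J[OF opt] V
  proof (rule Bochner_Integration.integral_cong[OF refl])
    fix x assume "x \<in> space (lborel_on S)"
    then have "x \<in> S" by (auto simp: space_restrict_space)
    with k[OF this] pt[OF this, of "?w x"]
    show "u x * ?w x - 1/2 * ((k x)\<^sup>2 * (?w x + c x)\<^sup>2) = 1/2 * ((u x)\<^sup>2 / (k x)\<^sup>2) - c x * u x"
      by (simp add: power2_eq_square)
  qed
  show ?thesis
    unfolding convex_conjugate_def
  proof (rule antisym)
    show "(SUP v\<in>X. ereal (?J v)) \<le> ereal ?V"
      using le by (auto intro!: SUP_least)
    show "ereal ?V \<le> (SUP v\<in>X. ereal (?J v))"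
      using eq opt by (intro SUP_upper2[of ?w]) auto
  qed
qed

lemma F_conj_eq:
  assumes r: "r \<in> borel_measurable (lborel_on Q)" "m > 0" "\<And>s. s \<in> Q \<Longrightarrow> m \<le> r s \<and> r s \<le> B"
    and "ybar \<in> L2 Q" "u \<in> L2 Q"
  shows "F_conj Q r ybar u
    = ereal (1/2 * (LINT s|lborel_on Q. (u s)\<^sup>2 / (r s)\<^sup>2) - (LINT s|lborel_on Q. ybar s * u s))"
proof -
  have pos: "r s > 0" if "s \<in> Q" for s using r(2) r(3)[OF that] by linarith
  have invb: "\<bar>inverse (r s)\<bar> \<le> inverse m" if "s \<in> Q" for s
    using pos[OF that] r(2) r(3)[OF that] by (simp add: le_imp_inverse_le abs_of_pos del: abs_inverse)
  have inv: "(\<lambda>s. inverse (r s) * f s) \<in> L2 Q" if "f \<in> L2 Q" for f :: "_ \<Rightarrow> real"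
    using invb r(1) by (intro L2_bounded_mult[OF that]) auto
  have rb: "\<bar>r s\<bar> \<le> B" if "s \<in> Q" for s
    using pos[OF that] r(3)[OF that] by simp
  have rf: "(\<lambda>s. r s * f s) \<in> L2 Q" if "f \<in> L2 Q" for f :: "_ \<Rightarrow> real"
    using rb r(1) by (intro L2_bounded_mult[OF that]) auto
  have neg: "(\<lambda>s. - ybar s) \<in> L2 Q" using assms(4) by (auto simp: L2_def)
  have opt: "(\<lambda>s. u s / (r s)\<^sup>2 - ybar s) \<in> L2 Q"
    using L2_add[OF inv[OF inv[OF assms(5)]] neg] by (simp add: field_simps power2_eq_square)
  show ?thesis
    unfolding F_conj_def F_fun_def
  proof (rule quadratic_conjugate[OF pos _ _ _ _ opt])
    fix v :: "_ \<Rightarrow> real" assume v: "v \<in> L2 Q"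
    show "integrable (lborel_on Q) (\<lambda>x. (r x)\<^sup>2 * (v x + ybar x)\<^sup>2)"
      using rf[OF L2_add[OF v assms(4)]] by (simp add: L2_def power_mult_distrib)
    show "integrable (lborel_on Q) (\<lambda>x. u x * v x)"
      by (rule L2_mult_integrable[OF assms(5) v])
  next
    show "integrable (lborel_on Q) (\<lambda>x. (u x)\<^sup>2 / (r x)\<^sup>2)"
      using inv[OF assms(5)] by (simp add: L2_def power_mult_distrib field_simps)
    show "integrable (lborel_on Q) (\<lambda>x. ybar x * u x)"
      by (rule L2_mult_integrable[OF assms(4,5)])
  qed
qed

lemma G_conj_eq:
  assumes r: "r0 \<in> borel_measurable (lborel_on Qw)" "m > 0" "\<And>s. s \<in> Qw \<Longrightarrow> m \<le> r0 s"
    and w: "w \<in> borel_measurable (lborel_on Qw)" "(\<lambda>s. w s / r0 s) \<in> L2 Qw"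
  shows "G_conj Qw r0 w = ereal (1/2 * (LINT s|lborel_on Qw. (w s)\<^sup>2 / (r0 s)\<^sup>2))"
proof -
  have pos: "r0 s > 0" if "s \<in> Qw" for s using r(2) r(3)[OF that] by linarith
  have ext: "f \<in> L2 Qw" if "g \<in> L2 Qw" "\<And>s. s \<in> Qw \<Longrightarrow> f s = g s" for f g :: "_ \<Rightarrow> real"
  proof -
    have eq: "f x = g x" if "x \<in> space (lborel_on Qw)" for x
      using that \<open>\<And>s. s \<in> Qw \<Longrightarrow> f s = g s\<close> by (auto simp: space_restrict_space)
    have "f \<in> borel_measurable (lborel_on Qw)"
      using that(1) eq measurable_cong[of "lborel_on Qw" f g borel] by (auto simp: L2_def)
    moreover have "integrable (lborel_on Qw) (\<lambda>x. (norm (f x))\<^sup>2)"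
      using that(1) eq Bochner_Integration.integrable_cong[of "lborel_on Qw" "lborel_on Qw"
          "\<lambda>x. (norm (f x))\<^sup>2" "\<lambda>x. (norm (g x))\<^sup>2"] by (auto simp: L2_def)
    ultimately show ?thesis by (simp add: L2_def)
  qed
  have "\<bar>inverse (r0 s)\<bar> \<le> inverse m" if "s \<in> Qw" for s
    using pos[OF that] r(2) r(3)[OF that] by (simp add: le_imp_inverse_le abs_of_pos del: abs_inverse)
  then have "(\<lambda>s. inverse (r0 s) * (w s / r0 s)) \<in> L2 Qw"
    using r(1) by (intro L2_bounded_mult[OF w(2)]) auto
  then have w2: "(\<lambda>s. w s / (r0 s)\<^sup>2) \<in> L2 Qw"
    by (simp add: divide_inverse power2_eq_square mult.commute mult.left_commute)
  have opt: "(\<lambda>s. w s / (r0 s)\<^sup>2 - 0) \<in> ctrl_space Qw r0"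
  proof -
    have "(\<lambda>s. r0 s * (w s / (r0 s)\<^sup>2)) \<in> L2 Qw"
    proof (rule ext[OF w(2)])
      fix s assume "s \<in> Qw"
      from pos[OF this] show "r0 s * (w s / (r0 s)\<^sup>2) = w s / r0 s"
        by (simp add: power2_eq_square)
    qed
    with w2 show ?thesis by (simp add: ctrl_space_def)
  qed
  have "convex_conjugate (ctrl_space Qw r0) (pairing Qw)
      (\<lambda>v. 1/2 * (LINT x|lborel_on Qw. (r0 x)\<^sup>2 * (v x + 0)\<^sup>2)) w
    = ereal (1/2 * (LINT s|lborel_on Qw. (w s)\<^sup>2 / (r0 s)\<^sup>2) - (LINT x|lborel_on Qw. 0 * w x))"
  proof (rule quadratic_conjugate[OF pos _ _ _ _ opt])
    fix v :: "_ \<Rightarrow> real" assume v: "v \<in> ctrl_space Qw r0"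
    then show "integrable (lborel_on Qw) (\<lambda>x. (r0 x)\<^sup>2 * (v x + 0)\<^sup>2)"
      by (simp add: ctrl_space_def L2_def power_mult_distrib)
    have "integrable (lborel_on Qw) (\<lambda>x. (w x / r0 x) * (r0 x * v x))"
      using v w(2) by (intro L2_mult_integrable) (auto simp: ctrl_space_def)
    then show "integrable (lborel_on Qw) (\<lambda>x. w x * v x)"
      by (rule Bochner_Integration.integrable_cong[THEN iffD1, rotated -1])
        (auto simp: space_restrict_space dest: pos)
  next
    show "integrable (lborel_on Qw) (\<lambda>x. (w x)\<^sup>2 / (r0 x)\<^sup>2)"
      using w(2) by (simp add: L2_def power_divide)
    show "integrable (lborel_on Qw) (\<lambda>x. 0 * w x)"
      by (simp only: mult_zero_left integrable_zero)
  qed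
  then show ?thesis
    by (simp add: G_conj_def G_fun_def[abs_def])
qed

end

theory Submission
  imports Defs
begin

text \<open>
  The Lagrangian is quadratic in each variable, and completing squares gives
  \<open>L v q = I v - A / 2 = - \<Phi> q + B / 2\<close> with
  \<open>A = \<parallel>q / \<rho>R + \<rho>R (M v + ybar)\<parallel>\<^sup>2\<close> and \<open>B = \<parallel>\<rho>0 v - Ms q / \<rho>0\<parallel>\<^sup>2\<close>. Hence the duality gap
  \<open>I v + \<Phi> q\<close> equals \<open>(A + B) / 2\<close>, and every claim follows once one pair with \<open>A = B = 0\<close> is
  known. A minimizing sequence of \<open>I\<close> is Cauchy by the parallelogram law; its limit \<open>v\<close> minimizes \<open>I\<close>,
  and with \<open>q = - \<rho>R\<^sup>2 (M v + ybar)\<close> the first variation of \<open>I\<close> at \<open>v\<close> reads \<open>B = 0\<close>.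

  The only property of \<open>M\<close> and \<open>Ms\<close> used is the adjoint relation, which also yields linearity and
  closedness of \<open>M\<close>. It is obtained without time derivatives of weak solutions: with
  zero-extensions, \<open>\<tau> \<mapsto> \<integral> y(x,t) z(x,t + \<tau>)\<close> has a right derivative at \<open>0\<close> that can be computed
  from the equation of \<open>y\<close> or from that of \<open>z\<close>, and the two values are compared.
\<close>

section \<open>Square integrable functions\<close>

text \<open>The obstacle is that \<open>M\<close> and \<open>Ms\<close> are mere selections:
  \<open>M v\<close> is some weak solution, \<open>Ms q\<close> agrees almost everywhere with one,
  and linearity is not among the hypotheses. A function in \<open>L2 Q\<close> is determined only up
  to null sets by its integrals against all \<open>q\<close>, so every identity derived for
  \<open>M\<close> holds almost everywhere.

  For the adjoint relation one would like to test the equation of \<open>y\<close> with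
  \<open>z\<close>, but \<open>z\<close> need not have a time derivative. Shifts in one time
  direction are still available: test functions for \<open>y\<close> vanish near
  \<open>t = T\<close> and are free at \<open>t = 0\<close>, those for \<open>z\<close> behave the
  opposite way. Hence \<open>z\<close> at time \<open>t + \<tau>\<close> suits the first equation
  and \<open>y\<close> at time \<open>t - \<tau>\<close> the second, both for
  \<open>\<tau> \<ge> 0\<close>. The zero initial value of \<open>y\<close> and the zero terminal
  value of \<open>z\<close> leave no boundary term in either equation.

  The truncation at \<open>R\<close> bounds \<open>\<rho>R\<close> from above, so that
  \<open>q = - \<rho>R\<^sup>2 (M v + ybar)\<close> is square integrable. No such bound is available
  for \<open>\<rho>0\<close>, and limits of controls are therefore taken in the variable
  \<open>\<rho>0 v\<close>.\<close>

lemma L2_inner_integrable: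
  assumes "f \<in> L2 S" "g \<in> L2 S"
  shows "integrable (lborel_on S) (\<lambda>x. f x \<bullet> g x)"
proof (rule Bochner_Integration.integrable_bound)
  show "integrable (lborel_on S) (\<lambda>x. (norm (f x))\<^sup>2 + (norm (g x))\<^sup>2)"
    using assms by (auto simp: L2_def)
  show "(\<lambda>x. f x \<bullet> g x) \<in> borel_measurable (lborel_on S)"
    using assms by (auto simp: L2_def)
  have "\<bar>u \<bullet> v\<bar> \<le> (norm u)\<^sup>2 + (norm v)\<^sup>2" for u v :: 'b
  proof -
    have "\<bar>u \<bullet> v\<bar> \<le> norm u * norm v" by (rule Cauchy_Schwarz_ineq2)
    moreover have "2 * (norm u * norm v) \<le> (norm u)\<^sup>2 + (norm v)\<^sup>2"
      using sum_squares_bound[of "norm u" "norm v"] by (simp add: mult.assoc)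
    moreover have "0 \<le> norm u * norm v" by simp
    ultimately show ?thesis by linarith
  qed
  then show "AE x in lborel_on S. norm (f x \<bullet> g x) \<le> norm ((norm (f x))\<^sup>2 + (norm (g x))\<^sup>2)"
    by (auto intro!: AE_I2)
qed

lemma L2_plus:
  assumes "f \<in> L2 S" "g \<in> L2 S"
  shows "(\<lambda>x. f x + g x) \<in> L2 S"
proof -
  have "integrable (lborel_on S) (\<lambda>x. (norm (f x))\<^sup>2 + (norm (g x))\<^sup>2 + 2 * (f x \<bullet> g x))"
    using assms L2_inner_integrable[OF assms] by (auto simp: L2_def)
  moreover have "(norm (f x))\<^sup>2 + (norm (g x))\<^sup>2 + 2 * (f x \<bullet> g x) = (norm (f x + g x))\<^sup>2" for x
    unfolding power2_norm_eq_inner by (simp add: inner_add inner_commute)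
  ultimately show ?thesis
    using assms by (auto simp: L2_def)
qed

lemma L2_bounded_scaleR:
  assumes "f \<in> L2 S" "h \<in> borel_measurable (lborel_on S)" "AE x in lborel_on S. \<bar>h x\<bar> \<le> B"
  shows "(\<lambda>x. h x *\<^sub>R f x) \<in> L2 S"
proof -
  have "integrable (lborel_on S) (\<lambda>x. (norm (h x *\<^sub>R f x))\<^sup>2)"
  proof (rule Bochner_Integration.integrable_bound)
    show "integrable (lborel_on S) (\<lambda>x. B\<^sup>2 * (norm (f x))\<^sup>2)"
      using assms by (auto simp: L2_def)
    show "(\<lambda>x. (norm (h x *\<^sub>R f x))\<^sup>2) \<in> borel_measurable (lborel_on S)"
      using assms by (auto simp: L2_def)
    show "AE x in lborel_on S. norm ((norm (h x *\<^sub>R f x))\<^sup>2) \<le> norm (B\<^sup>2 * (norm (f x))\<^sup>2)"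
      using assms(3)
    proof eventually_elim
      case (elim x)
      then have "(h x)\<^sup>2 \<le> B\<^sup>2" by (simp add: abs_le_square_iff[symmetric])
      then show ?case
        by (auto simp: power_mult_distrib intro: mult_right_mono)
    qed
  qed
  then show ?thesis using assms by (auto simp: L2_def)
qed

lemma L2_scaleR:
  assumes "f \<in> L2 S"
  shows "(\<lambda>x. c *\<^sub>R f x) \<in> L2 S"
  by (rule L2_bounded_scaleR[OF assms, where B = "\<bar>c\<bar>"]) auto

lemma L2_mult:
  fixes f :: "'b::euclidean_space \<Rightarrow> real"
  assumes "f \<in> L2 S"
  shows "(\<lambda>x. c * f x) \<in> L2 S"
  using L2_scaleR[OF assms] by simp

lemma L2_minus:
  assumes "f \<in> L2 S" "g \<in> L2 S"
  shows "(\<lambda>x. f x - g x) \<in> L2 S"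
  using L2_plus[OF assms(1) L2_scaleR[OF assms(2), of "-1"]] by simp

lemma L2_sq_integrable:
  fixes f :: "'b::euclidean_space \<Rightarrow> real"
  assumes "f \<in> L2 S"
  shows "integrable (lborel_on S) (\<lambda>x. (f x)\<^sup>2)"
  using assms by (simp add: L2_def)

lemma L2_norm_integrable: "f \<in> L2 S \<Longrightarrow> integrable (lborel_on S) (\<lambda>x. (norm (f x))\<^sup>2)"
  by (simp add: L2_def)

lemma L2_cong_AE:
  assumes "f \<in> L2 S" "g \<in> borel_measurable (lborel_on S)" "AE x in lborel_on S. f x = g x"
  shows "g \<in> L2 S"
proof -
  have "integrable (lborel_on S) (\<lambda>x. (norm (g x))\<^sup>2)"
    using assms by (intro integrable_cong_AE_imp[OF L2_norm_integrable[OF assms(1)]]) auto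
  with assms show ?thesis by (simp add: L2_def)
qed

lemma L2_cong:
  assumes "f \<in> L2 S" "\<And>x. x \<in> S \<Longrightarrow> f x = g x"
  shows "g \<in> L2 S"
proof (rule L2_cong_AE[OF assms(1)])
  have eq: "f x = g x" if "x \<in> space (lborel_on S)" for x
    using that assms(2) by (auto simp: space_restrict_space)
  then show "g \<in> borel_measurable (lborel_on S)"
    using assms(1) measurable_cong[of "lborel_on S" f g borel] by (auto simp: L2_def)
  show "AE x in lborel_on S. f x = g x" using eq by (intro AE_I2) auto
qed

text \<open>The polynomial \<open>t \<mapsto> ?F + 2 * t * ?I + t^2 * ?G\<close> is the squared norm
  of \<open>f + t g\<close>, hence nonnegative. If \<open>?G = 0\<close> it is affine and its slope
  must vanish; otherwise its minimum is evaluated.\<close>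

lemma L2_Cauchy_Schwarz:
  assumes f: "f \<in> L2 S" and g: "g \<in> L2 S"
  shows "(LINT x|lborel_on S. f x \<bullet> g x)\<^sup>2
    \<le> (LINT x|lborel_on S. (norm (f x))\<^sup>2) * (LINT x|lborel_on S. (norm (g x))\<^sup>2)"
proof -
  let ?F = "LINT x|lborel_on S. (norm (f x))\<^sup>2"
  let ?G = "LINT x|lborel_on S. (norm (g x))\<^sup>2"
  let ?I = "LINT x|lborel_on S. f x \<bullet> g x"
  have q: "0 \<le> ?F + 2 * t * ?I + t\<^sup>2 * ?G" for t
  proof -
    have "0 \<le> (LINT x|lborel_on S. (norm (f x))\<^sup>2 + (2 * t) * (f x \<bullet> g x) + t\<^sup>2 * (norm (g x))\<^sup>2)"
    proof (rule Bochner_Integration.integral_nonneg)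
      fix x
      have "(norm (f x))\<^sup>2 + (2 * t) * (f x \<bullet> g x) + t\<^sup>2 * (norm (g x))\<^sup>2 = (norm (f x + t *\<^sub>R g x))\<^sup>2"
        unfolding power2_norm_eq_inner
        by (simp add: inner_add inner_commute power2_eq_square algebra_simps)
      then show "0 \<le> (norm (f x))\<^sup>2 + (2 * t) * (f x \<bullet> g x) + t\<^sup>2 * (norm (g x))\<^sup>2" by simp
    qed
    also have "\<dots> = ?F + 2 * t * ?I + t\<^sup>2 * ?G"
      using L2_norm_integrable[OF f] L2_norm_integrable[OF g] L2_inner_integrable[OF f g]
      by (simp add: Bochner_Integration.integral_add)
    finally show ?thesis .
  qed
  have G: "0 \<le> ?G" by simp
  show ?thesis
  proof (cases "?G = 0")
    case True
    have "?I = 0"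
    proof (rule ccontr)
      assume "?I \<noteq> 0"
      \<comment> \<open>At this \<open>t\<close> the affine function has the value -1.\<close>
      with q[of "- (?F + 1) / (2 * ?I)"] True show False by (simp add: field_simps)
    qed
    with True show ?thesis by simp
  next
    case False
    with G have pos: "?G > 0" by linarith
    have "0 \<le> ?F - ?I\<^sup>2 / ?G"
      using q[of "- ?I / ?G"] pos by (simp add: power2_eq_square field_simps)
    with pos show ?thesis by (simp add: field_simps)
  qed
qed

lemma L2_inner_tendsto:
  assumes "\<And>n. f n \<in> L2 S" "h \<in> L2 S" "g \<in> L2 S"
    and lim: "(\<lambda>n. LINT x|lborel_on S. (norm (f n x - h x))\<^sup>2) \<longlonglongrightarrow> 0"
  shows "(\<lambda>n. LINT x|lborel_on S. f n x \<bullet> g x) \<longlonglongrightarrow> (LINT x|lborel_on S. h x \<bullet> g x)"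
proof -
  let ?d = "\<lambda>n. (LINT x|lborel_on S. f n x \<bullet> g x) - (LINT x|lborel_on S. h x \<bullet> g x)"
  let ?G = "LINT x|lborel_on S. (norm (g x))\<^sup>2"
  have "(?d n)\<^sup>2 \<le> (LINT x|lborel_on S. (norm (f n x - h x))\<^sup>2) * ?G" for n
  proof -
    have "?d n = (LINT x|lborel_on S. (f n x - h x) \<bullet> g x)"
      using assms by (simp add: inner_diff_left L2_inner_integrable)
    then show ?thesis
      using L2_Cauchy_Schwarz[OF L2_minus[OF assms(1,2)] assms(3)] by simp
  qed
  then have "(\<lambda>n. (?d n)\<^sup>2) \<longlonglongrightarrow> 0"
    by (intro tendsto_sandwich[OF _ _ tendsto_const tendsto_mult_left_zero[OF lim, of ?G]] always_eventually allI)
      simp_all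
  then have "?d \<longlonglongrightarrow> 0" by (subst (asm) power_tendsto_0_iff) simp_all
  then show ?thesis by (rule LIM_zero_cancel)
qed

text \<open>Expanding the square of \<open>f n - h\<close> leaves only the inner product with the
  fixed function \<open>h\<close>, to which \<open>L2_inner_tendsto\<close> applies.\<close>

lemma L2_norm_tendsto:
  assumes f: "\<And>n. f n \<in> L2 S" and h: "h \<in> L2 S"
    and lim: "(\<lambda>n. LINT x|lborel_on S. (norm (f n x - h x))\<^sup>2) \<longlonglongrightarrow> 0"
  shows "(\<lambda>n. LINT x|lborel_on S. (norm (f n x))\<^sup>2) \<longlonglongrightarrow> (LINT x|lborel_on S. (norm (h x))\<^sup>2)"
proof -
  have eq: "(LINT x|lborel_on S. (norm (f n x))\<^sup>2) = (LINT x|lborel_on S. (norm (f n x - h x))\<^sup>2)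
      + 2 * (LINT x|lborel_on S. f n x \<bullet> h x) - (LINT x|lborel_on S. (norm (h x))\<^sup>2)" for n
  proof -
    have "(LINT x|lborel_on S. (norm (f n x - h x))\<^sup>2)
      = (LINT x|lborel_on S. (norm (f n x))\<^sup>2 - 2 * (f n x \<bullet> h x) + (norm (h x))\<^sup>2)"
      by (rule Bochner_Integration.integral_cong)
        (auto simp: power2_norm_eq_inner inner_diff inner_commute)
    also have "\<dots> = (LINT x|lborel_on S. (norm (f n x))\<^sup>2)
      - 2 * (LINT x|lborel_on S. f n x \<bullet> h x) + (LINT x|lborel_on S. (norm (h x))\<^sup>2)"
      using L2_norm_integrable[OF f] L2_norm_integrable[OF h] L2_inner_integrable[OF f h] by simp
    finally show ?thesis by simp
  qed
  have "(\<lambda>n. (LINT x|lborel_on S. (norm (f n x - h x))\<^sup>2)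
      + 2 * (LINT x|lborel_on S. f n x \<bullet> h x) - (LINT x|lborel_on S. (norm (h x))\<^sup>2))
    \<longlonglongrightarrow> 0 + 2 * (LINT x|lborel_on S. h x \<bullet> h x) - (LINT x|lborel_on S. (norm (h x))\<^sup>2)"
    by (intro tendsto_intros lim L2_inner_tendsto[OF f h h lim])
  then show ?thesis unfolding eq by (simp add: power2_norm_eq_inner)
qed

lemma L2_norm_zero_AE:
  assumes "f \<in> L2 S" "(LINT x|lborel_on S. (norm (f x))\<^sup>2) = 0"
  shows "AE x in lborel_on S. f x = 0"
proof -
  have "AE x in lborel_on S. (norm (f x))\<^sup>2 = 0"
    using integral_nonneg_eq_0_iff_AE[OF L2_norm_integrable[OF assms(1)]] assms(2) by simp
  then show ?thesis by eventually_elim simp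
qed

text \<open>The test function is \<open>f - g\<close> itself. In this form the adjoint relation is
  turned into identities for \<open>M\<close>.\<close>

lemma L2_orthogonal_AE:
  assumes "f \<in> L2 S" "g \<in> L2 S"
    and eq: "\<And>q. q \<in> L2 S \<Longrightarrow> (LINT x|lborel_on S. f x \<bullet> q x) = (LINT x|lborel_on S. g x \<bullet> q x)"
  shows "AE x in lborel_on S. f x = g x"
proof -
  have d: "(\<lambda>x. f x - g x) \<in> L2 S" using assms by (intro L2_minus)
  have "(LINT x|lborel_on S. (norm (f x - g x))\<^sup>2)
    = (LINT x|lborel_on S. f x \<bullet> (f x - g x)) - (LINT x|lborel_on S. g x \<bullet> (f x - g x))"
    using L2_inner_integrable[OF assms(1) d] L2_inner_integrable[OF assms(2) d]
    by (simp add: power2_norm_eq_inner inner_diff_left)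
  also have "\<dots> = 0" using eq[OF d] by simp
  finally show ?thesis using L2_norm_zero_AE[OF d] by simp
qed

text \<open>Riesz-Fischer: a subsequence with rapidly decreasing increments converges almost
  everywhere, and Fatou's lemma transfers the Cauchy bounds to its limit, for the whole
  sequence.\<close>

lemma L2_complete:
  fixes f :: "nat \<Rightarrow> 'b::euclidean_space \<Rightarrow> real"
  assumes f: "\<And>n. f n \<in> L2 S"
    and Cauchy: "\<forall>e>0. \<exists>N. \<forall>m\<ge>N. \<forall>n\<ge>N. (LINT x|lborel_on S. (f m x - f n x)\<^sup>2) < e"
  obtains g where "g \<in> L2 S" "(\<lambda>n. LINT x|lborel_on S. (f n x - g x)\<^sup>2) \<longlonglongrightarrow> 0"
proof -
  let ?N = "lborel_on S"
  note Cauchy = Cauchy[rule_format]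
  have [measurable]: "f n \<in> borel_measurable ?N" for n using f[of n] by (simp add: L2_def)
  have sq: "integrable ?N (\<lambda>x. (f m x - f n x)\<^sup>2)" for m n
    by (intro L2_sq_integrable L2_minus f)
  have nn: "(\<integral>\<^sup>+x. ennreal ((f m x - f n x)\<^sup>2) \<partial>?N) = ennreal (LINT x|?N. (f m x - f n x)\<^sup>2)" for m n
    by (rule nn_integral_eq_integral[OF sq]) simp
  \<comment> \<open>The rate \<open>(1/4)^k\<close> is chosen so that the weight \<open>2^k\<close>
    used below still leaves the summable bound \<open>(1/2)^k\<close>.\<close>
  have "\<forall>k. \<exists>N. \<forall>m\<ge>N. \<forall>n\<ge>N. (LINT x|?N. (f m x - f n x)\<^sup>2) < (1/4)^k"
    using Cauchy by simp
  then obtain N where N: "\<And>k m n. m \<ge> N k \<Longrightarrow> n \<ge> N k \<Longrightarrow> (LINT x|?N. (f m x - f n x)\<^sup>2) < (1/4)^k"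
    by metis
  \<comment> \<open>The partial sum makes \<open>r\<close> nondecreasing and at least
    \<open>N k\<close>; the summand \<open>k\<close> makes it exceed every given index.\<close>
  define r where "r k = k + (\<Sum>i\<le>k. N i)" for k
  have rN: "r k \<ge> N k" for k
    unfolding r_def by (intro trans_le_add2 member_le_sum) auto
  have rmono: "r (Suc k) \<ge> r k" for k unfolding r_def by simp
  define d where "d k x = f (r (Suc k)) x - f (r k) x" for k x
  have [measurable]: "d k \<in> borel_measurable ?N" for k unfolding d_def by measurable
  have db: "(LINT x|?N. (d k x)\<^sup>2) \<le> (1/4)^k" for k
    unfolding d_def using N[of k "r (Suc k)" "r k"] rN[of k] rmono[of k] by simp
  text \<open>By AM-GM \<open>\<bar>d\<^sub>k\<bar> \<le> 2\<^sup>-\<^sup>k + 2\<^sup>k d\<^sub>k\<^sup>2\<close>, and the second summand has integral at most \<open>2\<^sup>-\<^sup>k\<close>,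
    so no triangle inequality for the norm is needed.\<close>
  have "(\<integral>\<^sup>+x. (\<Sum>k. ennreal (2^k * (d k x)\<^sup>2)) \<partial>?N) = (\<Sum>k. \<integral>\<^sup>+x. ennreal (2^k * (d k x)\<^sup>2) \<partial>?N)"
    by (rule nn_integral_suminf) measurable
  also have "\<dots> \<le> (\<Sum>k. ennreal ((1/2)^k))"
  proof (intro suminf_le allI)
    fix k
    have "(\<integral>\<^sup>+x. ennreal (2^k * (d k x)\<^sup>2) \<partial>?N) = ennreal (LINT x|?N. 2^k * (d k x)\<^sup>2)"
      using sq by (intro nn_integral_eq_integral) (auto simp: d_def)
    also have "\<dots> \<le> ennreal ((1/2)^k)"
    proof (rule ennreal_leI)
      have "(LINT x|?N. 2^k * (d k x)\<^sup>2) = 2^k * (LINT x|?N. (d k x)\<^sup>2)" by simp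
      also have "\<dots> \<le> 2^k * (1/4)^k" using db by (intro mult_left_mono) auto
      also have "\<dots> = (1/2)^k" by (simp add: power_mult_distrib[symmetric])
      finally show "(LINT x|?N. 2^k * (d k x)\<^sup>2) \<le> (1/2)^k" .
    qed
    finally show "(\<integral>\<^sup>+x. ennreal (2^k * (d k x)\<^sup>2) \<partial>?N) \<le> ennreal ((1/2)^k)" .
  qed auto
  also have "\<dots> = ennreal (\<Sum>k. (1/2)^k)"
    by (rule suminf_ennreal2) (auto intro: summable_geometric)
  also have "\<dots> < \<infinity>" by simp
  finally have fin: "(\<integral>\<^sup>+x. (\<Sum>k. ennreal (2^k * (d k x)\<^sup>2)) \<partial>?N) \<noteq> \<infinity>" by simp
  have "AE x in ?N. (\<Sum>k. ennreal (2^k * (d k x)\<^sup>2)) \<noteq> \<infinity>"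
    using fin by (intro nn_integral_PInf_AE) auto
  then have conv: "AE x in ?N. (\<lambda>k. f (r k) x) \<longlonglongrightarrow> lim (\<lambda>k. f (r k) x)"
  proof eventually_elim
    case (elim x)
    then have "summable (\<lambda>k. 2^k * (d k x)\<^sup>2)"
      by (intro summable_suminf_not_top) auto
    then have s: "summable (\<lambda>k. (1/2)^k + 2^k * (d k x)\<^sup>2)"
      by (intro summable_add) (auto intro: summable_geometric)
    have "norm (d k x) \<le> (1/2)^k + 2^k * (d k x)\<^sup>2" for k
    proof -
      have "0 \<le> ((1/2)^k - \<bar>d k x\<bar>)\<^sup>2" by simp
      then have "2 * (1/2)^k * \<bar>d k x\<bar> \<le> ((1/2)^k)\<^sup>2 + (d k x)\<^sup>2"
        by (simp add: power2_diff)
      then have "2^k * (2 * (1/2)^k * \<bar>d k x\<bar>) \<le> 2^k * (((1/2)^k)\<^sup>2 + (d k x)\<^sup>2)"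
        by (intro mult_left_mono) auto
      moreover have one: "2^k * (1/2::real)^k = 1" by (simp add: power_mult_distrib[symmetric])
      have "2^k * (2 * (1/2)^k * \<bar>d k x\<bar>) = 2 * (2^k * (1/2)^k) * \<bar>d k x\<bar>"
        "2^k * (((1/2)^k)\<^sup>2 + (d k x)\<^sup>2) = (2^k * (1/2)^k) * (1/2)^k + 2^k * (d k x)\<^sup>2"
        by (simp_all only: power2_eq_square distrib_left mult_ac)
      ultimately have "2 * \<bar>d k x\<bar> \<le> (1/2)^k + 2^k * (d k x)\<^sup>2"
        unfolding one by simp
      then show ?thesis by simp
    qed
    then have "summable (\<lambda>k. d k x)"
      by (intro summable_comparison_test'[OF s]) auto
    then have "(\<lambda>n. \<Sum>k<n. d k x) \<longlonglongrightarrow> suminf (\<lambda>k. d k x)" by (rule summable_LIMSEQ)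
    moreover have "(\<Sum>k<n. d k x) = f (r n) x - f (r 0) x" for n
      unfolding d_def by (rule sum_lessThan_telescope)
    ultimately have "(\<lambda>n. f (r n) x - f (r 0) x) \<longlonglongrightarrow> suminf (\<lambda>k. d k x)" by simp
    then have "(\<lambda>n. (f (r n) x - f (r 0) x) + f (r 0) x) \<longlonglongrightarrow> suminf (\<lambda>k. d k x) + f (r 0) x"
      by (intro tendsto_intros)
    then have "convergent (\<lambda>k. f (r k) x)" by (auto simp: convergent_def)
    then show ?case by (simp add: convergent_LIMSEQ_iff)
  qed
  define g where "g x = lim (\<lambda>k. f (r k) x)" for x
  have [measurable]: "g \<in> borel_measurable ?N" unfolding g_def by measurable
  \<comment> \<open>Nonnegative integrals are used because square integrability of
    \<open>f n - g\<close> is not known yet; it is read off from this bound.\<close>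
  have Fatou: "(\<integral>\<^sup>+x. ennreal ((f n x - g x)\<^sup>2) \<partial>?N) \<le> ennreal e"
    if e: "\<forall>m\<ge>K. \<forall>n\<ge>K. (LINT x|?N. (f m x - f n x)\<^sup>2) < e" and n: "n \<ge> K" for e n K
  proof -
    have "(\<integral>\<^sup>+x. ennreal ((f n x - g x)\<^sup>2) \<partial>?N)
      = (\<integral>\<^sup>+x. liminf (\<lambda>k. ennreal ((f n x - f (r k) x)\<^sup>2)) \<partial>?N)"
    proof (rule nn_integral_cong_AE)
      show "AE x in ?N. ennreal ((f n x - g x)\<^sup>2) = liminf (\<lambda>k. ennreal ((f n x - f (r k) x)\<^sup>2))"
        using conv
      proof eventually_elim
        case (elim x)
        then have "(\<lambda>k. ennreal ((f n x - f (r k) x)\<^sup>2)) \<longlonglongrightarrow> ennreal ((f n x - g x)\<^sup>2)"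
          unfolding g_def by (intro tendsto_ennrealI tendsto_intros)
        then show ?case by (intro lim_imp_Liminf[symmetric]) simp_all
      qed
    qed
    also have "\<dots> \<le> liminf (\<lambda>k. \<integral>\<^sup>+x. ennreal ((f n x - f (r k) x)\<^sup>2) \<partial>?N)"
      by (rule nn_integral_liminf) simp
    also have "\<dots> \<le> ennreal e"
    proof -
      have "eventually (\<lambda>k. (\<integral>\<^sup>+x. ennreal ((f n x - f (r k) x)\<^sup>2) \<partial>?N) \<le> ennreal e) sequentially"
        using eventually_ge_at_top[of K]
      proof eventually_elim
        case (elim k)
        have "k \<le> r k" unfolding r_def by simp
        with elim have "r k \<ge> K" by simp
        with e n show ?case unfolding nn by (intro ennreal_leI) (auto intro: less_imp_le)
      qed
      then show ?thesis by (intro Liminf_le) auto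
    qed
    finally show ?thesis .
  qed
  have bound: "integrable ?N (\<lambda>x. (f n x - g x)\<^sup>2) \<and> (LINT x|?N. (f n x - g x)\<^sup>2) \<le> e"
    if e: "\<forall>m\<ge>K. \<forall>n\<ge>K. (LINT x|?N. (f m x - f n x)\<^sup>2) < e" and n: "n \<ge> K" and "e > 0" for e n K
  proof
    have *: "(\<integral>\<^sup>+x. ennreal ((f n x - g x)\<^sup>2) \<partial>?N) \<le> ennreal e" by (rule Fatou[OF e n])
    show i: "integrable ?N (\<lambda>x. (f n x - g x)\<^sup>2)"
      using * by (intro integrableI_nonneg) (auto intro: le_less_trans)
    have "ennreal (LINT x|?N. (f n x - g x)\<^sup>2) \<le> ennreal e"
      using * nn_integral_eq_integral[OF i] by simp
    with \<open>e > 0\<close> show "(LINT x|?N. (f n x - g x)\<^sup>2) \<le> e" by simp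
  qed
  obtain K1 where K1: "\<forall>m\<ge>K1. \<forall>n\<ge>K1. (LINT x|?N. (f m x - f n x)\<^sup>2) < 1"
    using Cauchy[of 1] by auto
  have "(\<lambda>x. f K1 x - g x) \<in> L2 S"
    using bound[OF K1, of K1] by (simp add: L2_def)
  from L2_minus[OF f[of K1] this] have g: "g \<in> L2 S" by simp
  moreover have "(\<lambda>n. LINT x|?N. (f n x - g x)\<^sup>2) \<longlonglongrightarrow> 0"
  proof (rule LIMSEQ_I)
    fix e :: real assume e: "e > 0"
    then obtain K where K: "\<forall>m\<ge>K. \<forall>n\<ge>K. (LINT x|?N. (f m x - f n x)\<^sup>2) < e/2"
      using Cauchy[of "e/2"] by auto
    show "\<exists>no. \<forall>n\<ge>no. norm ((LINT x|?N. (f n x - g x)\<^sup>2) - 0) < e"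
    proof (intro exI[of _ K] allI impI)
      fix n assume "n \<ge> K"
      with bound[OF K, of n] e have "(LINT x|?N. (f n x - g x)\<^sup>2) \<le> e/2" by simp
      moreover have "0 \<le> (LINT x|?N. (f n x - g x)\<^sup>2)" by simp
      ultimately show "norm ((LINT x|?N. (f n x - g x)\<^sup>2) - 0) < e" using e by simp
    qed
  qed
  ultimately show ?thesis by (rule that)
qed

section \<open>Test functions\<close>

lemma grad_eq:
  assumes "GDERIV f x :> g"
  shows "grad f x = g"
  unfolding grad_def
proof (rule the_equality[where P = "\<lambda>D. GDERIV f x :> D", OF assms])
  fix D assume "GDERIV f x :> D"
  with assms have "(\<lambda>h. h \<bullet> D) = (\<lambda>h. h \<bullet> g)"
    unfolding gderiv_def by (metis has_derivative_unique)
  then have "\<forall>h. h \<bullet> D = h \<bullet> g" by metis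
  then show "D = g" by (simp only: vector_eq_ldot)
qed

lemma C1c_gderiv:
  assumes "\<phi> \<in> C1c S"
  shows "GDERIV \<phi> x :> grad \<phi> x"
proof -
  obtain g where "GDERIV \<phi> x :> g x"
    using assms by (auto simp: C1c_def)
  then show ?thesis using grad_eq by metis
qed

lemma C1c_continuous_grad:
  assumes "\<phi> \<in> C1c S"
  shows "continuous_on UNIV (grad \<phi>)"
proof -
  obtain g where "continuous_on UNIV g" "\<forall>x. GDERIV \<phi> x :> g x"
    using assms by (auto simp: C1c_def)
  moreover from this have "grad \<phi> = g" by (auto intro: grad_eq)
  ultimately show ?thesis by simp
qed

lemma C1c_continuous:
  assumes "\<phi> \<in> C1c S"
  shows "continuous_on UNIV \<phi>"
proof (rule continuous_at_imp_continuous_on, intro ballI)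
  fix x
  show "isCont \<phi> x"
    by (rule has_derivative_continuous[OF C1c_gderiv[OF assms, unfolded gderiv_def]])
qed

lemma C1cI:
  assumes "\<And>x. GDERIV \<phi> x :> g x" "continuous_on UNIV g" "compact K" "K \<subseteq> S"
    and "\<And>x. x \<notin> K \<Longrightarrow> \<phi> x = 0"
  shows "\<phi> \<in> C1c S"
proof -
  have "closure {x. \<phi> x \<noteq> 0} \<subseteq> K"
    using assms(3,5) by (intro closure_minimal) (auto intro: compact_imp_closed)
  moreover from this have "compact (closure {x. \<phi> x \<noteq> 0})"
    using assms(3) by (metis closed_closure compact_Int_closed inf.absorb_iff2)
  ultimately show ?thesis using assms unfolding C1c_def by blast
qed

lemma C1c_support:
  assumes "\<phi> \<in> C1c S"
  obtains K where "compact K" "K \<subseteq> S" "\<And>x. x \<notin> K \<Longrightarrow> \<phi> x = 0" "\<And>x. x \<notin> K \<Longrightarrow> grad \<phi> x = 0"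
proof (rule that)
  let ?K = "closure {x. \<phi> x \<noteq> 0}"
  show "compact ?K" "?K \<subseteq> S" using assms by (auto simp: C1c_def)
  show 0: "\<phi> x = 0" if "x \<notin> ?K" for x
    using that closure_subset[of "{x. \<phi> x \<noteq> 0}"] by auto
  show "grad \<phi> x = 0" if "x \<notin> ?K" for x
  proof (rule grad_eq)
    have "((\<lambda>_. 0::real) has_derivative (\<lambda>h. h \<bullet> 0)) (at x)" by simp
    then show "GDERIV \<phi> x :> 0"
      unfolding gderiv_def
    proof (rule has_derivative_transform_within_open[where s = "- ?K"])
      show "open (- ?K)" by (intro open_Compl closed_closure)
      show "x \<in> - ?K" using that by (simp only: Compl_iff not_False_eq_True)
      show "0 = \<phi> z" if "z \<in> - ?K" for z using 0[OF ComplD[OF that]] by (rule sym)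
    qed
  qed
qed

lemma C1c_outside:
  assumes "\<phi> \<in> C1c S" "x \<notin> S"
  shows "\<phi> x = 0" "grad \<phi> x = 0"
proof -
  obtain K where "K \<subseteq> S" "\<And>x. x \<notin> K \<Longrightarrow> \<phi> x = 0" "\<And>x. x \<notin> K \<Longrightarrow> grad \<phi> x = 0"
    using C1c_support[OF assms(1)] by metis
  with assms(2) show "\<phi> x = 0" "grad \<phi> x = 0" by auto
qed

lemma C1c_bounded:
  assumes "\<phi> \<in> C1c S"
  obtains B where "\<And>x. \<bar>\<phi> x\<bar> \<le> B" "\<And>x. norm (grad \<phi> x) \<le> B"
proof -
  obtain K where K: "compact K" "\<And>x. x \<notin> K \<Longrightarrow> \<phi> x = 0" "\<And>x. x \<notin> K \<Longrightarrow> grad \<phi> x = 0"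
    using C1c_support[OF assms] by metis
  have "bounded (\<phi> ` K)"
    using K(1) C1c_continuous[OF assms]
    by (intro compact_imp_bounded compact_continuous_image) (auto intro: continuous_on_subset)
  then obtain B1 where B1: "\<And>x. x \<in> K \<Longrightarrow> \<bar>\<phi> x\<bar> \<le> B1" by (auto simp: bounded_iff)
  have "bounded (grad \<phi> ` K)"
    using K(1) C1c_continuous_grad[OF assms]
    by (intro compact_imp_bounded compact_continuous_image) (auto intro: continuous_on_subset)
  then obtain B2 where B2: "\<And>x. x \<in> K \<Longrightarrow> norm (grad \<phi> x) \<le> B2" by (auto simp: bounded_iff)
  show ?thesis
  proof (rule that)
    fix x
    show "\<bar>\<phi> x\<bar> \<le> max 0 (max B1 B2)" "norm (grad \<phi> x) \<le> max 0 (max B1 B2)"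
      using B1[of x] B2[of x] K(2,3)[of x] by (cases "x \<in> K"; simp; linarith)+
  qed
qed

text \<open>The second hypothesis is purely a condition on sets. For
  \<open>S = S' = \<Omega> \<times> J\<close> with \<open>J\<close> a half-line in time it admits
  exactly one direction of time shifts.\<close>

lemma C1c_translate:
  assumes "\<phi> \<in> C1c S" "\<And>z. z + c \<in> S \<Longrightarrow> z \<in> S'"
  shows "(\<lambda>z. \<phi> (z + c)) \<in> C1c S'" "grad (\<lambda>z. \<phi> (z + c)) z = grad \<phi> (z + c)"
proof -
  have D: "GDERIV (\<lambda>z. \<phi> (z + c)) z :> grad \<phi> (z + c)" for z
  proof -
    have "((\<lambda>z. z + c) has_derivative (\<lambda>h. h)) (at z)"
      by (auto intro!: derivative_eq_intros)
    from has_derivative_compose[OF this C1c_gderiv[OF assms(1), unfolded gderiv_def]]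
    show ?thesis unfolding gderiv_def .
  qed
  show "grad (\<lambda>z. \<phi> (z + c)) z = grad \<phi> (z + c)" by (rule grad_eq[OF D])
  obtain K where K: "compact K" "K \<subseteq> S" "\<And>x. x \<notin> K \<Longrightarrow> \<phi> x = 0"
    using C1c_support[OF assms(1)] by metis
  show "(\<lambda>z. \<phi> (z + c)) \<in> C1c S'"
  proof (rule C1cI[OF D])
    show "continuous_on UNIV (\<lambda>z. grad \<phi> (z + c))"
      by (intro continuous_on_compose2[OF C1c_continuous_grad[OF assms(1)]] continuous_intros) auto
    show "compact ((\<lambda>z. z - c) ` K)"
      by (intro compact_continuous_image continuous_intros K)
    show "(\<lambda>z. z - c) ` K \<subseteq> S'" using assms(2) K(2) by force
    show "\<phi> (x + c) = 0" if "x \<notin> (\<lambda>z. z - c) ` K" for x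
      using that by (intro K(3)) force
  qed
qed

text \<open>Vanishing off a closed \<open>C\<close> inside \<open>J\<close> keeps the support
  compact: it lies in the compact set \<open>K\<close> cut by \<open>C\<close>. Only the spatial
  gradient is recorded, since the time derivative contains \<open>\<theta>'\<close>, which has no
  uniform bound for sharper and sharper cut-offs; the weak equation will eliminate it.\<close>

lemma C1c_time_cutoff:
  fixes \<phi> :: "'a::euclidean_space \<times> real \<Rightarrow> real"
  assumes "\<phi> \<in> C1c (\<Omega> \<times> UNIV)"
    and \<theta>: "\<And>t. (\<theta> has_real_derivative \<theta>' t) (at t)" "continuous_on UNIV \<theta>'"
    and C: "closed C" "C \<subseteq> J" "\<And>t. t \<notin> C \<Longrightarrow> \<theta> t = 0"
  shows "(\<lambda>z. \<theta> (snd z) * \<phi> z) \<in> C1c (\<Omega> \<times> J)"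
    and "fst (grad (\<lambda>z. \<theta> (snd z) * \<phi> z) z) = \<theta> (snd z) *\<^sub>R fst (grad \<phi> z)"
proof -
  let ?g = "\<lambda>z. \<theta> (snd z) *\<^sub>R grad \<phi> z + (0, \<phi> z * \<theta>' (snd z))"
  have D: "GDERIV (\<lambda>z. \<theta> (snd z) * \<phi> z) z :> ?g z" for z
  proof -
    have 1: "((\<lambda>z::'a\<times>real. \<theta> (snd z)) has_derivative (\<lambda>h. \<theta>' (snd z) * snd h)) (at z)"
      by (rule has_derivative_compose[OF _ \<theta>(1)[unfolded has_field_derivative_def]])
        (auto intro!: derivative_eq_intros)
    have "((\<lambda>z. \<theta> (snd z) * \<phi> z) has_derivative
        (\<lambda>h. \<theta> (snd z) * (h \<bullet> grad \<phi> z) + (\<theta>' (snd z) * snd h) * \<phi> z)) (at z)"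
      by (rule has_derivative_mult[OF 1 C1c_gderiv[OF assms(1), unfolded gderiv_def]])
    moreover have "\<theta> (snd z) * (h \<bullet> grad \<phi> z) + (\<theta>' (snd z) * snd h) * \<phi> z = h \<bullet> ?g z" for h
      by (simp add: inner_add_right inner_prod_def algebra_simps)
    ultimately show ?thesis unfolding gderiv_def by simp
  qed
  show "fst (grad (\<lambda>z. \<theta> (snd z) * \<phi> z) z) = \<theta> (snd z) *\<^sub>R fst (grad \<phi> z)"
    by (simp add: grad_eq[OF D])
  obtain K where K: "compact K" "K \<subseteq> \<Omega> \<times> UNIV" "\<And>x. x \<notin> K \<Longrightarrow> \<phi> x = 0"
    using C1c_support[OF assms(1)] by metis
  have \<theta>_cont: "continuous_on UNIV \<theta>"
    using \<theta>(1) by (intro continuous_at_imp_continuous_on ballI DERIV_isCont)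
  show "(\<lambda>z. \<theta> (snd z) * \<phi> z) \<in> C1c (\<Omega> \<times> J)"
  proof (rule C1cI[OF D])
    show "continuous_on UNIV ?g"
      by (intro continuous_intros C1c_continuous_grad[OF assms(1)] C1c_continuous[OF assms(1)]
          continuous_on_compose2[OF \<theta>_cont] continuous_on_compose2[OF \<theta>(2)]) auto
    have "closed (snd -` C :: ('a \<times> real) set)" by (rule closed_vimage_snd[OF C(1)])
    then show "compact (K \<inter> snd -` C)" using K(1) by (intro compact_Int_closed)
    show "K \<inter> snd -` C \<subseteq> \<Omega> \<times> J" using K(2) C(2) by auto
    show "\<theta> (snd x) * \<phi> x = 0" if "x \<notin> K \<inter> snd -` C" for x
      using that K(3)[of x] C(3)[of "snd x"] by auto
  qed
qed

text \<open>An explicit transition from 0 towards 1. Squaring the positive part makes it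
  differentiable at 0. The value 1 is only approached at infinity, which is enough for cut-offs that
  have to converge to 1 pointwise.\<close>

definition C1_step :: "real \<Rightarrow> real" where
  "C1_step u = 1 - inverse (1 + (max 0 u)\<^sup>2)"

lemma C1_step_range: "0 \<le> C1_step u" "C1_step u \<le> 1"
  using inverse_le_1_iff[of "1 + (max 0 u)\<^sup>2"] zero_le_power2[of "max 0 u"]
  unfolding C1_step_def by auto

lemma C1_step_nonpos: "u \<le> 0 \<Longrightarrow> C1_step u = 0"
  by (simp add: C1_step_def)

lemma C1_step_tendsto: "(C1_step \<longlongrightarrow> 1) at_top"
proof -
  have "filterlim (\<lambda>u::real. 1 + (max 0 u)\<^sup>2) at_top at_top"
  proof (rule filterlim_at_top_mono[OF filterlim_ident])
    show "\<forall>\<^sub>F u::real in at_top. u \<le> 1 + (max 0 u)\<^sup>2"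
    proof (intro always_eventually allI)
      fix u :: real
      have "0 \<le> (max 0 u - 1)\<^sup>2 + (max 0 u)\<^sup>2" by simp
      then show "u \<le> 1 + (max 0 u)\<^sup>2" by (simp add: power2_eq_square algebra_simps)
    qed
  qed
  then have "((\<lambda>u::real. inverse (1 + (max 0 u)\<^sup>2)) \<longlongrightarrow> 0) at_top"
    by (rule tendsto_inverse_0_at_top)
  then have "((\<lambda>u::real. 1 - inverse (1 + (max 0 u)\<^sup>2)) \<longlongrightarrow> 1 - 0) at_top"
    by (intro tendsto_intros)
  then show ?thesis by (simp add: C1_step_def[abs_def])
qed

lemma DERIV_max_0_squared: "((\<lambda>u::real. (max 0 u)\<^sup>2) has_real_derivative 2 * max 0 u) (at u)"
proof -
  consider "u < 0" | "u > 0" | "u = 0" by linarith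
  then show ?thesis
  proof cases
    case 1
    have "((\<lambda>u::real. 0) has_real_derivative 2 * max 0 u) (at u)" using 1 by simp
    then show ?thesis
      by (rule has_field_derivative_transform_within_open[where S = "{..<0}"]) (use 1 in auto)
  next
    case 2
    have "((\<lambda>u::real. u\<^sup>2) has_real_derivative 2 * max 0 u) (at u)"
      using 2 by (auto intro!: derivative_eq_intros)
    then show ?thesis
      by (rule has_field_derivative_transform_within_open[where S = "{0<..}"]) (use 2 in auto)
  next
    case 3
    have "((\<lambda>h::real. (max 0 h)\<^sup>2 / h) \<longlongrightarrow> 0) (at 0)"
    proof (rule tendsto_0_le[where K = 1])
      show "((\<lambda>h::real. h) \<longlongrightarrow> 0) (at 0)" by (rule tendsto_ident_at)
      show "\<forall>\<^sub>F h::real in at 0. norm ((max 0 h)\<^sup>2 / h) \<le> norm h * 1"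
        by (intro always_eventually allI) (auto simp: max_def power2_eq_square)
    qed
    with 3 show ?thesis by (simp add: has_field_derivative_iff)
  qed
qed

lemma C1_step_deriv:
  "(C1_step has_real_derivative 2 * max 0 u / (1 + (max 0 u)\<^sup>2)\<^sup>2) (at u)"
proof -
  have pos: "1 + (max 0 u)\<^sup>2 \<noteq> 0" by (smt (verit) zero_le_power2)
  have "((\<lambda>u. 1 - inverse (1 + (max 0 u)\<^sup>2)) has_real_derivative
      0 - - (inverse (1 + (max 0 u)\<^sup>2) * (0 + 2 * max 0 u) * inverse (1 + (max 0 u)\<^sup>2))) (at u)"
    by (intro DERIV_diff DERIV_const DERIV_inverse' DERIV_add DERIV_max_0_squared pos)
  then show ?thesis
    by (simp add: C1_step_def[abs_def] power2_eq_square divide_inverse mult_ac)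
qed

section \<open>Duality of the forward and the backward problem\<close>

lemma L2_bounded:
  assumes "S \<in> sets lborel" "bounded S" "f \<in> borel_measurable (lborel_on S)"
    and "\<And>x. x \<in> S \<Longrightarrow> norm (f x) \<le> B"
  shows "f \<in> L2 S"
proof -
  have "emeasure lborel S < \<infinity>" using assms(2) emeasure_bounded_finite by blast
  then have "finite_measure (lborel_on S)"
    using assms(1) by (intro finite_measureI) (simp add: emeasure_restrict_space space_restrict_space)
  then have "integrable (lborel_on S) (\<lambda>x. (norm (f x))\<^sup>2)"
  proof (rule finite_measure.integrable_const_bound)
    show "AE x in lborel_on S. norm ((norm (f x))\<^sup>2) \<le> B\<^sup>2"
      using assms(4) by (intro AE_I2) (auto simp: space_restrict_space intro: power_mono)
    show "(\<lambda>x. (norm (f x))\<^sup>2) \<in> borel_measurable (lborel_on S)"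
      using assms(3) by measurable
  qed
  with assms(3) show ?thesis by (simp add: L2_def)
qed

text \<open>Combines a spatial gradient with a function value, so that the energy norm becomes a
  single \<open>L2\<close> norm and the weak form a single inner product.\<close>

lemma L2_Pair:
  assumes "f \<in> L2 S" "g \<in> L2 S"
  shows "(\<lambda>x. (f x, g x)) \<in> L2 S"
  using assms Bochner_Integration.integrable_add[OF L2_norm_integrable[OF assms(1)] L2_norm_integrable[OF assms(2)]]
  by (auto simp: L2_def norm_Pair)

lemma borel_measurable_lborel_on:
  fixes f :: "'b::euclidean_space \<Rightarrow> 'c::euclidean_space"
  assumes "continuous_on S f"
  shows "f \<in> borel_measurable (lborel_on S)"
proof -
  have "sets (lborel_on S) = sets (restrict_space borel S)"
    by (intro sets_restrict_space_cong) simp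
  then show ?thesis
    using borel_measurable_continuous_on_restrict[OF assms]
    by (simp cong: measurable_cong_sets)
qed

lemma C1c_L2:
  assumes "\<phi> \<in> C1c S'" "S \<in> sets lborel" "bounded S"
  shows "\<phi> \<in> L2 S" "grad \<phi> \<in> L2 S"
proof -
  obtain B where "\<And>x. \<bar>\<phi> x\<bar> \<le> B" "\<And>x. norm (grad \<phi> x) \<le> B"
    using C1c_bounded[OF assms(1)] by metis
  then show "\<phi> \<in> L2 S" "grad \<phi> \<in> L2 S"
    using C1c_continuous[OF assms(1)] C1c_continuous_grad[OF assms(1)]
    by (auto intro!: L2_bounded[OF assms(2,3), where B = B] borel_measurable_lborel_on
        intro: continuous_on_subset)
qed

lemma L2_fst: "f \<in> L2 S \<Longrightarrow> (\<lambda>x. fst (f x)) \<in> L2 S"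
  and L2_snd: "f \<in> L2 S \<Longrightarrow> (\<lambda>x. snd (f x)) \<in> L2 S"
  for f :: "'b::euclidean_space \<Rightarrow> 'c::euclidean_space \<times> 'd::euclidean_space"
proof -
  assume f: "f \<in> L2 S"
  have [measurable]: "f \<in> borel_measurable (lborel_on S)" using f by (simp add: L2_def)
  have 1: "(\<lambda>x. fst (f x)) \<in> borel_measurable (lborel_on S)"
    by (rule borel_measurable_continuous_on[where f = fst]) (auto intro: continuous_intros)
  have 2: "(\<lambda>x. snd (f x)) \<in> borel_measurable (lborel_on S)"
    by (rule borel_measurable_continuous_on[where f = snd]) (auto intro: continuous_intros)
  have n: "norm (fst z) \<le> norm z" "norm (snd z) \<le> norm z" for z :: "'c \<times> 'd"
    by (metis norm_fst_le prod.collapse, metis norm_snd_le prod.collapse)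
  show "(\<lambda>x. fst (f x)) \<in> L2 S"
    unfolding L2_def using 1
    by (auto intro!: Bochner_Integration.integrable_bound[OF L2_norm_integrable[OF f]] AE_I2
        power_mono n)
  show "(\<lambda>x. snd (f x)) \<in> L2 S"
    unfolding L2_def using 2
    by (auto intro!: Bochner_Integration.integrable_bound[OF L2_norm_integrable[OF f]] AE_I2
        power_mono n)
qed

section \<open>Translations of integrals and of square integrable functions\<close>

lemma integral_lborel_translate:
  fixes f :: "'b::euclidean_space \<Rightarrow> 'c::euclidean_space"
  assumes "f \<in> borel_measurable lborel"
  shows "(LINT x|lborel. f (x + c)) = (LINT x|lborel. f x)"
proof -
  have "(LINT x|lborel. f x) = (LINT x|distr lborel borel ((+) c). f x)"
    by (simp add: lborel_distr_plus)
  also have "\<dots> = (LINT x|lborel. f (c + x))"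
    using assms by (intro integral_distr) auto
  finally show ?thesis by (simp add: add.commute)
qed

lemma integrable_lborel_translate:
  fixes f :: "'b::euclidean_space \<Rightarrow> 'c::euclidean_space"
  assumes "integrable lborel f"
  shows "integrable lborel (\<lambda>x. f (x + c))"
proof -
  have "integrable (distr lborel borel ((+) c)) f"
    using assms by (simp add: lborel_distr_plus)
  then have "integrable lborel (\<lambda>x. f (c + x))"
    using borel_measurable_integrable[OF assms] by (subst (asm) integrable_distr_eq) auto
  then show ?thesis by (simp add: add.commute)
qed

text \<open>Translation invariance holds on the whole space for the extension by zero; restricting
  to \<open>S\<close> can only lose mass, whence an inequality that is uniform in the shift
  \<open>c\<close>.\<close>

lemma L2_translate:
  assumes f: "f \<in> L2 Q" and Q: "Q \<in> sets lborel" and S: "S \<in> sets lborel"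
  shows "(\<lambda>s. indicator Q (s + c) *\<^sub>R f (s + c)) \<in> L2 S"
    and "(LINT s|lborel_on S. (norm (indicator Q (s + c) *\<^sub>R f (s + c)))\<^sup>2)
      \<le> (LINT s|lborel_on Q. (norm (f s))\<^sup>2)"
proof -
  let ?h = "\<lambda>s. indicator Q s *\<^sub>R f s"
  have m[measurable]: "?h \<in> borel_measurable lborel"
    using f Q by (simp add: L2_def borel_measurable_restrict_space_iff)
  have sq: "(norm (?h s))\<^sup>2 = indicator Q s *\<^sub>R (norm (f s))\<^sup>2" for s
    by (simp add: indicator_def)
  have i: "integrable lborel (\<lambda>s. (norm (?h s))\<^sup>2)"
    using L2_norm_integrable[OF f] Q unfolding sq by (simp add: integrable_restrict_space)
  have i': "integrable lborel (\<lambda>s. (norm (?h (s + c)))\<^sup>2)"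
    using integrable_lborel_translate[OF i] .
  then have i'': "integrable lborel (\<lambda>s. indicator S s *\<^sub>R (norm (?h (s + c)))\<^sup>2)"
    using S by (intro integrable_mult_indicator) auto
  have "(\<lambda>s. ?h (s + c)) \<in> borel_measurable lborel"
    using measurable_compose[OF _ m, of "\<lambda>s. s + c" lborel] by simp
  then have "(\<lambda>s. ?h (s + c)) \<in> borel_measurable (lborel_on S)"
    by (rule measurable_restrict_space1)
  with i'' S show "(\<lambda>s. ?h (s + c)) \<in> L2 S"
    by (simp add: L2_def integrable_restrict_space)
  have "(LINT s|lborel_on S. (norm (?h (s + c)))\<^sup>2)
      = (LINT s|lborel. indicator S s *\<^sub>R (norm (?h (s + c)))\<^sup>2)"
    using S by (simp add: integral_restrict_space)
  also have "\<dots> \<le> (LINT s|lborel. (norm (?h (s + c)))\<^sup>2)"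
    using i' i'' by (intro integral_mono) (auto simp: indicator_def)
  also have "\<dots> = (LINT s|lborel. (norm (?h s))\<^sup>2)"
    by (rule integral_lborel_translate) measurable
  also have "\<dots> = (LINT s|lborel_on Q. (norm (f s))\<^sup>2)"
    unfolding sq using Q by (simp add: integral_restrict_space)
  finally show "(LINT s|lborel_on S. (norm (?h (s + c)))\<^sup>2) \<le> (LINT s|lborel_on Q. (norm (f s))\<^sup>2)" .
qed

text \<open>Substituting \<open>s - c\<close> for \<open>s\<close> exchanges the two indicators. For
  \<open>c = (0, \<tau>)\<close> a forward shift of \<open>z\<close> becomes a backward shift of
  \<open>y\<close>, so that both weak equations can be applied to one function of
  \<open>\<tau>\<close>.\<close>

lemma integral_mult_translate_commute:
  fixes f g :: "'b::euclidean_space \<Rightarrow> real"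
  assumes "f \<in> L2 Q" "g \<in> L2 Q" "Q \<in> sets lborel"
  shows "(LINT s|lborel_on Q. f s * (indicator Q (s + c) * g (s + c)))
    = (LINT s|lborel_on Q. g s * (indicator Q (s + - c) * f (s + - c)))"
proof -
  have [measurable]: "(\<lambda>s. indicator Q s * f s) \<in> borel_measurable lborel"
      "(\<lambda>s. indicator Q s * g s) \<in> borel_measurable lborel"
    using assms by (simp_all add: L2_def borel_measurable_restrict_space_iff)
  have "(\<lambda>s. indicator Q (s + - c) * f (s + - c)) \<in> borel_measurable lborel"
    using measurable_compose[of "\<lambda>s. s + - c" lborel lborel "\<lambda>s. indicator Q s * f s"] by simp
  then have m: "(\<lambda>s. indicator Q s * g s * (indicator Q (s + - c) * f (s + - c))) \<in> borel_measurable lborel"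
    by simp
  have "(LINT s|lborel_on Q. f s * (indicator Q (s + c) * g (s + c)))
      = (LINT s|lborel. indicator Q (s + c) * g (s + c) * (indicator Q (s + c + - c) * f (s + c + - c)))"
    using assms(3) by (simp add: integral_restrict_space mult_ac)
  also have "\<dots> = (LINT s|lborel. indicator Q s * g s * (indicator Q (s + - c) * f (s + - c)))"
    by (rule integral_lborel_translate[OF m])
  also have "\<dots> = (LINT s|lborel_on Q. g s * (indicator Q (s + - c) * f (s + - c)))"
    using assms(3) by (simp add: integral_restrict_space mult_ac)
  finally show ?thesis .
qed

text \<open>All differentiation falls on \<open>\<psi>\<close>. Its difference quotients along
  \<open>e\<close> are bounded by \<open>B * norm e\<close> uniformly in the base point, and
  \<open>y\<close> is integrable on the bounded set \<open>Q\<close>, so dominated convergence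
  applies.\<close>

lemma integral_translate_deriv:
  fixes y :: "'b::euclidean_space \<Rightarrow> real"
  assumes y: "y \<in> L2 Q" and \<psi>: "\<psi> \<in> C1c S" and Q: "Q \<in> sets lborel" "bounded Q"
  shows "((\<lambda>\<tau>. LINT s|lborel_on Q. y s * \<psi> (s + \<tau> *\<^sub>R e)) has_real_derivative
    (LINT s|lborel_on Q. y s * (grad \<psi> (s + \<tau> *\<^sub>R e) \<bullet> e))) (at \<tau>)"
proof -
  let ?N = "lborel_on Q"
  let ?F = "\<lambda>\<tau>. LINT s|?N. y s * \<psi> (s + \<tau> *\<^sub>R e)"
  have tr: "(\<lambda>s. \<psi> (s + c)) \<in> L2 Q" "(\<lambda>s. grad \<psi> (s + c)) \<in> L2 Q" for c
  proof -
    have "grad (\<lambda>z. \<psi> (z + c)) = (\<lambda>s. grad \<psi> (s + c))"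
      using C1c_translate(2)[OF \<psi>, of c UNIV] by auto
    then show "(\<lambda>s. \<psi> (s + c)) \<in> L2 Q" "(\<lambda>s. grad \<psi> (s + c)) \<in> L2 Q"
      using C1c_L2[OF C1c_translate(1)[OF \<psi>, of c UNIV] Q] by simp_all
  qed
  have [measurable]: "y \<in> borel_measurable ?N" "(\<lambda>s. \<psi> (s + c)) \<in> borel_measurable ?N"
     "(\<lambda>s. grad \<psi> (s + c)) \<in> borel_measurable ?N" for c
    using y tr by (simp_all add: L2_def)
  have int: "integrable ?N (\<lambda>s. y s * \<psi> (s + c))" for c
    by (rule L2_mult_integrable[OF y tr(1)])
  obtain B where B: "\<And>x. norm (grad \<psi> x) \<le> B" using C1c_bounded[OF \<psi>] by metis
  have D: "((\<lambda>\<tau>. \<psi> (s + \<tau> *\<^sub>R e)) has_real_derivative grad \<psi> (s + \<tau> *\<^sub>R e) \<bullet> e) (at \<tau>)" for s \<tau>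
  proof -
    have "((\<lambda>\<tau>. s + \<tau> *\<^sub>R e) has_derivative (\<lambda>h. h *\<^sub>R e)) (at \<tau>)"
      by (auto intro!: derivative_eq_intros)
    from has_derivative_compose[OF this C1c_gderiv[OF \<psi>, unfolded gderiv_def]]
    show ?thesis unfolding has_field_derivative_def
      by (rule has_derivative_eq_rhs) (auto simp: inner_commute)
  qed
  have lip: "\<bar>\<psi> (s + \<tau>' *\<^sub>R e) - \<psi> (s + \<tau> *\<^sub>R e)\<bar> \<le> (B * norm e) * \<bar>\<tau>' - \<tau>\<bar>" for s \<tau>' \<tau>
  proof -
    have "norm (grad \<psi> (s + u *\<^sub>R e) \<bullet> e) \<le> B * norm e" for u
      using Cauchy_Schwarz_ineq2[of "grad \<psi> (s + u *\<^sub>R e)" e] B[of "s + u *\<^sub>R e"]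
      by (simp add: order_trans[OF _ mult_right_mono])
    then have "norm (\<psi> (s + \<tau>' *\<^sub>R e) - \<psi> (s + \<tau> *\<^sub>R e)) \<le> (B * norm e) * norm (\<tau>' - \<tau>)"
      by (intro field_differentiable_bound[OF convex_UNIV D]) auto
    then show ?thesis by simp
  qed
  have "((\<lambda>\<tau>'. (?F \<tau>' - ?F \<tau>) / (\<tau>' - \<tau>)) \<longlongrightarrow> (LINT s|?N. y s * (grad \<psi> (s + \<tau> *\<^sub>R e) \<bullet> e))) (at \<tau>)"
    unfolding tendsto_at_iff_sequentially comp_def
  proof (intro allI impI)
    fix X :: "nat \<Rightarrow> real"
    assume X: "\<forall>i. X i \<in> UNIV - {\<tau>}" "X \<longlonglongrightarrow> \<tau>"
    have eq: "(?F (X i) - ?F \<tau>) / (X i - \<tau>)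
        = (LINT s|?N. y s * ((\<psi> (s + X i *\<^sub>R e) - \<psi> (s + \<tau> *\<^sub>R e)) / (X i - \<tau>)))" for i
      by (simp add: int right_diff_distrib diff_divide_distrib)
    show "(\<lambda>i. (?F (X i) - ?F \<tau>) / (X i - \<tau>)) \<longlonglongrightarrow> (LINT s|?N. y s * (grad \<psi> (s + \<tau> *\<^sub>R e) \<bullet> e))"
      unfolding eq
    proof (rule integral_dominated_convergence[where w = "\<lambda>s. norm (y s * (B * norm e))"])
      have "(\<lambda>s. B * norm e) \<in> L2 Q"
        by (rule L2_bounded[OF Q, where B = "\<bar>B * norm e\<bar>"]) auto
      then show "integrable ?N (\<lambda>s. norm (y s * (B * norm e)))"
        by (intro integrable_norm L2_mult_integrable[OF y])
      show "AE s in ?N. (\<lambda>i. y s * ((\<psi> (s + X i *\<^sub>R e) - \<psi> (s + \<tau> *\<^sub>R e)) / (X i - \<tau>)))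
          \<longlonglongrightarrow> y s * (grad \<psi> (s + \<tau> *\<^sub>R e) \<bullet> e)"
      proof (intro AE_I2 tendsto_mult tendsto_const)
        fix s
        have "((\<lambda>\<tau>'. (\<psi> (s + \<tau>' *\<^sub>R e) - \<psi> (s + \<tau> *\<^sub>R e)) / (\<tau>' - \<tau>)) \<longlongrightarrow> grad \<psi> (s + \<tau> *\<^sub>R e) \<bullet> e) (at \<tau>)"
          using D[of s \<tau>] by (simp add: has_field_derivative_iff)
        then show "(\<lambda>i. (\<psi> (s + X i *\<^sub>R e) - \<psi> (s + \<tau> *\<^sub>R e)) / (X i - \<tau>)) \<longlonglongrightarrow> grad \<psi> (s + \<tau> *\<^sub>R e) \<bullet> e"
          unfolding tendsto_at_iff_sequentially comp_def using X by blast
      qed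
      show "AE s in ?N. norm (y s * ((\<psi> (s + X i *\<^sub>R e) - \<psi> (s + \<tau> *\<^sub>R e)) / (X i - \<tau>)))
          \<le> norm (y s * (B * norm e))" for i
      proof (rule AE_I2)
        fix s
        have "\<bar>\<psi> (s + X i *\<^sub>R e) - \<psi> (s + \<tau> *\<^sub>R e)\<bar> / \<bar>X i - \<tau>\<bar> \<le> B * norm e"
          using lip[of s "X i" \<tau>] X(1) by (simp add: field_simps)
        then show "norm (y s * ((\<psi> (s + X i *\<^sub>R e) - \<psi> (s + \<tau> *\<^sub>R e)) / (X i - \<tau>)))
          \<le> norm (y s * (B * norm e))"
          unfolding real_norm_def abs_mult[of "y s"] abs_divide
          by (rule mult_left_mono[OF order_trans[OF _ abs_ge_self] abs_ge_zero])
      qed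
    qed measurable
  qed
  then show ?thesis by (simp add: has_field_derivative_iff)
qed

text \<open>The right derivative at \<open>0\<close> of \<open>\<tau> \<mapsto> \<integral> y(x,t) z(x,t + \<sigma>\<tau>)\<close>, where \<open>z\<close> is extended by zero
  outside the cylinder, exists although neither \<open>y\<close> nor \<open>z\<close> has a time derivative: for the test
  functions approximating \<open>z\<close> it is given by the weak equation of \<open>y\<close>, and the expression obtained
  is continuous with respect to the energy norm.\<close>

lemma weak_translate_deriv:
  fixes \<Omega> :: "'a::euclidean_space set" and y z :: "'a \<times> real \<Rightarrow> real"
    and W :: "'a \<times> real \<Rightarrow> 'a \<times> real"
  assumes \<Omega>: "open \<Omega>" "bounded \<Omega>" and Q_def: "Q = \<Omega> \<times> {0<..<T}"
    and \<sigma>: "\<sigma> = 1 \<and> J = {..<T} \<or> \<sigma> = - 1 \<and> J = {0<..}"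
    and y: "y \<in> L2 Q" and W: "W \<in> L2 Q" and z: "energy_space \<Omega> T z p"
    and weak: "\<And>\<phi>. \<phi> \<in> C1c (\<Omega> \<times> J) \<Longrightarrow>
      (LINT s|lborel_on Q. y s * (\<sigma> * snd (grad \<phi> s))) = (LINT s|lborel_on Q. W s \<bullet> (fst (grad \<phi> s), \<phi> s))"
  shows "((\<lambda>\<tau>. LINT s|lborel_on Q. y s * (indicator Q (s + (0, \<tau> * \<sigma>)) * z (s + (0, \<tau> * \<sigma>))))
    has_real_derivative (LINT s|lborel_on Q. W s \<bullet> (p s, z s))) (at 0 within {0..})"
proof -
  let ?N = "lborel_on Q"
  let ?e = "(0, \<sigma>) :: 'a \<times> real"
  have Q: "Q \<in> sets lborel" "bounded Q"
    using \<Omega> by (auto simp: Q_def open_Times bounded_Times)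
  have zp: "z \<in> L2 Q" "p \<in> L2 Q"
    using z by (auto simp: energy_space_def Let_def Q_def)
  obtain \<phi> where \<phi>: "\<And>n::nat. \<phi> n \<in> C1c (\<Omega> \<times> UNIV)"
    and lim1: "(\<lambda>n. LINT s|?N. (\<phi> n s - z s)\<^sup>2) \<longlonglongrightarrow> 0"
    and lim2: "(\<lambda>n. LINT s|?N. (norm (fst (grad (\<phi> n) s) - p s))\<^sup>2) \<longlonglongrightarrow> 0"
    using z by (auto simp: energy_space_def Let_def Q_def)
  \<comment> \<open>Distance to the end of the time interval that \<open>J\<close> excludes:
    \<open>T - t\<close> for \<open>\<sigma> = 1\<close> and \<open>t\<close> for
    \<open>\<sigma> = - 1\<close>.\<close>
  define d where "d t = (1 + \<sigma>) / 2 * T - \<sigma> * t" for t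
  \<comment> \<open>Subtracting 1 makes the cut-off vanish as soon as
    \<open>n * d t \<le> 1\<close>, that is, on a whole neighbourhood of the excluded end.\<close>
  define \<theta> where "\<theta> n t = C1_step (real n * d t - 1)" for n t
  have d_pos: "0 < d t" if "t \<in> {0<..<T}" for t
    using that \<sigma> by (auto simp: d_def)
  define \<psi> where "\<psi> n s = \<theta> n (snd s) * \<phi> n s" for n s
  define Z where "Z s = (p s, z s)" for s
  define X where "X n s = (fst (grad (\<psi> n) s), \<psi> n s)" for n s
  have cut: "\<psi> n \<in> C1c (\<Omega> \<times> J)" "fst (grad (\<psi> n) s) = \<theta> n (snd s) *\<^sub>R fst (grad (\<phi> n) s)" for n s
  proof -
    let ?C = "{t. 1 \<le> real n * d t}"
    let ?g = "\<lambda>u. 2 * max 0 u / (1 + (max 0 u)\<^sup>2)\<^sup>2"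
    have d': "((\<lambda>t. real n * d t - 1) has_real_derivative real n * (- \<sigma>)) (at t)" for t
      unfolding d_def by (auto intro!: derivative_eq_intros)
    have D: "(\<theta> n has_real_derivative ?g (real n * d t - 1) * (real n * (- \<sigma>))) (at t)" for t
      unfolding \<theta>_def by (rule DERIV_chain'[OF d' C1_step_deriv])
    have d_cont: "continuous_on UNIV d" unfolding d_def by (intro continuous_intros)
    have pos: "(1 + (max 0 u)\<^sup>2)\<^sup>2 \<noteq> 0" for u :: real
      by (smt (verit) zero_le_power2 power_eq_0_iff)
    have c: "continuous_on UNIV (\<lambda>t. ?g (real n * d t - 1) * (real n * (- \<sigma>)))"
      by (intro continuous_intros d_cont) (use pos in auto)
    have C: "closed ?C" by (intro closed_Collect_le continuous_intros d_cont)
    have CJ: "?C \<subseteq> J"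
    proof
      fix t assume "t \<in> ?C"
      then have "0 < real n * d t" by simp
      then have "0 < d t" by (simp add: zero_less_mult_iff)
      then show "t \<in> J" using \<sigma> by (auto simp: d_def)
    qed
    have zero: "\<theta> n t = 0" if "t \<notin> ?C" for t
      using that by (auto simp: \<theta>_def intro: C1_step_nonpos)
    show "\<psi> n \<in> C1c (\<Omega> \<times> J)" "fst (grad (\<psi> n) s) = \<theta> n (snd s) *\<^sub>R fst (grad (\<phi> n) s)"
      using C1c_time_cutoff[OF \<phi> D c C CJ zero, of n] unfolding \<psi>_def[abs_def] by simp_all
  qed
  have X_L2: "X n \<in> L2 Q" for n
    unfolding X_def[abs_def] using C1c_L2[OF cut(1) Q] by (intro L2_Pair L2_fst)
  have Z_L2: "Z \<in> L2 Q"
    unfolding Z_def[abs_def] using zp by (intro L2_Pair)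
  have lim: "(\<lambda>n. LINT s|?N. (norm (X n s - Z s))\<^sup>2) \<longlonglongrightarrow> 0"
  proof -
    define P where "P n s = (fst (grad (\<phi> n) s), \<phi> n s)" for n s
    have P_L2: "P n \<in> L2 Q" for n
      unfolding P_def[abs_def] using C1c_L2[OF \<phi> Q] by (intro L2_Pair L2_fst)
    have "(LINT s|?N. (norm (P n s - Z s))\<^sup>2)
      = (LINT s|?N. (\<phi> n s - z s)\<^sup>2) + (LINT s|?N. (norm (fst (grad (\<phi> n) s) - p s))\<^sup>2)" for n
    proof -
      have "(\<lambda>s. \<phi> n s - z s) \<in> L2 Q" "(\<lambda>s. fst (grad (\<phi> n) s) - p s) \<in> L2 Q"
        using C1c_L2[OF \<phi> Q] zp by (auto intro!: L2_minus L2_fst)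
      from Bochner_Integration.integral_add[OF L2_norm_integrable[OF this(1)] L2_norm_integrable[OF this(2)]]
      show ?thesis by (simp add: P_def Z_def norm_Pair add.commute)
    qed
    with tendsto_add[OF lim1 lim2] have limP: "(\<lambda>n. LINT s|?N. (norm (P n s - Z s))\<^sup>2) \<longlonglongrightarrow> 0"
      by simp
    have th[measurable]: "(\<lambda>s. \<theta> n (snd s)) \<in> borel_measurable ?N" for n
    proof (rule borel_measurable_lborel_on)
      have c: "continuous_on UNIV C1_step"
        using C1_step_deriv by (intro continuous_at_imp_continuous_on ballI DERIV_isCont)
      have "continuous_on Q (\<lambda>s. real n * d (snd s) - 1)"
        unfolding d_def by (intro continuous_intros)
      then show "continuous_on Q (\<lambda>s. \<theta> n (snd s))"
        unfolding \<theta>_def by (rule continuous_on_compose2[OF c _ subset_UNIV])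
    qed
    have th01: "0 \<le> \<theta> n t" "\<theta> n t \<le> 1" for n t
      unfolding \<theta>_def by (rule C1_step_range)+
    have [measurable]: "Z \<in> borel_measurable ?N" using Z_L2 by (simp add: L2_def)
    have limZ: "(\<lambda>n. LINT s|?N. (norm ((1 - \<theta> n (snd s)) *\<^sub>R Z s))\<^sup>2) \<longlonglongrightarrow> (LINT s|?N. 0)"
    proof (rule integral_dominated_convergence[where w = "\<lambda>s. (norm (Z s))\<^sup>2"])
      show "integrable ?N (\<lambda>s. (norm (Z s))\<^sup>2)" by (rule L2_norm_integrable[OF Z_L2])
      show "AE s in ?N. (\<lambda>n. (norm ((1 - \<theta> n (snd s)) *\<^sub>R Z s))\<^sup>2) \<longlonglongrightarrow> 0"
      proof (rule AE_I2)
        fix s assume "s \<in> space ?N"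
        then have "0 < d (snd s)" by (intro d_pos) (auto simp: space_restrict_space Q_def)
        then have "filterlim (\<lambda>n. - 1 + d (snd s) * real n) at_top sequentially"
          by (intro filterlim_tendsto_add_at_top[OF tendsto_const]
              filterlim_tendsto_pos_mult_at_top[OF tendsto_const] filterlim_real_sequentially)
        then have "(\<lambda>n. C1_step (- 1 + d (snd s) * real n)) \<longlonglongrightarrow> 1"
          by (rule filterlim_compose[OF C1_step_tendsto])
        then have "(\<lambda>n. \<theta> n (snd s)) \<longlonglongrightarrow> 1" by (simp add: \<theta>_def mult.commute)
        then have "(\<lambda>n. (norm ((1 - \<theta> n (snd s)) *\<^sub>R Z s))\<^sup>2) \<longlonglongrightarrow> (norm ((1 - 1) *\<^sub>R Z s))\<^sup>2"
          by (intro tendsto_intros)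
        then show "(\<lambda>n. (norm ((1 - \<theta> n (snd s)) *\<^sub>R Z s))\<^sup>2) \<longlonglongrightarrow> 0" by simp
      qed
      show "AE s in ?N. norm ((norm ((1 - \<theta> n (snd s)) *\<^sub>R Z s))\<^sup>2) \<le> (norm (Z s))\<^sup>2" for n
      proof (rule AE_I2)
        fix s
        have "norm ((1 - \<theta> n (snd s)) *\<^sub>R Z s) \<le> 1 * norm (Z s)"
          unfolding norm_scaleR using th01[of n "snd s"] by (intro mult_right_mono) auto
        then show "norm ((norm ((1 - \<theta> n (snd s)) *\<^sub>R Z s))\<^sup>2) \<le> (norm (Z s))\<^sup>2"
          by (simp add: power_mono del: norm_scaleR)
      qed
    qed measurable
    \<comment> \<open>The error splits as \<open>\<theta> (P n - Z) - (1 - \<theta>) Z\<close> with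
      \<open>0 \<le> \<theta> \<le> 1\<close>: the approximation error is not enlarged by the
      cut-off, and the second part is handled by \<open>limZ\<close>.\<close>
    have le: "(LINT s|?N. (norm (X n s - Z s))\<^sup>2)
      \<le> 2 * (LINT s|?N. (norm (P n s - Z s))\<^sup>2) + 2 * (LINT s|?N. (norm ((1 - \<theta> n (snd s)) *\<^sub>R Z s))\<^sup>2)" for n
    proof -
      have i1: "integrable ?N (\<lambda>s. 2 * (norm (P n s - Z s))\<^sup>2)"
        by (intro integrable_mult_right L2_norm_integrable L2_minus P_L2 Z_L2)
      have i2: "integrable ?N (\<lambda>s. 2 * (norm ((1 - \<theta> n (snd s)) *\<^sub>R Z s))\<^sup>2)"
        using th01 by (intro integrable_mult_right L2_norm_integrable L2_bounded_scaleR[OF Z_L2, where B = 1])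
          (auto intro!: AE_I2)
      have "(LINT s|?N. (norm (X n s - Z s))\<^sup>2)
        \<le> (LINT s|?N. 2 * (norm (P n s - Z s))\<^sup>2 + 2 * (norm ((1 - \<theta> n (snd s)) *\<^sub>R Z s))\<^sup>2)"
      proof (rule integral_mono)
        show "integrable ?N (\<lambda>s. (norm (X n s - Z s))\<^sup>2)"
          by (intro L2_norm_integrable L2_minus X_L2 Z_L2)
        fix s
        let ?u = "\<theta> n (snd s) *\<^sub>R (P n s - Z s)" and ?v = "(1 - \<theta> n (snd s)) *\<^sub>R Z s"
        have eq: "X n s - Z s = ?u - ?v"
          by (simp add: X_def P_def Z_def cut(2) \<psi>_def algebra_simps)
        have "norm ?u \<le> 1 * norm (P n s - Z s)"
          unfolding norm_scaleR using th01[of n "snd s"] by (intro mult_right_mono) auto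
        then have "(norm ?u)\<^sup>2 \<le> (norm (P n s - Z s))\<^sup>2" by (intro power_mono) auto
        moreover have "(norm (?u - ?v))\<^sup>2 \<le> (norm ?u + norm ?v)\<^sup>2"
          by (intro power_mono norm_triangle_ineq4) auto
        moreover have "(norm ?u + norm ?v)\<^sup>2 \<le> 2 * (norm ?u)\<^sup>2 + 2 * (norm ?v)\<^sup>2"
          using sum_squares_bound[of "norm ?u" "norm ?v"] by (simp add: power2_sum)
        ultimately show "(norm (X n s - Z s))\<^sup>2 \<le> 2 * (norm (P n s - Z s))\<^sup>2 + 2 * (norm ?v)\<^sup>2"
          unfolding eq by linarith
      qed (intro Bochner_Integration.integrable_add i1 i2)
      also have "\<dots> = 2 * (LINT s|?N. (norm (P n s - Z s))\<^sup>2) + 2 * (LINT s|?N. (norm ((1 - \<theta> n (snd s)) *\<^sub>R Z s))\<^sup>2)"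
        by (subst Bochner_Integration.integral_add[OF i1 i2]) (simp only: integral_mult_right_zero)
      finally show ?thesis .
    qed
    have "(\<lambda>n. 2 * (LINT s|?N. (norm (P n s - Z s))\<^sup>2) + 2 * (LINT s|?N. (norm ((1 - \<theta> n (snd s)) *\<^sub>R Z s))\<^sup>2))
      \<longlonglongrightarrow> 2 * 0 + 2 * (LINT s|?N. 0)"
      by (intro tendsto_intros limP limZ)
    then have "(\<lambda>n. 2 * (LINT s|?N. (norm (P n s - Z s))\<^sup>2) + 2 * (LINT s|?N. (norm ((1 - \<theta> n (snd s)) *\<^sub>R Z s))\<^sup>2)) \<longlonglongrightarrow> 0"
      by simp
    then show ?thesis
      by (rule tendsto_sandwich[OF _ _ tendsto_const, rotated 2]) (use le in auto)
  qed
  define ZQ where "ZQ \<tau> s = indicator Q (s + \<tau> *\<^sub>R ?e) *\<^sub>R Z (s + \<tau> *\<^sub>R ?e)" for \<tau> s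
  have ZQ_L2: "ZQ \<tau> \<in> L2 Q" for \<tau>
    unfolding ZQ_def[abs_def] by (rule L2_translate(1)[OF Z_L2 Q(1) Q(1)])
  \<comment> \<open>A shift with \<open>\<tau> \<ge> 0\<close> can leave \<open>Q\<close> only
    through the time excluded from \<open>J\<close>, where \<open>\<psi> n\<close> and its gradient
    vanish. So \<open>X n\<close> needs no correction to match the zero extension used for
    \<open>Z\<close>.\<close>
  have XQ: "X n (s + \<tau> *\<^sub>R ?e) = indicator Q (s + \<tau> *\<^sub>R ?e) *\<^sub>R X n (s + \<tau> *\<^sub>R ?e)"
    if "s \<in> Q" "0 \<le> \<tau>" for n s \<tau>
  proof (cases "s + \<tau> *\<^sub>R ?e \<in> Q")
    case False
    then have "s + \<tau> *\<^sub>R ?e \<notin> \<Omega> \<times> J"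
      using that \<sigma> by (cases s) (auto simp: Q_def)
    then show ?thesis
      using C1c_outside[OF cut(1)] False by (simp add: X_def zero_prod_def)
  qed simp
  have Xtr_L2: "(\<lambda>s. X n (s + \<tau> *\<^sub>R ?e)) \<in> L2 Q" if "0 \<le> \<tau>" for n \<tau>
    using XQ[OF _ that, of _ n] by (intro L2_cong[OF L2_translate(1)[OF X_L2 Q(1) Q(1), of "\<tau> *\<^sub>R ?e" n]]) auto
  have unif: "(LINT s|?N. (norm (X n (s + \<tau> *\<^sub>R ?e) - ZQ \<tau> s))\<^sup>2) \<le> (LINT s|?N. (norm (X n s - Z s))\<^sup>2)"
    if "0 \<le> \<tau>" for n \<tau>
  proof -
    have "(LINT s|?N. (norm (X n (s + \<tau> *\<^sub>R ?e) - ZQ \<tau> s))\<^sup>2)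
      = (LINT s|?N. (norm (indicator Q (s + \<tau> *\<^sub>R ?e) *\<^sub>R (X n (s + \<tau> *\<^sub>R ?e) - Z (s + \<tau> *\<^sub>R ?e))))\<^sup>2)"
    proof (rule Bochner_Integration.integral_cong[OF refl])
      fix s assume "s \<in> space ?N"
      then have "s \<in> Q" by (auto simp: space_restrict_space)
      from XQ[OF this that] show "(norm (X n (s + \<tau> *\<^sub>R ?e) - ZQ \<tau> s))\<^sup>2
          = (norm (indicator Q (s + \<tau> *\<^sub>R ?e) *\<^sub>R (X n (s + \<tau> *\<^sub>R ?e) - Z (s + \<tau> *\<^sub>R ?e))))\<^sup>2"
        by (simp only: ZQ_def scaleR_diff_right)
    qed
    also have "\<dots> \<le> (LINT s|?N. (norm (X n s - Z s))\<^sup>2)"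
      by (rule L2_translate(2)[OF L2_minus[OF X_L2 Z_L2] Q(1) Q(1)])
    finally show ?thesis .
  qed
  define F where "F n \<tau> = (LINT s|?N. y s * \<psi> n (s + \<tau> *\<^sub>R ?e))" for n \<tau>
  define F' where "F' n \<tau> = (LINT s|?N. W s \<bullet> X n (s + \<tau> *\<^sub>R ?e))" for n \<tau>
  define D' where "D' \<tau> = (LINT s|?N. W s \<bullet> ZQ \<tau> s)" for \<tau>
  define D where "D \<tau> = (LINT s|?N. y s * snd (ZQ \<tau> s))" for \<tau>
  \<comment> \<open>The derivative along \<open>?e\<close> is \<open>\<sigma>\<close> times the time
    derivative of the shifted test function, which is still admissible for
    \<open>\<tau> \<ge> 0\<close>. The weak equation replaces it by an expression free of time
    derivatives, hence of the derivative of the cut-off.\<close>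
  have deriv: "(F n has_real_derivative F' n \<tau>) (at \<tau>)" if "0 \<le> \<tau>" for n \<tau>
  proof -
    have in_J: "z \<in> \<Omega> \<times> J" if "z + \<tau> *\<^sub>R ?e \<in> \<Omega> \<times> J" for z
      using that \<sigma> \<open>0 \<le> \<tau>\<close> by (cases z) auto
    have tr: "(\<lambda>z. \<psi> n (z + \<tau> *\<^sub>R ?e)) \<in> C1c (\<Omega> \<times> J)"
      "grad (\<lambda>z. \<psi> n (z + \<tau> *\<^sub>R ?e)) s = grad (\<psi> n) (s + \<tau> *\<^sub>R ?e)" for s
      by (rule C1c_translate[OF cut(1)], erule in_J)+
    have "(LINT s|?N. y s * (grad (\<psi> n) (s + \<tau> *\<^sub>R ?e) \<bullet> ?e)) = F' n \<tau>"
      using weak[OF tr(1)] unfolding tr(2)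
      by (simp add: inner_prod_def F'_def X_def mult.commute)
    with integral_translate_deriv[OF y cut(1) Q, of n ?e \<tau>]
    show ?thesis unfolding F_def by simp
  qed
  have conv: "(\<lambda>n. F n \<tau>) \<longlonglongrightarrow> D \<tau>" if "0 \<le> \<tau>" for \<tau>
  proof -
    have "(\<lambda>n. LINT s|?N. X n (s + \<tau> *\<^sub>R ?e) \<bullet> (0, y s)) \<longlonglongrightarrow> (LINT s|?N. ZQ \<tau> s \<bullet> (0, y s))"
    proof (rule L2_inner_tendsto)
      show "(\<lambda>n. LINT s|?N. (norm (X n (s + \<tau> *\<^sub>R ?e) - ZQ \<tau> s))\<^sup>2) \<longlonglongrightarrow> 0"
        by (rule tendsto_sandwich[OF _ always_eventually[OF allI[OF unif[OF that]]] tendsto_const lim]) simp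
      have "(\<lambda>s. 0::'a) \<in> L2 Q" by (rule L2_bounded[OF Q, where B = 0]) auto
      from L2_Pair[OF this y] show "(\<lambda>s. (0::'a, y s)) \<in> L2 Q" .
    qed (use Xtr_L2[OF that] ZQ_L2 in auto)
    then show ?thesis
      by (simp add: inner_prod_def F_def D_def X_def mult.commute)
  qed
  \<comment> \<open>The bound does not depend on \<open>\<tau>\<close>, so the derivatives converge
    uniformly on the half-line.\<close>
  have close: "(F' n \<tau> - D' \<tau>)\<^sup>2
      \<le> (LINT s|?N. (norm (W s))\<^sup>2) * (LINT s|?N. (norm (X n s - Z s))\<^sup>2)" if "0 \<le> \<tau>" for n \<tau>
  proof -
    have "F' n \<tau> - D' \<tau> = (LINT s|?N. W s \<bullet> (X n (s + \<tau> *\<^sub>R ?e) - ZQ \<tau> s))"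
      unfolding F'_def D'_def using L2_inner_integrable[OF W Xtr_L2[OF that]] L2_inner_integrable[OF W ZQ_L2]
      by (simp add: inner_diff_right)
    then have "(F' n \<tau> - D' \<tau>)\<^sup>2 \<le> (LINT s|?N. (norm (W s))\<^sup>2)
        * (LINT s|?N. (norm (X n (s + \<tau> *\<^sub>R ?e) - ZQ \<tau> s))\<^sup>2)"
      using L2_Cauchy_Schwarz[OF W L2_minus[OF Xtr_L2[OF that] ZQ_L2]] by simp
    also have "\<dots> \<le> (LINT s|?N. (norm (W s))\<^sup>2) * (LINT s|?N. (norm (X n s - Z s))\<^sup>2)"
      by (intro mult_left_mono unif[OF that]) simp
    finally show ?thesis .
  qed
  \<comment> \<open>Uniform convergence of the derivatives together with convergence at one point
    allows passing to the limit under the derivative. The convex set is the half-line, which is why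
    the result is one-sided.\<close>
  have "\<exists>g. \<forall>\<tau>\<in>{0..}. (\<lambda>n. F n \<tau>) \<longlonglongrightarrow> g \<tau> \<and> (g has_derivative (*) (D' \<tau>)) (at \<tau> within {0..})"
  proof (rule has_derivative_sequence[where ?x0.0 = 0])
    show "convex {0::real..}" by simp
    show "(F n has_derivative (*) (F' n \<tau>)) (at \<tau> within {0..})" if "\<tau> \<in> {0..}" for n \<tau>
      using deriv[of \<tau> n] that
      by (auto simp: has_field_derivative_def intro: has_derivative_at_withinI)
    show "\<forall>\<^sub>F n in sequentially. \<forall>\<tau>\<in>{0..}. \<forall>h. norm (F' n \<tau> * h - D' \<tau> * h) \<le> \<epsilon> * norm h"
      if "0 < \<epsilon>" for \<epsilon>
    proof -
      have "(\<lambda>n. (LINT s|?N. (norm (W s))\<^sup>2) * (LINT s|?N. (norm (X n s - Z s))\<^sup>2)) \<longlonglongrightarrow> 0"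
        by (rule tendsto_mult_right_zero[OF lim])
      then have "\<forall>\<^sub>F n in sequentially.
          (LINT s|?N. (norm (W s))\<^sup>2) * (LINT s|?N. (norm (X n s - Z s))\<^sup>2) < \<epsilon>\<^sup>2"
        using that by (intro order_tendstoD(2)) auto
      then show ?thesis
      proof eventually_elim
        case (elim n)
        show ?case
        proof (intro ballI allI)
          fix \<tau> h :: real assume "\<tau> \<in> {0..}"
          with close[of \<tau> n] elim have "(F' n \<tau> - D' \<tau>)\<^sup>2 \<le> \<epsilon>\<^sup>2" by simp
          with that have "\<bar>F' n \<tau> - D' \<tau>\<bar> \<le> \<epsilon>" by (simp add: abs_le_square_iff[symmetric])
          then have "\<bar>F' n \<tau> - D' \<tau>\<bar> * \<bar>h\<bar> \<le> \<epsilon> * \<bar>h\<bar>" by (intro mult_right_mono) auto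
          then show "norm (F' n \<tau> * h - D' \<tau> * h) \<le> \<epsilon> * norm h"
            by (simp add: abs_mult[symmetric] left_diff_distrib)
        qed
      qed
    qed
    show "0 \<in> {0::real..}" by simp
    show "(\<lambda>n. F n 0) \<longlonglongrightarrow> D 0" by (rule conv) simp
  qed
  then obtain g where g: "\<And>\<tau>. 0 \<le> \<tau> \<Longrightarrow> (\<lambda>n. F n \<tau>) \<longlonglongrightarrow> g \<tau>"
      "(g has_derivative (*) (D' 0)) (at 0 within {0..})"
    by auto
  have "g \<tau> = D \<tau>" if "\<tau> \<in> {0..}" for \<tau>
    using LIMSEQ_unique[OF g(1) conv] that by simp
  then have "(D has_derivative (*) (D' 0)) (at 0 within {0..})"
    by (intro has_derivative_transform[OF _ _ g(2)]) auto
  moreover have "D' 0 = (LINT s|?N. W s \<bullet> (p s, z s))"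
    unfolding D'_def
    by (rule Bochner_Integration.integral_cong) (auto simp: ZQ_def Z_def space_restrict_space)
  ultimately show ?thesis
    by (simp add: has_field_derivative_def D_def[abs_def] ZQ_def Z_def)
qed

lemma Linf_scaleR_L2:
  assumes "c \<in> Linf S" "f \<in> L2 S"
  shows "(\<lambda>s. (c s :: real) *\<^sub>R f s) \<in> L2 S"
  using assms(1) L2_bounded_scaleR[OF assms(2)] by (auto simp: Linf_def)

lemma Linf_mult_L2:
  fixes f :: "'b::euclidean_space \<Rightarrow> real"
  assumes "c \<in> Linf S" "f \<in> L2 S"
  shows "(\<lambda>s. c s * f s) \<in> L2 S"
  using Linf_scaleR_L2[OF assms] by simp

text \<open>\<open>W\<close> and \<open>V\<close> collect everything but the time derivative in the
  two equations. Equating the two right derivatives at 0, the diffusion terms and the terms with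
  \<open>b\<close> cancel by symmetry, and what remains is \<open>y q - f z\<close>.\<close>

lemma weak_duality:
  fixes \<Omega> :: "'a::euclidean_space set"
  assumes \<Omega>: "open \<Omega>" "bounded \<Omega>" and Q_def: "Q = \<Omega> \<times> {0<..<T}"
    and a: "a \<in> Linf Q" and b: "b \<in> Linf Q" and f: "f \<in> L2 Q" and q: "q \<in> L2 Q"
    and y: "weak_sol \<Omega> T a b f (\<lambda>_. 0) y" and z: "adjoint_weak_sol \<Omega> T a b q z"
  shows "(LINT s|lborel_on Q. y s * q s) = (LINT s|lborel_on Q. f s * z s)"
proof -
  let ?N = "lborel_on Q"
  have Q: "Q \<in> sets lborel" "bounded Q"
    using \<Omega> by (auto simp: Q_def open_Times bounded_Times)
  obtain p where p: "energy_space \<Omega> T y p"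
    and y_eq: "\<And>\<phi>. \<phi> \<in> C1c (\<Omega> \<times> {..<T}) \<Longrightarrow>
      (LINT s|?N. - y s * snd (grad \<phi> s) + a s * (p s \<bullet> fst (grad \<phi> s)) + b s * y s * \<phi> s)
      = (LINT s|?N. f s * \<phi> s)"
    using y by (auto simp: weak_sol_def Let_def Q_def)
  obtain r where r: "energy_space \<Omega> T z r"
    and z_eq: "\<And>\<phi>. \<phi> \<in> C1c (\<Omega> \<times> {0<..}) \<Longrightarrow>
      (LINT s|?N. z s * snd (grad \<phi> s) + a s * (r s \<bullet> fst (grad \<phi> s)) + b s * z s * \<phi> s)
      = (LINT s|?N. q s * \<phi> s)"
    using z by (auto simp: adjoint_weak_sol_def Let_def Q_def)
  have L2: "y \<in> L2 Q" "p \<in> L2 Q" "z \<in> L2 Q" "r \<in> L2 Q"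
    using p r by (auto simp: energy_space_def Let_def Q_def)
  define W where "W s = (a s *\<^sub>R p s, b s * y s - f s)" for s
  define V where "V s = (a s *\<^sub>R r s, b s * z s - q s)" for s
  have W: "W \<in> L2 Q" and V: "V \<in> L2 Q"
    unfolding W_def[abs_def] V_def[abs_def]
    by (intro L2_Pair L2_minus Linf_scaleR_L2 Linf_mult_L2 a b f q L2)+
  have W_eq: "(LINT s|?N. y s * (1 * snd (grad \<phi> s))) = (LINT s|?N. W s \<bullet> (fst (grad \<phi> s), \<phi> s))"
    if "\<phi> \<in> C1c (\<Omega> \<times> {..<T})" for \<phi>
  proof -
    note \<phi> = C1c_L2[OF that Q]
    have i: "integrable ?N (\<lambda>s. y s * snd (grad \<phi> s))" "integrable ?N (\<lambda>s. f s * \<phi> s)"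
      "integrable ?N (\<lambda>s. W s \<bullet> (fst (grad \<phi> s), \<phi> s))"
      by (intro L2_mult_integrable L2_snd L2_inner_integrable W L2_Pair L2_fst L2 f \<phi>)+
    have "(LINT s|?N. f s * \<phi> s)
      = (LINT s|?N. W s \<bullet> (fst (grad \<phi> s), \<phi> s) - y s * snd (grad \<phi> s) + f s * \<phi> s)"
      unfolding y_eq[OF that, symmetric]
      by (rule Bochner_Integration.integral_cong) (auto simp: W_def inner_prod_def algebra_simps)
    then show ?thesis using i by simp
  qed
  have V_eq: "(LINT s|?N. z s * (- 1 * snd (grad \<phi> s))) = (LINT s|?N. V s \<bullet> (fst (grad \<phi> s), \<phi> s))"
    if "\<phi> \<in> C1c (\<Omega> \<times> {0<..})" for \<phi>
  proof -
    note \<phi> = C1c_L2[OF that Q]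
    have i: "integrable ?N (\<lambda>s. z s * snd (grad \<phi> s))" "integrable ?N (\<lambda>s. q s * \<phi> s)"
      "integrable ?N (\<lambda>s. V s \<bullet> (fst (grad \<phi> s), \<phi> s))"
      by (intro L2_mult_integrable L2_snd L2_inner_integrable V L2_Pair L2_fst L2 q \<phi>)+
    have "(LINT s|?N. q s * \<phi> s)
      = (LINT s|?N. V s \<bullet> (fst (grad \<phi> s), \<phi> s) + z s * snd (grad \<phi> s) + q s * \<phi> s)"
      unfolding z_eq[OF that, symmetric]
      by (rule Bochner_Integration.integral_cong) (auto simp: V_def inner_prod_def algebra_simps)
    then show ?thesis using i by simp
  qed
  let ?D = "\<lambda>\<tau>. LINT s|?N. y s * (indicator Q (s + (0, \<tau>)) * z (s + (0, \<tau>)))"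
  have "(?D has_real_derivative (LINT s|?N. W s \<bullet> (r s, z s))) (at 0 within {0..})"
    using weak_translate_deriv[OF \<Omega> Q_def _ L2(1) W r W_eq] by simp
  moreover have "(?D has_real_derivative (LINT s|?N. V s \<bullet> (p s, y s))) (at 0 within {0..})"
  proof -
    \<comment> \<open>Seen from \<open>z\<close>, the same function shifts \<open>y\<close>
      backwards in time: this is the case \<open>\<sigma> = - 1\<close>.\<close>
    have "?D \<tau> = (LINT s|?N. z s * (indicator Q (s + (0, \<tau> * - 1)) * y (s + (0, \<tau> * - 1))))" for \<tau>
      using integral_mult_translate_commute[OF L2(1,3) Q(1), of "(0, \<tau>)"] by simp
    then show ?thesis
      using weak_translate_deriv[OF \<Omega> Q_def _ L2(3) V p V_eq] by simp
  qed
  \<comment> \<open>Difference quotients taken from the right alone determine the derivative,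
    because the right-sided filter at 0 is nontrivial.\<close>
  ultimately have "(LINT s|?N. W s \<bullet> (r s, z s)) = (LINT s|?N. V s \<bullet> (p s, y s))"
    unfolding has_field_derivative_iff by (rule tendsto_unique[rotated]) (simp add: at_within_Ici_at_right)
  moreover have "(LINT s|?N. W s \<bullet> (r s, z s)) - (LINT s|?N. V s \<bullet> (p s, y s))
      = (LINT s|?N. W s \<bullet> (r s, z s) - V s \<bullet> (p s, y s))"
    by (intro Bochner_Integration.integral_diff[symmetric] L2_inner_integrable W V L2_Pair L2)
  moreover have "\<dots> = (LINT s|?N. y s * q s - f s * z s)"
    by (rule Bochner_Integration.integral_cong)
      (auto simp: W_def V_def inner_prod_def inner_commute algebra_simps)
  moreover have "\<dots> = (LINT s|?N. y s * q s) - (LINT s|?N. f s * z s)"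
    by (intro Bochner_Integration.integral_diff L2_mult_integrable L2 f q)
  ultimately show ?thesis by simp
qed

section \<open>Duality of the weighted quadratic problems\<close>

lemma L2_zero_AE:
  fixes f :: "'b::euclidean_space \<Rightarrow> real"
  assumes "f \<in> L2 S" "(LINT x|lborel_on S. (f x)\<^sup>2) = 0"
  shows "AE x in lborel_on S. f x = 0"
  using L2_norm_zero_AE[OF assms(1)] assms(2) by simp

text \<open>The midpoint is an independent function \<open>h\<close>, equal to the average almost
  everywhere only, because \<open>M\<close> respects averages only up to null sets.\<close>

lemma L2_parallelogram:
  fixes f g h :: "'b::euclidean_space \<Rightarrow> real"
  assumes f: "f \<in> L2 S" and g: "g \<in> L2 S" and h: "h \<in> L2 S"
    and eq: "AE x in lborel_on S. h x = (f x + g x) / 2"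
  shows "(LINT x|lborel_on S. (f x)\<^sup>2) + (LINT x|lborel_on S. (g x)\<^sup>2)
    = 2 * (LINT x|lborel_on S. (h x)\<^sup>2) + 1/2 * (LINT x|lborel_on S. (f x - g x)\<^sup>2)"
proof -
  have d: "(\<lambda>x. f x - g x) \<in> L2 S" by (rule L2_minus[OF f g])
  note i = L2_sq_integrable[OF f] L2_sq_integrable[OF g] L2_sq_integrable[OF h] L2_sq_integrable[OF d]
  have "(LINT x|lborel_on S. (f x)\<^sup>2 + (g x)\<^sup>2) = (LINT x|lborel_on S. 2 * (h x)\<^sup>2 + 1/2 * (f x - g x)\<^sup>2)"
  proof (rule integral_cong_AE)
    show "AE x in lborel_on S. (f x)\<^sup>2 + (g x)\<^sup>2 = 2 * (h x)\<^sup>2 + 1/2 * (f x - g x)\<^sup>2"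
      using eq by eventually_elim (simp add: power2_eq_square field_simps)
  qed (use f g h in \<open>auto simp: L2_def\<close>)
  with i show ?thesis by simp
qed

lemma linear_part_zero:
  fixes l c :: real
  assumes nonneg: "\<And>t. 0 \<le> t * l + t\<^sup>2 * c" and c: "0 \<le> c"
  shows "l = 0"
proof (rule ccontr)
  assume l: "l \<noteq> 0"
  \<comment> \<open>Dividing by \<open>c + 1\<close> instead of \<open>c\<close> covers
    \<open>c = 0\<close> and makes the value at \<open>- l / k\<close> exactly
    \<open>- l^2 / k^2\<close>.\<close>
  define k where "k = c + 1"
  have k: "c = k - 1" "0 < k" using c by (auto simp: k_def)
  let ?t = "- l / k"
  have "?t * l + ?t\<^sup>2 * c = - (l\<^sup>2 / k\<^sup>2)"
    using k(2) unfolding k(1) by (simp add: power2_eq_square field_simps)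
  moreover have "0 < l\<^sup>2 / k\<^sup>2" using l k(2) by (intro divide_pos_pos) auto
  ultimately show False using nonneg[of ?t] by linarith
qed

text \<open>The two weights enter asymmetrically. \<open>r\<close> lies between \<open>m\<close> and
  \<open>B\<close>, so multiplication and division by it preserve \<open>L2 Q\<close>;
  \<open>r0\<close> is only bounded below, so division by it is harmless while multiplication
  requires membership in \<open>ctrl_space\<close>.\<close>

locale weighted_duality =
  fixes Q Qw :: "'b::euclidean_space set" and r r0 ybar :: "'b \<Rightarrow> real"
    and M Ms :: "('b \<Rightarrow> real) \<Rightarrow> 'b \<Rightarrow> real" and m B :: real
  assumes r: "r \<in> borel_measurable (lborel_on Q)" "0 < m" "\<And>s. s \<in> Q \<Longrightarrow> m \<le> r s \<and> r s \<le> B"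
    and r0: "r0 \<in> borel_measurable (lborel_on Qw)" "\<And>s. s \<in> Qw \<Longrightarrow> m \<le> r0 s"
    and ybar: "ybar \<in> L2 Q"
    and M: "\<And>v. v \<in> L2 Qw \<Longrightarrow> M v \<in> L2 Q"
    and Ms: "\<And>q. q \<in> L2 Q \<Longrightarrow> Ms q \<in> L2 Qw"
    and adjoint: "\<And>v q. v \<in> L2 Qw \<Longrightarrow> q \<in> L2 Q \<Longrightarrow>
      (LINT s|lborel_on Q. M v s * q s) = (LINT s|lborel_on Qw. v s * Ms q s)"
begin

abbreviation "U \<equiv> ctrl_space Qw r0"
abbreviation "I \<equiv> primal_fun Q Qw r r0 ybar M"
abbreviation "\<Phi> \<equiv> dual_fun Q Qw r r0 ybar Ms"
abbreviation "L \<equiv> Lagrangian Q Qw r r0 ybar M"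

text \<open>Weighted state, affine in the control; \<open>Y\<close> is the weighted control. In
  these variables \<open>primal_fun\<close> is half the sum of two unweighted squared norms, so
  plain \<open>L2\<close> completeness applies.\<close>

definition X :: "('b \<Rightarrow> real) \<Rightarrow> 'b \<Rightarrow> real" where
  "X v s = r s * (M v s + ybar s)"

definition Y :: "('b \<Rightarrow> real) \<Rightarrow> 'b \<Rightarrow> real" where
  "Y v s = r0 s * v s"

text \<open>Twice the defect in the Fenchel-Young inequality for \<open>F_fun\<close> at the state
  \<open>M v\<close> and the dual variable \<open>- q\<close>. Likewise \<open>control_gap\<close>
  is twice the defect for \<open>G_fun\<close> at \<open>v\<close> and \<open>Ms q\<close>. Hence
  vanishing gaps are the extremality relations.\<close>

definition state_gap :: "('b \<Rightarrow> real) \<Rightarrow> ('b \<Rightarrow> real) \<Rightarrow> real" where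
  "state_gap v q = (LINT s|lborel_on Q. (q s / r s + X v s)\<^sup>2)"

definition control_gap :: "('b \<Rightarrow> real) \<Rightarrow> ('b \<Rightarrow> real) \<Rightarrow> real" where
  "control_gap v q = (LINT s|lborel_on Qw. (Y v s - Ms q s / r0 s)\<^sup>2)"

lemma r_pos: "s \<in> Q \<Longrightarrow> 0 < r s"
  using r(2) r(3)[of s] by linarith

lemma r0_pos: "s \<in> Qw \<Longrightarrow> 0 < r0 s"
  using r(2) r0(2)[of s] by linarith

lemma AE_Q: "(\<And>s. s \<in> Q \<Longrightarrow> P s) \<Longrightarrow> AE s in lborel_on Q. P s"
  and AE_Qw: "(\<And>s. s \<in> Qw \<Longrightarrow> P s) \<Longrightarrow> AE s in lborel_on Qw. P s"
  by (auto intro!: AE_I2 simp: space_restrict_space)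

lemma integral_cong_Q:
  fixes f g :: "'b \<Rightarrow> real"
  assumes "\<And>s. s \<in> Q \<Longrightarrow> f s = g s"
  shows "(LINT s|lborel_on Q. f s) = (LINT s|lborel_on Q. g s)"
  using assms by (intro Bochner_Integration.integral_cong) (auto simp: space_restrict_space)

lemma integral_cong_Qw:
  fixes f g :: "'b \<Rightarrow> real"
  assumes "\<And>s. s \<in> Qw \<Longrightarrow> f s = g s"
  shows "(LINT s|lborel_on Qw. f s) = (LINT s|lborel_on Qw. g s)"
  using assms by (intro Bochner_Integration.integral_cong) (auto simp: space_restrict_space)

lemma r_mult_L2: "f \<in> L2 Q \<Longrightarrow> (\<lambda>s. r s * f s) \<in> L2 Q"
  using L2_bounded_mult[OF _ r(1), of f B] r_pos r(3) by (simp add: abs_of_pos)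

lemma r_divide_L2:
  assumes "f \<in> L2 Q"
  shows "(\<lambda>s. f s / r s) \<in> L2 Q"
proof -
  have "\<bar>inverse (r s)\<bar> \<le> inverse m" if "s \<in> Q" for s
    using r_pos[OF that] r(2) r(3)[OF that] by (simp add: le_imp_inverse_le del: abs_inverse)
  from L2_bounded_mult[OF assms _ this] r(1) show ?thesis
    by (simp add: divide_inverse mult.commute)
qed

lemma r0_divide_L2:
  assumes "f \<in> L2 Qw"
  shows "(\<lambda>s. f s / r0 s) \<in> L2 Qw"
proof -
  have "\<bar>inverse (r0 s)\<bar> \<le> inverse m" if "s \<in> Qw" for s
    using r0_pos[OF that] r(2) r0(2)[OF that] by (simp add: le_imp_inverse_le del: abs_inverse)
  from L2_bounded_mult[OF assms _ this] r0(1) show ?thesis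
    by (simp add: divide_inverse mult.commute)
qed

lemma U_L2: "v \<in> U \<Longrightarrow> v \<in> L2 Qw"
  by (simp add: ctrl_space_def)

text \<open>Shows that \<open>Y\<close> maps \<open>U\<close> onto \<open>L2 Qw\<close> up to values
  off \<open>Qw\<close>: the quotient is a preimage of \<open>f\<close>. Limits and test directions
  are built in \<open>L2 Qw\<close> and pulled back this way.\<close>

lemma r0_divide_U:
  assumes "f \<in> L2 Qw"
  shows "(\<lambda>s. f s / r0 s) \<in> U"
proof -
  have "(\<lambda>s. r0 s * (f s / r0 s)) \<in> L2 Qw"
    by (rule L2_cong[OF assms]) (auto dest: r0_pos)
  then show ?thesis
    unfolding ctrl_space_def using r0_divide_L2[OF assms] by blast
qed

lemma X_L2: "v \<in> L2 Qw \<Longrightarrow> X v \<in> L2 Q"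
  unfolding X_def[abs_def] by (intro r_mult_L2 L2_add M ybar)

lemma Y_L2: "v \<in> U \<Longrightarrow> Y v \<in> L2 Qw"
  by (simp add: ctrl_space_def Y_def[abs_def])

lemma I_eq: "I v = 1/2 * (LINT s|lborel_on Q. (X v s)\<^sup>2) + 1/2 * (LINT s|lborel_on Qw. (Y v s)\<^sup>2)"
  by (simp add: primal_fun_def F_fun_def G_fun_def X_def Y_def power_mult_distrib)

lemma I_nonneg: "0 \<le> I v"
  unfolding I_eq by simp

lemma gap_nonneg: "0 \<le> state_gap v q" "0 \<le> control_gap v q"
  by (simp_all add: state_gap_def control_gap_def)

section \<open>Completed squares and the duality gap\<close>

lemma Lagrangian_primal:
  assumes v: "v \<in> U" and q: "q \<in> L2 Q"
  shows "L v q = I v - 1/2 * state_gap v q"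
proof -
  note i = L2_sq_integrable[OF r_divide_L2[OF q]] L2_sq_integrable[OF X_L2[OF U_L2[OF v]]]
    L2_mult_integrable[OF q L2_add[OF M[OF U_L2[OF v]] ybar]]
  have "state_gap v q = (LINT s|lborel_on Q. (q s / r s)\<^sup>2 + (X v s)\<^sup>2 + 2 * (q s * (M v s + ybar s)))"
    unfolding state_gap_def
    by (rule integral_cong_Q) (auto simp: power2_sum X_def dest: r_pos)
  also have "\<dots> = (LINT s|lborel_on Q. (q s / r s)\<^sup>2) + (LINT s|lborel_on Q. (X v s)\<^sup>2)
      + 2 * (LINT s|lborel_on Q. q s * (M v s + ybar s))"
    using i by simp
  finally show ?thesis
    by (simp add: Lagrangian_def I_eq Y_def power_mult_distrib power_divide field_simps)
qed

lemma Lagrangian_dual: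
  assumes v: "v \<in> U" and q: "q \<in> L2 Q"
  shows "L v q = - \<Phi> q + 1/2 * control_gap v q"
proof -
  note i = L2_sq_integrable[OF r0_divide_L2[OF Ms[OF q]]] L2_sq_integrable[OF Y_L2[OF v]]
    L2_mult_integrable[OF U_L2[OF v] Ms[OF q]]
  have "control_gap v q = (LINT s|lborel_on Qw. (Y v s)\<^sup>2 + (Ms q s / r0 s)\<^sup>2 - 2 * (v s * Ms q s))"
    unfolding control_gap_def
    by (rule integral_cong_Qw) (auto simp: power2_diff Y_def dest: r0_pos)
  also have "\<dots> = (LINT s|lborel_on Qw. (Y v s)\<^sup>2) + (LINT s|lborel_on Qw. (Ms q s / r0 s)\<^sup>2)
      - 2 * (LINT s|lborel_on Q. M v s * q s)"
    using i adjoint[OF U_L2[OF v] q] by simp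
  finally have gap: "control_gap v q = (LINT s|lborel_on Qw. (Y v s)\<^sup>2)
      + (LINT s|lborel_on Qw. (Ms q s / r0 s)\<^sup>2) - 2 * (LINT s|lborel_on Q. M v s * q s)" .
  have "(LINT s|lborel_on Q. q s * (M v s + ybar s))
      = (LINT s|lborel_on Q. M v s * q s) + (LINT s|lborel_on Q. q s * ybar s)"
    using L2_mult_integrable[OF M[OF U_L2[OF v]] q] L2_mult_integrable[OF q ybar]
    by (simp add: distrib_left mult.commute)
  with gap show ?thesis
    by (simp add: Lagrangian_def dual_fun_def Y_def power_mult_distrib power_divide field_simps)
qed

lemma duality_gap:
  assumes "v \<in> U" "q \<in> L2 Q"
  shows "I v + \<Phi> q = 1/2 * (state_gap v q + control_gap v q)"
  using Lagrangian_primal[OF assms] Lagrangian_dual[OF assms] by simp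

text \<open>This is \<open>- r^2 (M v + ybar)\<close>, the \<open>q\<close> that annihilates
  \<open>state_gap v q\<close> and so maximizes the Lagrangian for fixed \<open>v\<close>.\<close>

definition dual_of :: "('b \<Rightarrow> real) \<Rightarrow> 'b \<Rightarrow> real" where
  "dual_of v s = - r s * X v s"

text \<open>The \<open>v\<close> that annihilates \<open>control_gap v q\<close>. The two divisions
  are kept separate: the first stays in \<open>L2 Qw\<close>, the second leads into
  \<open>U\<close>.\<close>

definition control_of :: "('b \<Rightarrow> real) \<Rightarrow> 'b \<Rightarrow> real" where
  "control_of q s = Ms q s / r0 s / r0 s"

lemma dual_of: "v \<in> U \<Longrightarrow> dual_of v \<in> L2 Q" "state_gap v (dual_of v) = 0"
proof -
  assume "v \<in> U"
  from L2_mult[OF r_mult_L2[OF X_L2[OF U_L2[OF this]]], of "-1"] show "dual_of v \<in> L2 Q"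
    by (simp add: dual_of_def[abs_def])
next
  have "state_gap v (dual_of v) = (LINT s|lborel_on Q. 0)"
    unfolding state_gap_def dual_of_def by (rule integral_cong_Q) (auto dest: r_pos)
  then show "state_gap v (dual_of v) = 0" by simp
qed

lemma control_of: "q \<in> L2 Q \<Longrightarrow> control_of q \<in> U" "control_gap (control_of q) q = 0"
proof -
  assume "q \<in> L2 Q"
  then show "control_of q \<in> U"
    unfolding control_of_def[abs_def] by (intro r0_divide_U r0_divide_L2 Ms)
next
  have "control_gap (control_of q) q = (LINT s|lborel_on Qw. 0)"
    unfolding control_gap_def control_of_def Y_def by (rule integral_cong_Qw) (auto dest: r0_pos)
  then show "control_gap (control_of q) q = 0" by simp
qed

lemma state_gap_zero:
  assumes "v \<in> U" "q \<in> L2 Q" "state_gap v q = 0"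
  shows "AE s in lborel_on Q. q s = dual_of v s"
proof -
  have "AE s in lborel_on Q. q s / r s + X v s = 0"
    using assms by (intro L2_zero_AE L2_add r_divide_L2 X_L2 U_L2) (auto simp: state_gap_def)
  moreover have "AE s in lborel_on Q. 0 < r s" by (rule AE_Q) (rule r_pos)
  ultimately show ?thesis
    by eventually_elim (simp add: dual_of_def field_simps)
qed

lemma control_gap_zero:
  assumes "v \<in> U" "q \<in> L2 Q" "control_gap v q = 0"
  shows "AE s in lborel_on Qw. v s = control_of q s"
proof -
  have "AE s in lborel_on Qw. Y v s - Ms q s / r0 s = 0"
    using assms by (intro L2_zero_AE L2_minus r0_divide_L2 Y_L2 Ms) (auto simp: control_gap_def)
  moreover have "AE s in lborel_on Qw. 0 < r0 s" by (rule AE_Qw) (rule r0_pos)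
  ultimately show ?thesis
    by eventually_elim (simp add: control_of_def Y_def field_simps)
qed

section \<open>Existence of a minimizer and its first variation\<close>

lemma M_linear:
  assumes u: "u \<in> L2 Qw" and v: "v \<in> L2 Qw"
  shows "AE s in lborel_on Q. M (\<lambda>s. c * u s + d * v s) s = c * M u s + d * M v s"
proof (rule L2_orthogonal_AE)
  have uv: "(\<lambda>s. c * u s + d * v s) \<in> L2 Qw" by (intro L2_add L2_mult u v)
  show "M (\<lambda>s. c * u s + d * v s) \<in> L2 Q" by (rule M[OF uv])
  show "(\<lambda>s. c * M u s + d * M v s) \<in> L2 Q" by (intro L2_add L2_mult M u v)
  fix q :: "'b \<Rightarrow> real" assume q: "q \<in> L2 Q"
  \<comment> \<open>The right-hand side of the adjoint relation is visibly linear in the control,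
    although nothing of the kind is known of \<open>M\<close> beforehand.\<close>
  have "(LINT s|lborel_on Q. M (\<lambda>s. c * u s + d * v s) s * q s)
      = (LINT s|lborel_on Qw. c * (u s * Ms q s) + d * (v s * Ms q s))"
    unfolding adjoint[OF uv q] by (simp add: algebra_simps)
  also have "\<dots> = c * (LINT s|lborel_on Q. M u s * q s) + d * (LINT s|lborel_on Q. M v s * q s)"
    using L2_mult_integrable[OF u Ms[OF q]] L2_mult_integrable[OF v Ms[OF q]]
    by (simp add: adjoint u v q)
  also have "\<dots> = (LINT s|lborel_on Q. c * (M u s * q s) + d * (M v s * q s))"
    using L2_mult_integrable[OF M[OF u] q] L2_mult_integrable[OF M[OF v] q] by simp
  finally show "(LINT s|lborel_on Q. M (\<lambda>s. c * u s + d * v s) s \<bullet> q s)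
      = (LINT s|lborel_on Q. (c * M u s + d * M v s) \<bullet> q s)"
    by (simp add: algebra_simps)
qed

lemma U_combine:
  assumes "u \<in> U" "v \<in> U"
  shows "(\<lambda>s. c * u s + d * v s) \<in> U"
proof -
  have "(\<lambda>s. c * u s + d * v s) \<in> L2 Qw" by (intro L2_add L2_mult U_L2 assms)
  moreover have "(\<lambda>s. c * Y u s + d * Y v s) \<in> L2 Qw" by (intro L2_add L2_mult Y_L2 assms)
  ultimately show ?thesis by (simp add: ctrl_space_def Y_def algebra_simps)
qed

lemma I_parallelogram:
  assumes u: "u \<in> U" and v: "v \<in> U"
  shows "I u + I v = 2 * I (\<lambda>s. 1/2 * u s + 1/2 * v s)
    + 1/4 * (LINT s|lborel_on Q. (X u s - X v s)\<^sup>2) + 1/4 * (LINT s|lborel_on Qw. (Y u s - Y v s)\<^sup>2)"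
proof -
  let ?w = "\<lambda>s. 1/2 * u s + 1/2 * v s"
  have w: "?w \<in> U" by (rule U_combine[OF u v])
  \<comment> \<open>\<open>X\<close> is affine, not linear; the coefficients add up to 1, so the
    contribution of \<open>ybar\<close> is reproduced by the average.\<close>
  have "AE s in lborel_on Q. X ?w s = (X u s + X v s) / 2"
    using M_linear[OF U_L2[OF u] U_L2[OF v], of "1/2" "1/2"]
    by eventually_elim (simp add: X_def field_simps)
  note X_eq = L2_parallelogram[OF X_L2[OF U_L2[OF u]] X_L2[OF U_L2[OF v]] X_L2[OF U_L2[OF w]] this]
  have "AE s in lborel_on Qw. Y ?w s = (Y u s + Y v s) / 2"
    by (rule AE_Qw) (simp add: Y_def field_simps)
  note Y_eq = L2_parallelogram[OF Y_L2[OF u] Y_L2[OF v] Y_L2[OF w] this]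
  show ?thesis unfolding I_eq using X_eq Y_eq by (simp add: field_simps)
qed

text \<open>The limit of \<open>M v\<^sub>n\<close> is identified through the adjoint, i.e. the graph of \<open>M\<close> is closed.\<close>

lemma minimizer_exists: "\<exists>v. is_minimizer U I v"
proof -
  let ?d = "Inf (I ` U)"
  have ne: "I ` U \<noteq> {}"
  proof -
    have "(\<lambda>s. 0 :: real) \<in> U" by (simp add: ctrl_space_def L2_def)
    then show ?thesis by blast
  qed
  have bdd: "bdd_below (I ` U)" by (rule bdd_belowI2[OF I_nonneg])
  have d_le: "?d \<le> I v" if "v \<in> U" for v using bdd that by (intro cInf_lower) auto
  have "\<exists>v\<in>U. I v < ?d + 1 / real (Suc n)" for n
    using cInf_less_iff[OF ne bdd, of "?d + 1 / real (Suc n)"] by auto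
  then obtain v where v: "\<And>n. v n \<in> U" and vd: "\<And>n. I (v n) < ?d + 1 / real (Suc n)" by metis
  note vL2 = U_L2[OF v]
  \<comment> \<open>The midpoint is again in \<open>U\<close> and costs at least \<open>?d\<close>,
    so a quarter of the left-hand side is at most the total excess of the two values over
    \<open>?d\<close>.\<close>
  have diff: "(LINT s|lborel_on Q. (X (v i) s - X (v j) s)\<^sup>2) + (LINT s|lborel_on Qw. (Y (v i) s - Y (v j) s)\<^sup>2)
      < 4 / real (Suc i) + 4 / real (Suc j)" for i j
    using I_parallelogram[OF v[of i] v[of j]] vd[of i] vd[of j]
      d_le[OF U_combine[OF v[of i] v[of j], of "1/2" "1/2"]] by simp
  have small: "\<exists>N. \<forall>i\<ge>N. \<forall>j\<ge>N. 4 / real (Suc i) + 4 / real (Suc j) < e" if "0 < e" for e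
  proof -
    have "0 < e / 8" using that by simp
    then obtain N where N: "1 / real (Suc N) < e / 8" by (rule nat_approx_posE)
    have "4 / real (Suc i) < e / 2" if "i \<ge> N" for i
    proof -
      have "1 / real (Suc i) \<le> 1 / real (Suc N)" using that by (simp add: frac_le)
      with N show ?thesis by simp
    qed
    then have "4 / real (Suc i) + 4 / real (Suc j) < e / 2 + e / 2" if "i \<ge> N" "j \<ge> N" for i j
      using that by (intro add_strict_mono) auto
    then show ?thesis by (intro exI[of _ N]) auto
  qed
  have "\<forall>e>0. \<exists>N. \<forall>i\<ge>N. \<forall>j\<ge>N. (LINT s|lborel_on Q. (X (v i) s - X (v j) s)\<^sup>2) < e"
  proof (intro allI impI)
    fix e :: real assume e: "0 < e"
    obtain N where "\<forall>i\<ge>N. \<forall>j\<ge>N. 4 / real (Suc i) + 4 / real (Suc j) < e" using small[OF e] by blast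
    moreover have "(LINT s|lborel_on Q. (X (v i) s - X (v j) s)\<^sup>2) < 4 / real (Suc i) + 4 / real (Suc j)" for i j
    proof -
      have "0 \<le> (LINT s|lborel_on Qw. (Y (v i) s - Y (v j) s)\<^sup>2)" by simp
      with diff[of i j] show ?thesis by linarith
    qed
    ultimately show "\<exists>N. \<forall>i\<ge>N. \<forall>j\<ge>N. (LINT s|lborel_on Q. (X (v i) s - X (v j) s)\<^sup>2) < e" by (meson less_trans)
  qed
  from L2_complete[OF X_L2[OF vL2] this] obtain x where x: "x \<in> L2 Q"
    and x_lim: "(\<lambda>n. LINT s|lborel_on Q. (X (v n) s - x s)\<^sup>2) \<longlonglongrightarrow> 0" by blast
  have "\<forall>e>0. \<exists>N. \<forall>i\<ge>N. \<forall>j\<ge>N. (LINT s|lborel_on Qw. (Y (v i) s - Y (v j) s)\<^sup>2) < e"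
  proof (intro allI impI)
    fix e :: real assume e: "0 < e"
    obtain N where "\<forall>i\<ge>N. \<forall>j\<ge>N. 4 / real (Suc i) + 4 / real (Suc j) < e" using small[OF e] by blast
    moreover have "(LINT s|lborel_on Qw. (Y (v i) s - Y (v j) s)\<^sup>2) < 4 / real (Suc i) + 4 / real (Suc j)" for i j
    proof -
      have "0 \<le> (LINT s|lborel_on Q. (X (v i) s - X (v j) s)\<^sup>2)" by simp
      with diff[of i j] show ?thesis by linarith
    qed
    ultimately show "\<exists>N. \<forall>i\<ge>N. \<forall>j\<ge>N. (LINT s|lborel_on Qw. (Y (v i) s - Y (v j) s)\<^sup>2) < e" by (meson less_trans)
  qed
  from L2_complete[OF Y_L2[OF v] this] obtain w where w: "w \<in> L2 Qw"
    and w_lim: "(\<lambda>n. LINT s|lborel_on Qw. (Y (v n) s - w s)\<^sup>2) \<longlonglongrightarrow> 0" by blast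
  define u where "u s = w s / r0 s" for s
  have u: "u \<in> U" unfolding u_def[abs_def] by (rule r0_divide_U[OF w])
  have Yu: "Y u s = w s" if "s \<in> Qw" for s
    using r0_pos[OF that] by (simp add: Y_def u_def)
  \<comment> \<open>Tested with \<open>q\<close>, the weighted state depends on the control only
    through an \<open>L2 Qw\<close> pairing of \<open>Y z\<close> with a fixed function:
    \<open>r\<close> is moved onto \<open>q\<close> and \<open>r0\<close> is divided out of
    \<open>Ms\<close>. In this form convergence of \<open>Y (v n)\<close> can be used.\<close>
  have Xq: "(LINT s|lborel_on Q. X z s * q s)
      = (LINT s|lborel_on Qw. Y z s * (Ms (\<lambda>s. r s * q s) s / r0 s)) + (LINT s|lborel_on Q. r s * ybar s * q s)"
    if z: "z \<in> U" and q: "q \<in> L2 Q" for z q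
  proof -
    note rq = r_mult_L2[OF q]
    have "(LINT s|lborel_on Q. X z s * q s)
        = (LINT s|lborel_on Q. M z s * (r s * q s) + r s * ybar s * q s)"
      by (simp add: X_def algebra_simps)
    also have "\<dots> = (LINT s|lborel_on Q. M z s * (r s * q s)) + (LINT s|lborel_on Q. r s * ybar s * q s)"
      by (intro Bochner_Integration.integral_add L2_mult_integrable M U_L2 z rq r_mult_L2 ybar q)
    also have "(LINT s|lborel_on Q. M z s * (r s * q s)) = (LINT s|lborel_on Qw. z s * Ms (\<lambda>s. r s * q s) s)"
      by (rule adjoint[OF U_L2[OF z] rq])
    also have "\<dots> = (LINT s|lborel_on Qw. Y z s * (Ms (\<lambda>s. r s * q s) s / r0 s))"
      by (rule integral_cong_Qw) (auto simp: Y_def dest: r0_pos)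
    finally show ?thesis .
  qed
  have x_eq: "AE s in lborel_on Q. x s = X u s"
  proof (rule L2_orthogonal_AE[OF x X_L2[OF U_L2[OF u]]])
    fix q :: "'b \<Rightarrow> real" assume q: "q \<in> L2 Q"
    let ?g = "\<lambda>s. Ms (\<lambda>s. r s * q s) s / r0 s"
    have g: "?g \<in> L2 Qw" by (intro r0_divide_L2 Ms r_mult_L2 q)
    have "(\<lambda>n. LINT s|lborel_on Q. X (v n) s \<bullet> q s) \<longlonglongrightarrow> (LINT s|lborel_on Q. x s \<bullet> q s)"
      by (rule L2_inner_tendsto[OF X_L2[OF vL2] x q]) (simp add: x_lim)
    moreover have "(\<lambda>n. LINT s|lborel_on Qw. Y (v n) s \<bullet> ?g s) \<longlonglongrightarrow> (LINT s|lborel_on Qw. w s \<bullet> ?g s)"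
      by (rule L2_inner_tendsto[OF Y_L2[OF v] w g]) (simp add: w_lim)
    then have "(\<lambda>n. (LINT s|lborel_on Qw. Y (v n) s * ?g s) + (LINT s|lborel_on Q. r s * ybar s * q s))
        \<longlonglongrightarrow> (LINT s|lborel_on Qw. w s * ?g s) + (LINT s|lborel_on Q. r s * ybar s * q s)"
      by (intro tendsto_add tendsto_const) (simp only: inner_real_def)
    ultimately have "(LINT s|lborel_on Q. x s * q s)
        = (LINT s|lborel_on Qw. w s * ?g s) + (LINT s|lborel_on Q. r s * ybar s * q s)"
      unfolding Xq[OF v q, symmetric] inner_real_def by (rule LIMSEQ_unique)
    also have "(LINT s|lborel_on Qw. w s * ?g s) = (LINT s|lborel_on Qw. Y u s * ?g s)"
      by (rule integral_cong_Qw) (simp only: Yu)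
    finally show "(LINT s|lborel_on Q. x s \<bullet> q s) = (LINT s|lborel_on Q. X u s \<bullet> q s)"
      unfolding inner_real_def Xq[OF u q] .
  qed
  have "(\<lambda>n. I (v n)) \<longlonglongrightarrow> 1/2 * (LINT s|lborel_on Q. (x s)\<^sup>2) + 1/2 * (LINT s|lborel_on Qw. (w s)\<^sup>2)"
    unfolding I_eq
    using L2_norm_tendsto[OF X_L2[OF vL2] x] L2_norm_tendsto[OF Y_L2[OF v] w] x_lim w_lim
    by (intro tendsto_intros) simp_all
  moreover have "(LINT s|lborel_on Q. (x s)\<^sup>2) = (LINT s|lborel_on Q. (X u s)\<^sup>2)"
    using x_eq x X_L2[OF U_L2[OF u]] by (intro integral_cong_AE) (auto simp: L2_def)
  moreover have "(LINT s|lborel_on Qw. (w s)\<^sup>2) = (LINT s|lborel_on Qw. (Y u s)\<^sup>2)"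
    by (rule integral_cong_Qw) (simp only: Yu)
  ultimately have "(\<lambda>n. I (v n)) \<longlonglongrightarrow> I u" by (simp add: I_eq)
  moreover have "(\<lambda>n. ?d + 1 / real (Suc n)) \<longlonglongrightarrow> ?d + 0"
    by (intro tendsto_intros LIMSEQ_Suc[OF lim_1_over_n])
  ultimately have "I u \<le> ?d + 0"
    using vd by (intro LIMSEQ_le[where X = "\<lambda>n. I (v n)"]) (auto intro: less_imp_le)
  then have "\<forall>w\<in>U. I u \<le> I w" using d_le by force
  with u show ?thesis unfolding is_minimizer_def by blast
qed

lemma minimizer_control_gap:
  assumes "is_minimizer U I v"
  shows "control_gap v (dual_of v) = 0"
proof -
  have v: "v \<in> U" and min: "\<And>w. w \<in> U \<Longrightarrow> I v \<le> I w"
    using assms by (auto simp: is_minimizer_def)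
  note Xv = X_L2[OF U_L2[OF v]]
  note q = dual_of(1)[OF v]
  \<comment> \<open>The residual whose square is integrated in \<open>control_gap\<close> serves,
    after division by \<open>r0\<close>, as the direction of variation: then \<open>Y h = g\<close>,
    and the first variation becomes the squared norm of \<open>g\<close>.\<close>
  define g where "g s = Y v s - Ms (dual_of v) s / r0 s" for s
  have g: "g \<in> L2 Qw" unfolding g_def[abs_def] by (intro L2_minus Y_L2 v r0_divide_L2 Ms q)
  define h where "h s = g s / r0 s" for s
  have h: "h \<in> U" unfolding h_def[abs_def] by (rule r0_divide_U[OF g])
  have Yh: "Y h s = g s" if "s \<in> Qw" for s
    using r0_pos[OF that] by (simp add: Y_def h_def)
  note rMh = r_mult_L2[OF M[OF U_L2[OF h]]]
  \<comment> \<open>\<open>?l\<close> and \<open>?c\<close> are the coefficients of \<open>t\<close>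
    and \<open>t^2\<close> in the increment of the cost from \<open>v\<close> to
    \<open>v + t h\<close>.\<close>
  let ?l = "(LINT s|lborel_on Q. X v s * (r s * M h s)) + (LINT s|lborel_on Qw. Y v s * Y h s)"
  let ?c = "1/2 * (LINT s|lborel_on Q. (r s * M h s)\<^sup>2) + 1/2 * (LINT s|lborel_on Qw. (Y h s)\<^sup>2)"
  have "0 \<le> t * ?l + t\<^sup>2 * ?c" for t
  proof -
    let ?w = "\<lambda>s. 1 * v s + t * h s"
    have w: "?w \<in> U" by (rule U_combine[OF v h])
    have "(LINT s|lborel_on Q. (X ?w s)\<^sup>2)
      = (LINT s|lborel_on Q. (X v s)\<^sup>2 + 2 * t * (X v s * (r s * M h s)) + t\<^sup>2 * (r s * M h s)\<^sup>2)"
    proof (rule integral_cong_AE)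
      show "AE s in lborel_on Q. (X ?w s)\<^sup>2
          = (X v s)\<^sup>2 + 2 * t * (X v s * (r s * M h s)) + t\<^sup>2 * (r s * M h s)\<^sup>2"
        using M_linear[OF U_L2[OF v] U_L2[OF h], of 1 t]
        by eventually_elim (simp add: X_def power2_eq_square algebra_simps)
    qed (use X_L2[OF U_L2[OF w]] Xv rMh in \<open>auto simp: L2_def\<close>)
    also have "\<dots> = (LINT s|lborel_on Q. (X v s)\<^sup>2) + 2 * t * (LINT s|lborel_on Q. X v s * (r s * M h s))
        + t\<^sup>2 * (LINT s|lborel_on Q. (r s * M h s)\<^sup>2)"
      using L2_sq_integrable[OF Xv] L2_sq_integrable[OF rMh] L2_mult_integrable[OF Xv rMh] by simp
    finally have 1: "(LINT s|lborel_on Q. (X ?w s)\<^sup>2) = \<dots>" .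
    have "(LINT s|lborel_on Qw. (Y ?w s)\<^sup>2)
      = (LINT s|lborel_on Qw. (Y v s)\<^sup>2 + 2 * t * (Y v s * Y h s) + t\<^sup>2 * (Y h s)\<^sup>2)"
      by (rule integral_cong_Qw) (simp add: Y_def power2_eq_square algebra_simps)
    also have "\<dots> = (LINT s|lborel_on Qw. (Y v s)\<^sup>2) + 2 * t * (LINT s|lborel_on Qw. Y v s * Y h s)
        + t\<^sup>2 * (LINT s|lborel_on Qw. (Y h s)\<^sup>2)"
      using L2_sq_integrable[OF Y_L2[OF v]] L2_sq_integrable[OF Y_L2[OF h]]
        L2_mult_integrable[OF Y_L2[OF v] Y_L2[OF h]] by simp
    finally have 2: "(LINT s|lborel_on Qw. (Y ?w s)\<^sup>2) = \<dots>" .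
    have "I ?w = I v + (t * ?l + t\<^sup>2 * ?c)"
      unfolding I_eq 1 2 by (simp add: algebra_simps)
    with min[OF w] show ?thesis by simp
  qed
  then have "?l = 0" by (rule linear_part_zero) simp
  moreover have "(LINT s|lborel_on Q. X v s * (r s * M h s)) = - (LINT s|lborel_on Q. M h s * dual_of v s)"
    by (simp add: dual_of_def mult_ac)
  moreover have "\<dots> = - (LINT s|lborel_on Qw. h s * Ms (dual_of v) s)"
    by (simp add: adjoint[OF U_L2[OF h] q])
  moreover have "(LINT s|lborel_on Qw. h s * Ms (dual_of v) s) = (LINT s|lborel_on Qw. Ms (dual_of v) s / r0 s * g s)"
    by (simp add: h_def mult.commute)
  moreover have "(LINT s|lborel_on Qw. Y v s * Y h s) = (LINT s|lborel_on Qw. Y v s * g s)"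
    by (rule integral_cong_Qw) (simp only: Yh)
  ultimately have "(LINT s|lborel_on Qw. Y v s * g s) - (LINT s|lborel_on Qw. Ms (dual_of v) s / r0 s * g s) = 0"
    by simp
  moreover have "(LINT s|lborel_on Qw. Y v s * g s) - (LINT s|lborel_on Qw. Ms (dual_of v) s / r0 s * g s)
      = (LINT s|lborel_on Qw. Y v s * g s - Ms (dual_of v) s / r0 s * g s)"
    by (intro Bochner_Integration.integral_diff[symmetric] L2_mult_integrable Y_L2 v g r0_divide_L2 Ms q)
  moreover have "\<dots> = control_gap v (dual_of v)"
    unfolding control_gap_def g_def[symmetric]
    by (rule integral_cong_Qw) (simp add: g_def power2_eq_square algebra_simps)
  ultimately show ?thesis by simp
qed

section \<open>Optimality as vanishing of the duality gap, and uniqueness\<close>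

lemma optimal_pair:
  obtains v q where "v \<in> U" "q \<in> L2 Q" "I v + \<Phi> q = 0"
proof -
  obtain v where v: "is_minimizer U I v" using minimizer_exists by blast
  then have vU: "v \<in> U" by (simp add: is_minimizer_def)
  have "I v + \<Phi> (dual_of v) = 0"
    using duality_gap[OF vU dual_of(1)[OF vU]] dual_of(2) minimizer_control_gap[OF v] by simp
  with vU dual_of(1)[OF vU] show ?thesis by (rule that)
qed

lemma weak_duality_gap:
  assumes "v \<in> U" "q \<in> L2 Q"
  shows "0 \<le> I v + \<Phi> q"
  unfolding duality_gap[OF assms] using gap_nonneg[of v q] by simp

text \<open>In the direction from right to left the two optimizers are found separately. Comparison
  with one known zero-gap pair forces their own gap to be at most zero, and weak duality gives the
  rest.\<close>

lemma optimal_iff: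
  assumes "v \<in> U" "q \<in> L2 Q"
  shows "I v + \<Phi> q = 0 \<longleftrightarrow> is_minimizer U I v \<and> is_maximizer (L2 Q) (\<lambda>q. - \<Phi> q) q"
proof
  assume "I v + \<Phi> q = 0"
  moreover from this have "I v \<le> I w" if "w \<in> U" for w
    using weak_duality_gap[OF that assms(2)] by linarith
  moreover from calculation have "- \<Phi> p \<le> - \<Phi> q" if "p \<in> L2 Q" for p
    using weak_duality_gap[OF assms(1) that] by linarith
  ultimately show "is_minimizer U I v \<and> is_maximizer (L2 Q) (\<lambda>q. - \<Phi> q) q"
    using assms by (auto simp: is_minimizer_def is_maximizer_def)
next
  assume opt: "is_minimizer U I v \<and> is_maximizer (L2 Q) (\<lambda>q. - \<Phi> q) q"
  obtain w p where "w \<in> U" "p \<in> L2 Q" "I w + \<Phi> p = 0" by (rule optimal_pair)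
  with opt have "I v \<le> I w" "- \<Phi> p \<le> - \<Phi> q" by (auto simp: is_minimizer_def is_maximizer_def)
  with \<open>I w + \<Phi> p = 0\<close> weak_duality_gap[OF assms] show "I v + \<Phi> q = 0" by linarith
qed

lemma optimal_gaps:
  assumes "v \<in> U" "q \<in> L2 Q" "I v + \<Phi> q = 0"
  shows "state_gap v q = 0" "control_gap v q = 0"
  using duality_gap[OF assms(1,2)] assms(3) gap_nonneg[of v q] by auto

lemma optimal_AE:
  assumes "v \<in> U" "q \<in> L2 Q" "I v + \<Phi> q = 0"
  shows "AE s in lborel_on Q. q s = dual_of v s" "AE s in lborel_on Qw. v s = control_of q s"
  using optimal_gaps[OF assms] state_gap_zero control_gap_zero assms by auto

text \<open>Partners are exchanged: any minimizer together with the same dual solution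
  \<open>q\<close> has zero gap, and thus equals \<open>control_of q\<close> almost everywhere. This
  takes the place of a strict convexity argument, and \<open>dual_unique\<close> is proved
  symmetrically.\<close>

lemma primal_unique:
  "\<exists>v. is_minimizer U I v \<and> (\<forall>v'. is_minimizer U I v' \<longrightarrow> (AE s in lborel_on Qw. v' s = v s))"
proof -
  obtain v q where opt: "v \<in> U" "q \<in> L2 Q" "I v + \<Phi> q = 0" by (rule optimal_pair)
  then have o: "is_minimizer U I v" "is_maximizer (L2 Q) (\<lambda>q. - \<Phi> q) q" using optimal_iff by auto
  have "AE s in lborel_on Qw. v' s = v s" if v': "is_minimizer U I v'" for v'
  proof -
    have U: "v' \<in> U" using v' by (simp add: is_minimizer_def)
    have "I v' + \<Phi> q = 0" using optimal_iff[OF U opt(2)] v' o by simp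
    from optimal_AE(2)[OF U opt(2) this] optimal_AE(2)[OF opt] show ?thesis
      by eventually_elim simp
  qed
  with o show ?thesis by blast
qed

lemma dual_unique:
  "\<exists>q. is_maximizer (L2 Q) (\<lambda>q. - \<Phi> q) q \<and>
    (\<forall>q'. is_maximizer (L2 Q) (\<lambda>q. - \<Phi> q) q' \<longrightarrow> (AE s in lborel_on Q. q' s = q s))"
proof -
  obtain v q where opt: "v \<in> U" "q \<in> L2 Q" "I v + \<Phi> q = 0" by (rule optimal_pair)
  then have o: "is_minimizer U I v" "is_maximizer (L2 Q) (\<lambda>q. - \<Phi> q) q" using optimal_iff by auto
  have "AE s in lborel_on Q. q' s = q s" if q': "is_maximizer (L2 Q) (\<lambda>q. - \<Phi> q) q'" for q'
  proof -
    have L: "q' \<in> L2 Q" using q' by (simp add: is_maximizer_def)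
    have "I v + \<Phi> q' = 0" using optimal_iff[OF opt(1) L] q' o by simp
    from optimal_AE(1)[OF opt(1) L this] optimal_AE(1)[OF opt] show ?thesis
      by eventually_elim simp
  qed
  with o show ?thesis by blast
qed

section \<open>Inf-sup values, saddle points and extremality relations\<close>

lemma SUP_Lagrangian:
  assumes v: "v \<in> U"
  shows "(SUP q\<in>L2 Q. ereal (L v q)) = ereal (I v)"
proof (rule antisym)
  show "(SUP q\<in>L2 Q. ereal (L v q)) \<le> ereal (I v)"
    using Lagrangian_primal[OF v] gap_nonneg by (intro SUP_least) simp
  show "ereal (I v) \<le> (SUP q\<in>L2 Q. ereal (L v q))"
    using Lagrangian_primal[OF v dual_of(1)[OF v]] dual_of(1)[OF v] dual_of(2)
    by (intro SUP_upper2[of "dual_of v"]) simp_all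
qed

lemma INF_Lagrangian:
  assumes q: "q \<in> L2 Q"
  shows "(INF v\<in>U. ereal (L v q)) = ereal (- \<Phi> q)"
proof (rule antisym)
  show "ereal (- \<Phi> q) \<le> (INF v\<in>U. ereal (L v q))"
    using Lagrangian_dual[OF _ q] gap_nonneg by (intro INF_greatest) simp
  show "(INF v\<in>U. ereal (L v q)) \<le> ereal (- \<Phi> q)"
    using Lagrangian_dual[OF control_of(1)[OF q] q] control_of(1)[OF q] control_of(2)
    by (intro INF_lower2[of "control_of q"]) simp_all
qed

lemma INF_SUP_Lagrangian: "(INF v\<in>U. SUP q\<in>L2 Q. ereal (L v q)) = (INF v\<in>U. ereal (I v))"
  by (rule INF_cong) (simp_all add: SUP_Lagrangian)

lemma SUP_INF_Lagrangian: "(SUP q\<in>L2 Q. INF v\<in>U. ereal (L v q)) = (SUP q\<in>L2 Q. ereal (- \<Phi> q))"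
  by (rule SUP_cong) (simp_all add: INF_Lagrangian)

text \<open>Comparing a saddle point with \<open>dual_of v\<close> and \<open>control_of q\<close>,
  where the extremal values are attained, gives the reverse of weak duality. Conversely, zero gap
  makes \<open>L v q\<close> equal to both \<open>I v\<close> and \<open>- \<Phi> q\<close>.\<close>

lemma saddle_point_iff:
  assumes v: "v \<in> U" and q: "q \<in> L2 Q"
  shows "is_saddle_point U (L2 Q) L v q \<longleftrightarrow> I v + \<Phi> q = 0"
proof
  assume s: "is_saddle_point U (L2 Q) L v q"
  have "I v = L v (dual_of v)"
    using Lagrangian_primal[OF v dual_of(1)[OF v]] dual_of(2) by simp
  also have "\<dots> \<le> L v q" using s dual_of(1)[OF v] v by (auto simp: is_saddle_point_def)
  also have "\<dots> \<le> L (control_of q) q" using s control_of(1)[OF q] q by (auto simp: is_saddle_point_def)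
  also have "\<dots> = - \<Phi> q"
    using Lagrangian_dual[OF control_of(1)[OF q] q] control_of(2) by simp
  finally show "I v + \<Phi> q = 0" using weak_duality_gap[OF v q] by linarith
next
  assume opt: "I v + \<Phi> q = 0"
  have "L v q = I v" using Lagrangian_primal[OF v q] optimal_gaps[OF v q opt] by simp
  moreover have "L v q' \<le> I v" if "q' \<in> L2 Q" for q'
    using Lagrangian_primal[OF v that] gap_nonneg(1)[of v q'] by simp
  moreover have "I v \<le> L v' q" if "v' \<in> U" for v'
    using Lagrangian_dual[OF that q] gap_nonneg(2)[of v' q] opt by simp
  ultimately show "is_saddle_point U (L2 Q) L v q"
    using v q opt by (auto simp: is_saddle_point_def)
qed

text \<open>With zero \<open>state_gap\<close> the Lagrangian equals the primal cost; the control
  terms cancel and equality in the Fenchel-Young inequality remains. \<open>dual_extremality\<close>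
  compares with the dual cost in the same way, and there the \<open>q^2 / r^2\<close> terms
  cancel.\<close>

lemma primal_extremality:
  assumes v: "v \<in> U" and q: "q \<in> L2 Q" and gap: "state_gap v q = 0"
  shows "ereal (F_fun Q r ybar (M v)) + F_conj Q r ybar (\<lambda>s. - q s) = ereal (- pairing Q (M v) q)"
proof -
  have mq: "(\<lambda>s. - q s) \<in> L2 Q" using L2_mult[OF q, of "-1"] by simp
  have "(LINT s|lborel_on Q. q s * (M v s + ybar s)) = pairing Q (M v) q + (LINT s|lborel_on Q. ybar s * q s)"
    using L2_mult_integrable[OF M[OF U_L2[OF v]] q] L2_mult_integrable[OF ybar q]
    by (simp add: pairing_def distrib_left mult.commute)
  moreover have "F_conj Q r ybar (\<lambda>s. - q s) = ereal (1/2 * (LINT s|lborel_on Q. (- q s)\<^sup>2 / (r s)\<^sup>2)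
      - (LINT s|lborel_on Q. ybar s * - q s))"
    by (rule F_conj_eq[OF r(1,2) _ ybar mq]) (rule r(3))
  ultimately show ?thesis
    using Lagrangian_primal[OF v q] gap
    by (simp add: Lagrangian_def primal_fun_def G_fun_def)
qed

lemma dual_extremality:
  assumes v: "v \<in> U" and q: "q \<in> L2 Q" and gap: "control_gap v q = 0"
  shows "ereal (G_fun Qw r0 v) + G_conj Qw r0 (Ms q) = ereal (pairing Qw (Ms q) v)"
proof -
  have "Ms q \<in> borel_measurable (lborel_on Qw)" using Ms[OF q] by (simp add: L2_def)
  then have "G_conj Qw r0 (Ms q) = ereal (1/2 * (LINT s|lborel_on Qw. (Ms q s)\<^sup>2 / (r0 s)\<^sup>2))"
    using r0_divide_L2[OF Ms[OF q]] by (intro G_conj_eq[OF r0(1) r(2)] r0(2))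
  moreover have "(LINT s|lborel_on Q. q s * (M v s + ybar s))
      = pairing Qw (Ms q) v + (LINT s|lborel_on Q. q s * ybar s)"
    using L2_mult_integrable[OF M[OF U_L2[OF v]] q] L2_mult_integrable[OF q ybar] adjoint[OF U_L2[OF v] q]
    by (simp add: pairing_def distrib_left mult.commute)
  ultimately show ?thesis
    using Lagrangian_dual[OF v q] gap by (simp add: Lagrangian_def dual_fun_def G_fun_def)
qed

lemma duality:
  "(\<exists>v. is_minimizer U I v \<and> (\<forall>v'. is_minimizer U I v' \<longrightarrow> (AE z in lborel_on Qw. v' z = v z))) \<and>
   (\<exists>q. is_maximizer (L2 Q) (\<lambda>q. - \<Phi> q) q \<and>
     (\<forall>q'. is_maximizer (L2 Q) (\<lambda>q. - \<Phi> q) q' \<longrightarrow> (AE z in lborel_on Q. q' z = q z))) \<and>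
   (INF v\<in>U. ereal (I v)) = (INF v\<in>U. SUP q\<in>L2 Q. ereal (L v q)) \<and>
   (SUP q\<in>L2 Q. ereal (- \<Phi> q)) = (SUP q\<in>L2 Q. INF v\<in>U. ereal (L v q)) \<and>
   (\<forall>vR qR. is_minimizer U I vR \<and> is_maximizer (L2 Q) (\<lambda>q. - \<Phi> q) qR \<longrightarrow>
     is_saddle_point U (L2 Q) L vR qR \<and>
     (\<forall>v q. is_saddle_point U (L2 Q) L v q \<longrightarrow>
        (AE z in lborel_on Qw. v z = vR z) \<and> (AE z in lborel_on Q. q z = qR z)) \<and>
     (INF v\<in>U. SUP q\<in>L2 Q. ereal (L v q)) = ereal (L vR qR) \<and>
     ereal (L vR qR) = (SUP q\<in>L2 Q. INF v\<in>U. ereal (L v q)) \<and>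
     ereal (F_fun Q r ybar (M vR)) + F_conj Q r ybar (\<lambda>z. - qR z) = ereal (- pairing Q (M vR) qR) \<and>
     ereal (G_fun Qw r0 vR) + G_conj Qw r0 (Ms qR) = ereal (pairing Qw (Ms qR) vR) \<and>
     (AE z in lborel_on Q. M vR z + ybar z = - qR z / (r z)\<^sup>2) \<and>
     (AE z in lborel_on Qw. vR z = Ms qR z / (r0 z)\<^sup>2))"
proof (intro conjI primal_unique dual_unique INF_SUP_Lagrangian[symmetric] SUP_INF_Lagrangian[symmetric]
    allI impI; (elim conjE)?)
  fix v q assume min: "is_minimizer U I v" and max: "is_maximizer (L2 Q) (\<lambda>q. - \<Phi> q) q"
  then have v: "v \<in> U" and q: "q \<in> L2 Q" by (auto simp: is_minimizer_def is_maximizer_def)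
  have opt: "I v + \<Phi> q = 0" using optimal_iff[OF v q] min max by simp
  note gaps = optimal_gaps[OF v q opt]
  show "is_saddle_point U (L2 Q) L v q" using saddle_point_iff[OF v q] opt by simp
  {
    fix v' q' assume s: "is_saddle_point U (L2 Q) L v' q'"
    then have v': "v' \<in> U" and q': "q' \<in> L2 Q" by (auto simp: is_saddle_point_def)
    have opt': "I v' + \<Phi> q' = 0" using saddle_point_iff[OF v' q'] s by simp
    \<comment> \<open>Each component of the other saddle point is optimal by itself and may be
      paired with the opposite component of the given one; uniqueness then reduces to the pointwise
      formulas.\<close>
    then have mixed: "I v' + \<Phi> q = 0" "I v + \<Phi> q' = 0"
      using optimal_iff[OF v' q'] optimal_iff[OF v' q] optimal_iff[OF v q'] min max by auto
    show "AE z in lborel_on Qw. v' z = v z"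
      using optimal_AE(2)[OF v' q mixed(1)] optimal_AE(2)[OF v q opt] by eventually_elim simp
    show "AE z in lborel_on Q. q' z = q z"
      using optimal_AE(1)[OF v q' mixed(2)] optimal_AE(1)[OF v q opt] by eventually_elim simp
  }
  have LI: "L v q = I v" using Lagrangian_primal[OF v q] gaps by simp
  show "(INF v\<in>U. SUP q\<in>L2 Q. ereal (L v q)) = ereal (L v q)"
    unfolding INF_SUP_Lagrangian LI
  proof (rule antisym)
    show "(INF v\<in>U. ereal (I v)) \<le> ereal (I v)" by (rule INF_lower[OF v])
    show "ereal (I v) \<le> (INF v\<in>U. ereal (I v))"
      using min by (intro INF_greatest) (simp add: is_minimizer_def)
  qed
  have L\<Phi>: "L v q = - \<Phi> q" using LI opt by simp
  show "ereal (L v q) = (SUP q\<in>L2 Q. INF v\<in>U. ereal (L v q))"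
    unfolding SUP_INF_Lagrangian L\<Phi>
  proof (rule antisym)
    show "ereal (- \<Phi> q) \<le> (SUP q\<in>L2 Q. ereal (- \<Phi> q))" by (rule SUP_upper[OF q])
    show "(SUP q\<in>L2 Q. ereal (- \<Phi> q)) \<le> ereal (- \<Phi> q)"
      using max by (intro SUP_least) (simp add: is_maximizer_def)
  qed
  show "ereal (F_fun Q r ybar (M v)) + F_conj Q r ybar (\<lambda>z. - q z) = ereal (- pairing Q (M v) q)"
    by (rule primal_extremality[OF v q gaps(1)])
  show "ereal (G_fun Qw r0 v) + G_conj Qw r0 (Ms q) = ereal (pairing Qw (Ms q) v)"
    by (rule dual_extremality[OF v q gaps(2)])
  have "AE z in lborel_on Q. 0 < r z" by (rule AE_Q) (rule r_pos)
  with optimal_AE(1)[OF v q opt] show "AE z in lborel_on Q. M v z + ybar z = - q z / (r z)\<^sup>2"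
    by eventually_elim (simp add: dual_of_def X_def power2_eq_square)
  show "AE z in lborel_on Qw. v z = Ms q z / (r0 z)\<^sup>2"
    using optimal_AE(2)[OF v q opt] by eventually_elim (simp add: control_of_def power2_eq_square)
qed

end

section \<open>Carleman weights\<close>

text \<open>Compactness of the closure turns the strict pointwise inequality into a uniform gap;
  \<open>c\<close> is what keeps \<open>rho0\<close> away from zero.\<close>

lemma eta_gap:
  fixes \<Omega> :: "'a::euclidean_space set"
  assumes "bounded \<Omega>" "\<Omega> \<noteq> {}" "continuous_on (closure \<Omega>) \<eta>" "\<forall>x\<in>closure \<Omega>. \<eta> x < K"
  obtains c where "0 < c" "\<And>x. x \<in> \<Omega> \<Longrightarrow> c \<le> exp K - exp (\<eta> x :: real)"
proof -
  have "compact (closure \<Omega>)" "closure \<Omega> \<noteq> {}"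
    using assms(1,2) by (auto simp: compact_closure)
  moreover have "continuous_on (closure \<Omega>) (\<lambda>x. exp K - exp (\<eta> x))"
    by (intro continuous_intros assms(3))
  ultimately obtain x where x: "x \<in> closure \<Omega>"
      "\<forall>y\<in>closure \<Omega>. exp K - exp (\<eta> x) \<le> exp K - exp (\<eta> y)"
    using continuous_attains_inf by blast
  show ?thesis
  proof (rule that)
    show "0 < exp K - exp (\<eta> x)" using assms(4) x(1) by simp
    show "exp K - exp (\<eta> x) \<le> exp K - exp (\<eta> y)" if "y \<in> \<Omega>" for y
      using x(2) closure_subset that by blast
  qed
qed

lemma alpha_eq: "alpha K1 K2 T \<eta> z = K1 * (exp K2 - exp (\<eta> (fst z))) / (T - snd z)"
  by (simp add: alpha_def case_prod_unfold)

lemma rho_continuous: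
  assumes "continuous_on \<Omega> \<eta>"
  shows "continuous_on (\<Omega> \<times> {0<..<T}) (rho K1 K2 T \<eta>)"
    and "continuous_on (\<Omega> \<times> {0<..<T}) (rho0 K1 K2 T \<eta>)"
proof -
  have \<eta>: "continuous_on (\<Omega> \<times> {0<..<T}) (\<lambda>z. \<eta> (fst z))"
    by (rule continuous_on_compose2[OF assms continuous_on_fst[OF continuous_on_id]]) auto
  show rho: "continuous_on (\<Omega> \<times> {0<..<T}) (rho K1 K2 T \<eta>)"
    unfolding rho_def[abs_def] alpha_eq by (intro continuous_intros \<eta>) auto
  show "continuous_on (\<Omega> \<times> {0<..<T}) (rho0 K1 K2 T \<eta>)"
    unfolding rho0_def[abs_def] by (intro continuous_intros rho) auto
qed

lemma rho_ge_1:
  assumes "0 \<le> K1" "\<eta> (fst z) \<le> K2" "snd z < T"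
  shows "1 \<le> rho K1 K2 T \<eta> z"
  using assms by (simp add: rho_def alpha_eq)

text \<open>The exponential beats the vanishing factor \<open>(T - t) powr (3/2)\<close> because \<open>exp x \<ge> x\<^sup>2 / 2\<close>.\<close>

lemma rho0_lower_bound:
  assumes K1: "0 \<le> K1" and c: "0 \<le> c" "c \<le> exp K2 - exp (\<eta> (fst z))" and t: "0 < snd z" "snd z < T"
  shows "(K1 * c)\<^sup>2 / 2 * T powr (- 1/2) \<le> rho0 K1 K2 T \<eta> z"
proof -
  let ?k = "K1 * c" and ?u = "T - snd z"
  have u: "0 < ?u" "?u \<le> T" using t by auto
  have k: "0 \<le> ?k / ?u" using K1 c u by simp
  have "(?k / ?u)\<^sup>2 / 2 \<le> exp (?k / ?u)"
    using exp_lower_Taylor_quadratic[OF k] k by linarith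
  also have "\<dots> \<le> rho K1 K2 T \<eta> z"
    unfolding rho_def alpha_eq using K1 c u by (simp add: divide_right_mono mult_left_mono)
  finally have "?u powr (3/2) * ((?k / ?u)\<^sup>2 / 2) \<le> rho0 K1 K2 T \<eta> z"
    unfolding rho0_def by (intro mult_left_mono) auto
  moreover have "?u powr (3/2) * ((?k / ?u)\<^sup>2 / 2) = ?k\<^sup>2 / 2 * ?u powr (- 1/2)"
  proof -
    have "?u powr (- 1/2) = ?u powr (3/2) / ?u powr 2"
      by (simp add: powr_diff[symmetric])
    also have "?u powr 2 = ?u\<^sup>2" using u by simp
    finally show ?thesis by (simp add: power_divide mult.commute)
  qed
  \<comment> \<open>The exponent is negative, so over \<open>0 < ?u \<le> T\<close> the power is
    smallest at \<open>T\<close>.\<close>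
  moreover have "?k\<^sup>2 / 2 * T powr (- 1/2) \<le> ?k\<^sup>2 / 2 * ?u powr (- 1/2)"
    using u by (intro mult_left_mono powr_mono2') auto
  ultimately show ?thesis by linarith
qed

section \<open>The control problem\<close>

lemma L2_subset:
  assumes "f \<in> L2 Q" "S \<subseteq> Q" "S \<in> sets lborel" "Q \<in> sets lborel"
  shows "f \<in> L2 S"
proof -
  have ind: "indicator S s *\<^sub>R (indicator Q s *\<^sub>R x) = indicator S s *\<^sub>R x" for s and x :: "'d::real_vector"
    using assms(2) by (auto simp: indicator_def)
  have "(\<lambda>s. indicator Q s *\<^sub>R f s) \<in> borel_measurable lborel"
    using assms by (simp add: L2_def borel_measurable_restrict_space_iff)
  then have "(\<lambda>s. indicator S s *\<^sub>R (indicator Q s *\<^sub>R f s)) \<in> borel_measurable lborel"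
    by (rule borel_measurable_scaleR[OF borel_measurable_indicator[OF assms(3)]])
  moreover have "integrable lborel (\<lambda>s. indicator Q s *\<^sub>R (norm (f s))\<^sup>2)"
    using L2_norm_integrable[OF assms(1)] assms(4) by (simp add: integrable_restrict_space)
  then have "integrable lborel (\<lambda>s. indicator S s *\<^sub>R (indicator Q s *\<^sub>R (norm (f s))\<^sup>2))"
    by (rule integrable_mult_indicator[OF assms(3)])
  ultimately show ?thesis
    unfolding ind using assms(3)
    by (simp add: L2_def borel_measurable_restrict_space_iff integrable_restrict_space)
qed

lemma L2_extend:
  fixes v :: "'b::euclidean_space \<Rightarrow> real"
  assumes "v \<in> L2 S" "S \<subseteq> Q" "S \<in> sets lborel" "Q \<in> sets lborel"
  shows "(\<lambda>s. indicator S s * v s) \<in> L2 Q"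
proof -
  have ind: "indicator Q s * (indicator S s * v s) = indicator S s * v s"
    "indicator Q s * (indicator S s * v s)\<^sup>2 = indicator S s * (v s)\<^sup>2" for s
    using assms(2) by (auto simp: indicator_def)
  show ?thesis
    using assms by (simp add: L2_def borel_measurable_restrict_space_iff integrable_restrict_space ind)
qed

theorem theorem3p1:
  fixes \<Omega> \<omega> :: "'a::euclidean_space set" and T R a0 K1 K2 :: real
    and a b ybar \<rho> \<rho>0 \<rho>R :: "'a \<times> real \<Rightarrow> real" and \<eta> y0 :: "'a \<Rightarrow> real" and D\<eta> :: "'a \<Rightarrow> 'a"
    and M Ms :: "('a \<times> real \<Rightarrow> real) \<Rightarrow> ('a \<times> real \<Rightarrow> real)"
    and Q Qw :: "('a \<times> real) set" and U :: "('a \<times> real \<Rightarrow> real) set"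
    and I :: "('a \<times> real \<Rightarrow> real) \<Rightarrow> real" and \<Phi> :: "('a \<times> real \<Rightarrow> real) \<Rightarrow> real"
    and L :: "('a \<times> real \<Rightarrow> real) \<Rightarrow> ('a \<times> real \<Rightarrow> real) \<Rightarrow> real"
  assumes Omega: "bounded_C2_domain \<Omega>"
    and omega: "open \<omega>" "\<omega> \<noteq> {}" "\<omega> \<subseteq> \<Omega>"
    and T: "T > 0" and R: "R > 0"
    and Q_def: "Q = \<Omega> \<times> {0<..<T}" and Qw_def: "Qw = \<omega> \<times> {0<..<T}"
    and a: "a \<in> W1inf Q" and a0: "a0 > 0" "AE z in lborel_on Q. a0 \<le> a z"
    and b: "b \<in> Linf Q"
    and y0: "y0 \<in> L2 \<Omega>"
    and eta: "C2_closure \<Omega> \<eta> D\<eta>" "\<forall>x\<in>frontier \<Omega>. \<eta> x = 0"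
      "\<forall>x\<in>\<Omega> - closure \<omega>. norm (D\<eta> x) > 0"
      "\<forall>x\<in>frontier \<Omega>. \<forall>\<nu>. outward_normal \<Omega> x \<nu> \<longrightarrow> D\<eta> x \<bullet> \<nu> < 0"
    and K: "K1 > 0" "K2 > 0" "\<forall>x\<in>closure \<Omega>. \<eta> x < K2"
    and rho: "\<rho> = rho K1 K2 T \<eta>" and rho0: "\<rho>0 = rho0 K1 K2 T \<eta>"
    and rhoR: "\<rho>R = (\<lambda>z. min R (\<rho> z))"
    and M: "\<forall>v\<in>L2 Qw. weak_sol \<Omega> T a b (\<lambda>z. indicator Qw z * v z) (\<lambda>_. 0) (M v)"
    and Ms: "\<forall>q\<in>L2 Q. \<exists>\<zeta>. adjoint_weak_sol \<Omega> T a b q \<zeta> \<and>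
               Ms q \<in> borel_measurable (lborel_on Qw) \<and> (AE z in lborel_on Qw. Ms q z = \<zeta> z)"
    and ybar: "weak_sol \<Omega> T a b (\<lambda>_. 0) y0 ybar"
    and U_def: "U = ctrl_space Qw \<rho>0"
    and I_def: "I = primal_fun Q Qw \<rho>R \<rho>0 ybar M"
    and Phi_def: "\<Phi> = dual_fun Q Qw \<rho>R \<rho>0 ybar Ms"
    and L_def: "L = Lagrangian Q Qw \<rho>R \<rho>0 ybar M"
  shows
    "(\<exists>v. is_minimizer U I v \<and> (\<forall>v'. is_minimizer U I v' \<longrightarrow> (AE z in lborel_on Qw. v' z = v z))) \<and>
     (\<exists>q. is_maximizer (L2 Q) (\<lambda>q. - \<Phi> q) q \<and>
       (\<forall>q'. is_maximizer (L2 Q) (\<lambda>q. - \<Phi> q) q' \<longrightarrow> (AE z in lborel_on Q. q' z = q z))) \<and>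
     (INF v\<in>U. ereal (I v)) = (INF v\<in>U. SUP q\<in>L2 Q. ereal (L v q)) \<and>
     (SUP q\<in>L2 Q. ereal (- \<Phi> q)) = (SUP q\<in>L2 Q. INF v\<in>U. ereal (L v q)) \<and>
     (\<forall>vR qR. is_minimizer U I vR \<and> is_maximizer (L2 Q) (\<lambda>q. - \<Phi> q) qR \<longrightarrow>
       is_saddle_point U (L2 Q) L vR qR \<and>
       (\<forall>v q. is_saddle_point U (L2 Q) L v q \<longrightarrow>
          (AE z in lborel_on Qw. v z = vR z) \<and> (AE z in lborel_on Q. q z = qR z)) \<and>
       (INF v\<in>U. SUP q\<in>L2 Q. ereal (L v q)) = ereal (L vR qR) \<and>
       ereal (L vR qR) = (SUP q\<in>L2 Q. INF v\<in>U. ereal (L v q)) \<and>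
       ereal (F_fun Q \<rho>R ybar (M vR)) + F_conj Q \<rho>R ybar (\<lambda>z. - qR z) = ereal (- pairing Q (M vR) qR) \<and>
       ereal (G_fun Qw \<rho>0 vR) + G_conj Qw \<rho>0 (Ms qR) = ereal (pairing Qw (Ms qR) vR) \<and>
       (AE z in lborel_on Q. M vR z + ybar z = - qR z / (\<rho>R z)\<^sup>2) \<and>
       (AE z in lborel_on Qw. vR z = Ms qR z / (\<rho>0 z)\<^sup>2))"
proof -
  have \<Omega>: "open \<Omega>" "bounded \<Omega>" "\<Omega> \<noteq> {}" using Omega by (auto simp: bounded_C2_domain_def)
  have Q: "Q \<in> sets lborel" and Qw: "Qw \<in> sets lborel" and sub: "Qw \<subseteq> Q"
    using \<Omega> omega by (auto simp: Q_def Qw_def open_Times)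
  have aL: "a \<in> Linf Q" using a by (simp add: W1inf_def)
  have \<eta>_cont: "continuous_on (closure \<Omega>) \<eta>" using eta(1) by (auto simp: C2_closure_def)
  then have \<eta>_cont': "continuous_on \<Omega> \<eta>" by (rule continuous_on_subset[OF _ closure_subset])
  obtain c where c: "0 < c" "\<And>x. x \<in> \<Omega> \<Longrightarrow> c \<le> exp K2 - exp (\<eta> x)"
    using eta_gap[OF \<Omega>(2,3) \<eta>_cont K(3)] by blast
  \<comment> \<open>\<open>R\<close> and 1 bound the two arguments of the minimum in
    \<open>\<rho>R\<close> from below, the last term bounds \<open>\<rho>0\<close>. One constant
    serves both weights.\<close>
  define m where "m = min (min R 1) ((K1 * c)\<^sup>2 / 2 * T powr (- 1/2))"
  have m: "0 < m" using R K(1) c(1) T by (simp add: m_def)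
  have \<rho>_cont: "continuous_on Q \<rho>" "continuous_on Q \<rho>0"
    unfolding rho rho0 Q_def by (rule rho_continuous[OF \<eta>_cont'])+
  have \<rho>R_meas: "\<rho>R \<in> borel_measurable (lborel_on Q)"
    unfolding rhoR by (intro borel_measurable_lborel_on continuous_intros \<rho>_cont)
  have \<rho>0_meas: "\<rho>0 \<in> borel_measurable (lborel_on Qw)"
    by (intro borel_measurable_lborel_on continuous_on_subset[OF \<rho>_cont(2) sub])
  have \<rho>R_bounds: "m \<le> \<rho>R s \<and> \<rho>R s \<le> R" if "s \<in> Q" for s
  proof -
    have "\<eta> (fst s) < K2" using K(3) that closure_subset[of \<Omega>] by (auto simp: Q_def)
    then have "1 \<le> \<rho> s"
      unfolding rho using that K(1) by (intro rho_ge_1) (auto simp: Q_def)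
    then show ?thesis by (auto simp: rhoR m_def)
  qed
  have \<rho>0_bound: "m \<le> \<rho>0 s" if "s \<in> Qw" for s
  proof -
    have "s \<in> Q" using that sub by auto
    then have "(K1 * c)\<^sup>2 / 2 * T powr (- 1/2) \<le> \<rho>0 s"
      unfolding rho0 using K(1) c(1) c(2)[of "fst s"] by (intro rho0_lower_bound) (auto simp: Q_def)
    then show ?thesis by (simp add: m_def)
  qed
  have sol_L2: "y \<in> L2 Q" if "weak_sol \<Omega> T a b f g y" for f g y
    using that by (auto simp: weak_sol_def energy_space_def Let_def Q_def)
  have ext: "(\<lambda>z. indicator Qw z * v z) \<in> L2 Q" if "v \<in> L2 Qw" for v :: "'a \<times> real \<Rightarrow> real"
    by (rule L2_extend[OF that sub Qw Q])
  \<comment> \<open>\<open>Ms q\<close> coincides with a backward solution \<open>\<zeta>\<close>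
    only almost everywhere on \<open>Qw\<close>. Square integrability and the pairing are therefore
    established for \<open>\<zeta>\<close> and transferred.\<close>
  have adj: "Ms q \<in> L2 Qw \<and> (\<forall>v\<in>L2 Qw. (LINT s|lborel_on Q. M v s * q s) = (LINT s|lborel_on Qw. v s * Ms q s))"
    if q: "q \<in> L2 Q" for q
  proof -
    obtain \<zeta> where \<zeta>: "adjoint_weak_sol \<Omega> T a b q \<zeta>" "Ms q \<in> borel_measurable (lborel_on Qw)"
      "AE z in lborel_on Qw. Ms q z = \<zeta> z"
      using Ms q by blast
    have "\<zeta> \<in> L2 Q" using \<zeta>(1) by (auto simp: adjoint_weak_sol_def energy_space_def Let_def Q_def)
    then have \<zeta>_L2: "\<zeta> \<in> L2 Qw" by (rule L2_subset[OF _ sub Qw Q])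
    then have Ms_L2: "Ms q \<in> L2 Qw"
      by (rule L2_cong_AE[OF _ \<zeta>(2)]) (use \<zeta>(3) in eventually_elim, simp)
    have "(LINT s|lborel_on Q. M v s * q s) = (LINT s|lborel_on Qw. v s * Ms q s)" if v: "v \<in> L2 Qw" for v
    proof -
      have "(LINT s|lborel_on Q. M v s * q s) = (LINT s|lborel_on Q. indicator Qw s * v s * \<zeta> s)"
        using weak_duality[OF \<Omega>(1,2) Q_def aL b ext[OF v] q _ \<zeta>(1)] M v by blast
      \<comment> \<open>The detour through the whole space lets the indicator of \<open>Qw\<close>
        absorb that of \<open>Q\<close>.\<close>
      also have "\<dots> = (LINT s|lborel. indicator Q s * (indicator Qw s * v s * \<zeta> s))"
        using Q by (simp add: integral_restrict_space)
      also have "\<dots> = (LINT s|lborel. indicator Qw s * (v s * \<zeta> s))"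
        using sub by (intro Bochner_Integration.integral_cong) (auto simp: indicator_def)
      also have "\<dots> = (LINT s|lborel_on Qw. v s * \<zeta> s)"
        using Qw by (simp add: integral_restrict_space)
      also have "\<dots> = (LINT s|lborel_on Qw. v s * Ms q s)"
      proof (rule integral_cong_AE)
        show "AE s in lborel_on Qw. v s * \<zeta> s = v s * Ms q s"
          using \<zeta>(3) by eventually_elim simp
      qed (use v \<zeta>_L2 Ms_L2 in \<open>auto simp: L2_def\<close>)
      finally show ?thesis .
    qed
    with Ms_L2 show ?thesis by blast
  qed
  \<comment> \<open>The truncation level \<open>R\<close> itself is the upper bound for the state
    weight.\<close>
  interpret D: weighted_duality Q Qw \<rho>R \<rho>0 ybar M Ms m R
  proof
    show "M v \<in> L2 Q" if "v \<in> L2 Qw" for v using M that sol_L2 by blast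
    show "ybar \<in> L2 Q" by (rule sol_L2[OF ybar])
  qed (use m \<rho>R_meas \<rho>0_meas \<rho>R_bounds \<rho>0_bound adj in blast)+
  show ?thesis unfolding U_def I_def Phi_def L_def by (rule D.duality)
qed

end
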